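(* Assume $\mathbb K\subset\mathbb C$. Let $\Sigma$ be a quasi-regular DAE system satisfying the primality assumption and the rank hypothesis, and let $U$, $W$, $\mathcal W$, $\mathcal V$, the parametric geometric resolution, $\underline\Sigma$, $\mathcal H$, $\Phi$, $\pi_1$ and $\mathcal G_0\subset\mathcal H$ be as defined in the context. Suppose that $\underline\varphi:(-\varepsilon,\varepsilon)\to\mathbb C^{1+\mathrm{ord}[F]}$ is an analytic solution of the DAE system $\underline\Sigma$ such that $\underline\varphi(t)\in\mathcal G_0$ for all $t$, and let $$\varphi(t)=(\varphi_0(t),\dots,\varphi_e(t)):=\pi_1\circ\Phi(\underline\varphi(t)),$$ where $\varphi_j=(\varphi_{j,1},\dots,\varphi_{j,n})$ is the block of coordinates corresponding to $X^{(j)}$, for $j=0,\dots,e$. Then $\varphi_0:(-\varepsilon,\varepsilon)\to\mathbb C^n$ is a well defined analytic function that is a solution of the DAE system $\Sigma$.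
   Context: **The system.** $\mathbb K$ is a subfield of $\mathbb C$ (a field of constants, i.e. with derivation $\delta=0$); $X=\{x_1,\dots,x_n\}$ ($n\ge 1$) are differential indeterminates; $x_i^{(j)}$ is the $j$-th formal derivative of $x_i$ (also $\dot x_i=x_i^{(1)}$); $X^{(j)}=\{x_1^{(j)},\dots,x_n^{(j)}\}$, $X^{[j]}=\{X,X^{(1)},\dots,X^{(j)}\}$. $\mathbb K\{X\}$ is the ring of differential polynomials, with the derivation extending $\delta$ and mapping $x_i^{(j)}\mapsto x_i^{(j+1)}$; $f^{(j)}$ is the $j$-th total derivative of $f$. The system $\Sigma$ is $f_1=\dots=f_n=0$ with $f_i\in\mathbb K[X^{[e_i]}]$, $e_i$ the maximal derivation order in $f_i$, and $e=\max_i e_i\ge 1$. $F=\{f_1,\dots,f_n\}$, $F^{(j)}=\{f_1^{(j)},\dots,f_n^{(j)}\}$, $F^{[j]}=\{F,F^{(1)},\dots,F^{(j)}\}$ ($F^{[-1]}=\emptyset$). $[F]$ is the differential ideal generated by $F$. $R^{(j)}=\mathbb K[X^{[j]}]$; $\mathrm{pr}^{(j)}F$ is the ideal of $R^{(j-1+e)}$ generated by $F^{[j-1]}$, and $\mathrm{pr}^{(0)}F=(0)$. Solutions are understood in the classical sense. **Primality assumption.** For all $j\ge 0$ and $0\le i\le n$, the ideal generated by $F^{[j-1]},f_1^{(j)},\dots,f_i^{(j)}$ is prime (in particular $[F]$ is prime). **Quasi-regularity of $\Sigma$.** For every $j\ge 0$ the Jacobian matrix of $F^{[j]}$ with respect to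 $X^{[j+e]}$ has full row rank over $R^{(j+e)}/([F]\cap R^{(j+e)})$. **Rank hypothesis.** For $j\ge1$, $h\ge e-1$ let $\mathfrak J_{j,h}$ be the Jacobian matrix of $F^{(h-e+1)},\dots,F^{(h-e+j)}$ with respect to $X^{(h+1)},\dots,X^{(h+j)}$. Its rank over $R^{(j+h+i)}/\mathrm{pr}^{(j+h+i-e+1)}F$ and over $R^{(j+h+i)}/([F]\cap R^{(j+h+i)})$ is the same, for all $i\ge 0$. **Index, order, $U$, $W$.** The differentiation index of $\Sigma$ is $\sigma=\min\{j\ge 0: \mathrm{pr}^{(j)}F\cap R^{(e-1)}=[F]\cap R^{(e-1)}\}$. $\mathrm{ord}[F]$ is the (eventually constant) transcendence degree over $\mathbb K$ of $\mathrm{Frac}(R^{(j)}/([F]\cap R^{(j)}))$ for $j$ large. $U\subset X^{[e-1]}$ is a set of $\mathrm{ord}[F]$ variables which is a transcendence basis over $\mathbb K$ of both $\mathrm{Frac}(R^{(e-1)}/([F]\cap R^{(e-1)}))$ and $\mathrm{Frac}(R^{(e)}/([F]\cap R^{(e)}))$ (such $U$ exists). $W$ is a set of variables in $\bigcup_{j=e+1}^{e+\sigma}X^{(j)}$, of cardinality $s=ne-\mathrm{ord}[F]$, such that $\{U,W\}$ is a transcendence basis of $\mathrm{Frac}(R^{(e+\sigma)}/\mathrm{pr}^{(\sigma+1)}F)$. $Z=X^{[e+\sigma]}\setminus(U\cup W)$, which has $(1+\sigma)n$ elements. **Specialization and $\mathcal V$.** For $\mathcal W\in\mathbb K^s$,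 $f|_{\mathcal W}$ is $f$ with the variables $W$ replaced by $\mathcal W$. $\mathcal W\in\mathbb K^s$ is fixed in a nonempty Zariski open set such that for all $1\le i\le\sigma+1$: the sequence $F^{(j)}|_{\mathcal W}$, $0\le j\le i-1$, is a reduced regular sequence (a regular sequence all of whose initial segments generate radical ideals), and no prime component of $\mathrm{pr}^{(i)}F+(W-\mathcal W)\subset R^{(e+\sigma)}$ contains a nonzero polynomial of $\mathbb K[U]$. $\mathrm{pr}^{(\sigma+1)}F|_{\mathcal W}$ is the ideal of $\mathbb K[X^{[e+\sigma]}\setminus W]$ generated by $F^{[\sigma]}|_{\mathcal W}$ (a radical ideal), and $\mathcal V$ is the equidimensional variety (of dimension $\mathrm{ord}[F]$) it defines in $\mathbb A^{\mathrm{ord}[F]+(1+\sigma)n}$. (Points of varieties are taken with complex coordinates.) **Parametric geometric resolution.** A parametric geometric resolution $(U,\upsilon,q,\{p_z/q'\}_{z\in Z})$ of $\mathcal V$ is fixed. It consists of: a $\mathbb Q$-linear form $\upsilon$ in the variables $Z$ whose class generates the $\mathbb K(U)$-algebra $\mathbb K(U)[Z]/I(\mathcal V)\mathbb K(U)[Z]$; a square-free polynomial $q\in\mathbb K[U,\upsilon]$ (in $U$ and one new indeterminate, also denoted $\upsilon$), of positive degree in $\upsilon$ and without nonconstant factors in $\mathbb K[U]$, which is the minimal polynomial of that class over $\mathbb K(U)$ (up to a factor in $\mathbb K(U)$); with $q'=\partial q/\partial\upsilon$, for each $z\in Z$, $p_z=a_z(U,\upsilon)/b_z(U)$ with $a_z\in\mathbb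 K[U,\upsilon]$, $b_z\in\mathbb K[U]\setminus\{0\}$ coprime, $\deg_\upsilon a_z<\deg_\upsilon q$, such that $b_z q' z-a_z$ vanishes on $\mathcal V$. $\mathcal H=\{q=0\}\subset\mathbb A^{\mathrm{ord}[F]+1}$, and $\Phi:\mathcal H\to\mathcal V$ is the rational map $(U,\upsilon)\mapsto(U,(p_z/q')(U,\upsilon))_{z\in Z}$. $B(U)=\prod_{z\in Z} b_z(U)$. $\pi_1:\mathbb A^{\mathrm{ord}[F]+(1+\sigma)n}\to\mathbb A^{(1+e)n}$ is the projection to the coordinates $X^{[e]}$ (note $W\cap X^{[e]}=\emptyset$). **The system $\underline\Sigma$.** Write $U=\{u_1,\dots,u_{\mathrm{ord}[F]}\}$. As $U\subset X^{[e-1]}$, each derivative $\dot u_i$ is a variable in $X^{[e]}$, hence either (a) $\dot u_i=u_h$ for a unique $h$, or (b) $\dot u_i=z$ for a unique $z\in Z$. $\underline\Sigma$ is the system in the differential unknowns $U,\upsilon$ consisting of the equations $\dot u_i-u_h=0$ in case (a), $b_z(U)q'(U,\upsilon)\dot u_i-a_z(U,\upsilon)=0$ in case (b), and $q(U,\upsilon)=0$. **The set $\mathcal G_0$.** For each variable $x_i^{(j)}\notin U$ with $0\le j\le e-1$, $1\le i\le n$, and each associated prime $\mathfrak p$ of $\mathrm{pr}^{(\sigma+1)}F|_{\mathcal W}$, let $P_{ji\mathfrak p}\in\mathbb K[U,x_i^{(j)}]$ be an irreducible polynomial lying in $\mathfrak p$, and let $P_{ji}$ be the least common multiple of the $P_{ji\mathfrak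 p}$ over all such $\mathfrak p$. Let $h$ be a positive integer such that $$P_0(U,\upsilon):=B(U)^h\, q'(U,\upsilon)^h\prod_{x_i^{(j)}\notin U,\ 0\le j\le e-1}\frac{\partial P_{ji}}{\partial x_i^{(j)}}\bigl(\Phi(U,\upsilon)\bigr)$$ is a polynomial in $\mathbb K[U,\upsilon]$ divisible by $Bq'$. Then $\mathcal G_0:=\mathcal H\cap\{P_0\ne0\}$, which is a dense Zariski open subset of $\mathcal H$ contained in the domain of definition of $\Phi$. *)

theory Defs
  imports
    "HOL-Analysis.Analysis"
    "HOL-Algebra.Algebra"
    "HOL-Library.Poly_Mapping"
begin

section \<open>Polynomials\<close>

type_synonym 'v mpoly = "('v \<Rightarrow>\<^sub>0 nat) \<Rightarrow>\<^sub>0 complex"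

definition mconst :: "complex \<Rightarrow> 'v mpoly"
  where "mconst c = Poly_Mapping.single 0 c"

definition mvar :: "'v \<Rightarrow> 'v mpoly"
  where "mvar v = Poly_Mapping.single (Poly_Mapping.single v 1) 1"

definition mvars :: "'v mpoly \<Rightarrow> 'v set"
  where "mvars p = (\<Union>m\<in>Poly_Mapping.keys p. Poly_Mapping.keys m)"

definition mdeg :: "'v \<Rightarrow> 'v mpoly \<Rightarrow> nat"
  where "mdeg v p = Max (insert 0 ((\<lambda>m. Poly_Mapping.lookup m v) ` Poly_Mapping.keys p))"

definition mhom :: "(complex \<Rightarrow> 'a) \<Rightarrow> ('v \<Rightarrow> 'a) \<Rightarrow> 'v mpoly \<Rightarrow> 'a::comm_ring_1"
  where "mhom c \<rho> p = (\<Sum>m\<in>Poly_Mapping.keys p. c (Poly_Mapping.lookup p m) *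
           (\<Prod>v\<in>Poly_Mapping.keys m. \<rho> v ^ Poly_Mapping.lookup m v))"

definition meval :: "('v \<Rightarrow> complex) \<Rightarrow> 'v mpoly \<Rightarrow> complex"
  where "meval = mhom (\<lambda>c. c)"

definition msubst :: "('v \<Rightarrow> 'w mpoly) \<Rightarrow> 'v mpoly \<Rightarrow> 'w mpoly"
  where "msubst = mhom mconst"

definition mpderiv :: "'v \<Rightarrow> 'v mpoly \<Rightarrow> 'v mpoly"
  where "mpderiv v p = (\<Sum>m\<in>Poly_Mapping.keys p.
           Poly_Mapping.single (m - Poly_Mapping.single v 1)
             (of_nat (Poly_Mapping.lookup m v) * Poly_Mapping.lookup p m))"

definition polys :: "complex set \<Rightarrow> 'v set \<Rightarrow> 'v mpoly set"
  where "polys K V = {p. (\<forall>m. Poly_Mapping.lookup p m \<in> K) \<and> mvars p \<subseteq> V}"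

definition cring_on :: "'a::comm_ring_1 set \<Rightarrow> 'a ring"
  where "cring_on A = \<lparr>carrier = A, monoid.mult = (*), one = 1, ring.zero = 0, add = (+)\<rparr>"

definition mpoly_ring :: "complex set \<Rightarrow> 'v set \<Rightarrow> 'v mpoly ring"
  where "mpoly_ring K V = cring_on (polys K V)"


section \<open>Commutative algebra\<close>

definition loc_rel :: "('a, 'm) ring_scheme \<Rightarrow> 'a set \<Rightarrow> (('a \<times> 'a) \<times> ('a \<times> 'a)) set"
  where "loc_rel D S = {((a, s), (b, t)). a \<in> carrier D \<and> b \<in> carrier D \<and> s \<in> S \<and> t \<in> S \<and>
           (\<exists>w\<in>S. w \<otimes>\<^bsub>D\<^esub> (a \<otimes>\<^bsub>D\<^esub> t) = w \<otimes>\<^bsub>D\<^esub> (b \<otimes>\<^bsub>D\<^esub> s))}"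

definition loc_frac :: "('a, 'm) ring_scheme \<Rightarrow> 'a set \<Rightarrow> 'a \<Rightarrow> 'a \<Rightarrow> ('a \<times> 'a) set"
  where "loc_frac D S a s = loc_rel D S `` {(a, s)}"

definition localization :: "('a, 'm) ring_scheme \<Rightarrow> 'a set \<Rightarrow> ('a \<times> 'a) set ring"
  where "localization D S =
    \<lparr>carrier = (carrier D \<times> S) // loc_rel D S,
     monoid.mult = (\<lambda>x y. \<Union>(a, s)\<in>x. \<Union>(b, t)\<in>y. loc_frac D S (a \<otimes>\<^bsub>D\<^esub> b) (s \<otimes>\<^bsub>D\<^esub> t)),
     one = loc_frac D S \<one>\<^bsub>D\<^esub> \<one>\<^bsub>D\<^esub>,
     ring.zero = loc_frac D S \<zero>\<^bsub>D\<^esub> \<one>\<^bsub>D\<^esub>,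
     add = (\<lambda>x y. \<Union>(a, s)\<in>x. \<Union>(b, t)\<in>y.
              loc_frac D S (a \<otimes>\<^bsub>D\<^esub> t \<oplus>\<^bsub>D\<^esub> b \<otimes>\<^bsub>D\<^esub> s) (s \<otimes>\<^bsub>D\<^esub> t))\<rparr>"

definition frac_field :: "('a, 'm) ring_scheme \<Rightarrow> ('a \<times> 'a) set ring"
  where "frac_field D = localization D (carrier D - {\<zero>\<^bsub>D\<^esub>})"

definition quot_field :: "('a, 'm) ring_scheme \<Rightarrow> 'a set \<Rightarrow> ('a set \<times> 'a set) set ring"
  where "quot_field R P = frac_field (R Quot P)"

definition quot_class :: "('a, 'm) ring_scheme \<Rightarrow> 'a set \<Rightarrow> 'a \<Rightarrow> ('a set \<times> 'a set) set"
  where "quot_class R P p =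
    loc_frac (R Quot P) (carrier (R Quot P) - {\<zero>\<^bsub>R Quot P\<^esub>}) (P +>\<^bsub>R\<^esub> p) \<one>\<^bsub>R Quot P\<^esub>"

text \<open>In the next definitions \<open>c\<close> is the embedding of the constants \<open>K\<close> into the field \<open>L\<close>.\<close>

definition alg_eval :: "('l, 'm) ring_scheme \<Rightarrow> (complex \<Rightarrow> 'l) \<Rightarrow> ('v \<Rightarrow> 'l) \<Rightarrow> 'v mpoly \<Rightarrow> 'l"
  where "alg_eval L c \<rho> p = (\<Oplus>\<^bsub>L\<^esub>m\<in>Poly_Mapping.keys p. c (Poly_Mapping.lookup p m) \<otimes>\<^bsub>L\<^esub>
           (\<Otimes>\<^bsub>L\<^esub>v\<in>Poly_Mapping.keys m. \<rho> v [^]\<^bsub>L\<^esub> Poly_Mapping.lookup m v))"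

definition alg_independent ::
    "complex set \<Rightarrow> (complex \<Rightarrow> 'l) \<Rightarrow> ('l, 'm) ring_scheme \<Rightarrow> 'l set \<Rightarrow> bool"
  where "alg_independent K c L B \<longleftrightarrow>
    B \<subseteq> carrier L \<and> (\<forall>p\<in>polys K B. alg_eval L c (\<lambda>b. b) p = \<zero>\<^bsub>L\<^esub> \<longrightarrow> p = 0)"

definition transcendence_basis ::
    "complex set \<Rightarrow> (complex \<Rightarrow> 'l) \<Rightarrow> ('l, 'm) ring_scheme \<Rightarrow> 'l set \<Rightarrow> bool"
  where "transcendence_basis K c L B \<longleftrightarrow> alg_independent K c L B \<and>
    (\<forall>x\<in>carrier L. (ring.algebraic L over generate_field L (c ` K \<union> B)) x)"

definition trdeg_is ::
    "complex set \<Rightarrow> (complex \<Rightarrow> 'l) \<Rightarrow> ('l, 'm) ring_scheme \<Rightarrow> nat \<Rightarrow> bool"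
  where "trdeg_is K c L d \<longleftrightarrow> (\<exists>B. transcendence_basis K c L B \<and> finite B \<and> card B = d)"

definition vars_transcendence_basis ::
    "complex set \<Rightarrow> 'v mpoly ring \<Rightarrow> 'v mpoly set \<Rightarrow> 'v set \<Rightarrow> bool"
  where "vars_transcendence_basis K R P B \<longleftrightarrow>
    inj_on (\<lambda>v. quot_class R P (mvar v)) B \<and>
    transcendence_basis K (\<lambda>c. quot_class R P (mconst c)) (quot_field R P)
      ((\<lambda>v. quot_class R P (mvar v)) ` B)"

text \<open>The rank of the matrix \<open>(M r k)\<close>, \<open>r \<in> A\<close>, \<open>k \<in> C\<close>, over the field \<open>L\<close>.\<close>

definition rows_independent ::
    "('l, 'm) ring_scheme \<Rightarrow> ('r \<Rightarrow> 'c \<Rightarrow> 'l) \<Rightarrow> 'r set \<Rightarrow> 'c set \<Rightarrow> bool"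
  where "rows_independent L M A C \<longleftrightarrow>
    (\<forall>l\<in>A \<rightarrow> carrier L. (\<forall>k\<in>C. (\<Oplus>\<^bsub>L\<^esub>r\<in>A. l r \<otimes>\<^bsub>L\<^esub> M r k) = \<zero>\<^bsub>L\<^esub>) \<longrightarrow> (\<forall>r\<in>A. l r = \<zero>\<^bsub>L\<^esub>))"

definition matrix_rank ::
    "('l, 'm) ring_scheme \<Rightarrow> ('r \<Rightarrow> 'c \<Rightarrow> 'l) \<Rightarrow> 'r set \<Rightarrow> 'c set \<Rightarrow> nat"
  where "matrix_rank L M A C = Max (card ` {B. B \<subseteq> A \<and> rows_independent L M B C})"

text \<open>The rank of a polynomial matrix over the domain \<open>R/P\<close> is its rank over the fraction field.\<close>

definition rank_mod ::
    "'v mpoly ring \<Rightarrow> 'v mpoly set \<Rightarrow> ('r \<Rightarrow> 'c \<Rightarrow> 'v mpoly) \<Rightarrow> 'r set \<Rightarrow> 'c set \<Rightarrow> nat"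
  where "rank_mod R P M A C =
    matrix_rank (quot_field R P) (\<lambda>r k. quot_class R P (M r k)) A C"

definition radical_ideal :: "('a, 'm) ring_scheme \<Rightarrow> 'a set \<Rightarrow> bool"
  where "radical_ideal R I \<longleftrightarrow> ideal I R \<and>
    (\<forall>x\<in>carrier R. \<forall>k::nat. x [^]\<^bsub>R\<^esub> k \<in> I \<longrightarrow> x \<in> I)"

definition minimal_primes :: "('a, 'm) ring_scheme \<Rightarrow> 'a set \<Rightarrow> 'a set set"
  where "minimal_primes R I = {P. primeideal P R \<and> I \<subseteq> P \<and>
    (\<forall>Q. primeideal Q R \<and> I \<subseteq> Q \<and> Q \<subseteq> P \<longrightarrow> Q = P)}"

definition associated_primes :: "('a, 'm) ring_scheme \<Rightarrow> 'a set \<Rightarrow> 'a set set"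
  where "associated_primes R I = {P. primeideal P R \<and>
    (\<exists>g\<in>carrier R. P = {x \<in> carrier R. x \<otimes>\<^bsub>R\<^esub> g \<in> I})}"

definition regular_sequence :: "('a, 'm) ring_scheme \<Rightarrow> 'a list \<Rightarrow> bool"
  where "regular_sequence R gs \<longleftrightarrow> set gs \<subseteq> carrier R \<and>
    (\<forall>k<length gs. \<forall>x\<in>carrier R.
       x \<otimes>\<^bsub>R\<^esub> (gs ! k) \<in> genideal R (set (take k gs)) \<longrightarrow> x \<in> genideal R (set (take k gs))) \<and>
    genideal R (set gs) \<noteq> carrier R"

definition reduced_regular_sequence :: "('a, 'm) ring_scheme \<Rightarrow> 'a list \<Rightarrow> bool"
  where "reduced_regular_sequence R gs \<longleftrightarrow> regular_sequence R gs \<and>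
    (\<forall>k\<le>length gs. radical_ideal R (genideal R (set (take k gs))))"

definition is_lcm_of :: "('a, 'm) ring_scheme \<Rightarrow> 'a \<Rightarrow> 'a set \<Rightarrow> bool"
  where "is_lcm_of R x A \<longleftrightarrow> x \<in> carrier R \<and> (\<forall>a\<in>A. a divides\<^bsub>R\<^esub> x) \<and>
    (\<forall>y\<in>carrier R. (\<forall>a\<in>A. a divides\<^bsub>R\<^esub> y) \<longrightarrow> x divides\<^bsub>R\<^esub> y)"

definition is_coprime :: "('a, 'm) ring_scheme \<Rightarrow> 'a \<Rightarrow> 'a \<Rightarrow> bool"
  where "is_coprime R x y \<longleftrightarrow>
    (\<forall>g\<in>carrier R. g divides\<^bsub>R\<^esub> x \<and> g divides\<^bsub>R\<^esub> y \<longrightarrow> g \<in> Units R)"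

definition is_squarefree :: "('a, 'm) ring_scheme \<Rightarrow> 'a \<Rightarrow> bool"
  where "is_squarefree R x \<longleftrightarrow>
    (\<forall>g\<in>carrier R. (g \<otimes>\<^bsub>R\<^esub> g) divides\<^bsub>R\<^esub> x \<longrightarrow> g \<in> Units R)"


section \<open>Affine varieties\<close>

text \<open>A point of the affine space with coordinates \<open>S\<close> is an extensional function on \<open>S\<close>.\<close>

definition affine_space :: "'v set \<Rightarrow> ('v \<Rightarrow> complex) set"
  where "affine_space S = S \<rightarrow>\<^sub>E UNIV"

definition zero_set :: "'v set \<Rightarrow> 'v mpoly set \<Rightarrow> ('v \<Rightarrow> complex) set"
  where "zero_set S G = {x \<in> affine_space S. \<forall>g\<in>G. meval x g = 0}"

definition vanishing_ideal :: "complex set \<Rightarrow> 'v set \<Rightarrow> ('v \<Rightarrow> complex) set \<Rightarrow> 'v mpoly set"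
  where "vanishing_ideal K S Y = {p \<in> polys K S. \<forall>x\<in>Y. meval x p = 0}"

definition zariski_open :: "complex set \<Rightarrow> 'v set \<Rightarrow> ('v \<Rightarrow> complex) set \<Rightarrow> bool"
  where "zariski_open K S Y \<longleftrightarrow>
    (\<exists>G. G \<subseteq> polys K S \<and> Y = {x \<in> S \<rightarrow>\<^sub>E K. \<exists>g\<in>G. meval x g \<noteq> 0})"


section \<open>Differential polynomials and classical solutions\<close>

text \<open>The pair \<open>(x, j)\<close> stands for the \<open>j\<close>-th formal derivative of the differential
  indeterminate \<open>x\<close>. All constants have derivative zero.\<close>

type_synonym 'x dpoly = "('x \<times> nat) mpoly"

definition total_deriv :: "'x dpoly \<Rightarrow> 'x dpoly"
  where "total_deriv p = (\<Sum>v\<in>mvars p. mpderiv v p * mvar (fst v, Suc (snd v)))"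

definition diff_order :: "'x dpoly \<Rightarrow> nat"
  where "diff_order p = Max (insert 0 (snd ` mvars p))"

definition iter_deriv :: "nat \<Rightarrow> (real \<Rightarrow> complex) \<Rightarrow> real \<Rightarrow> complex"
  where "iter_deriv j = (\<lambda>g t. vector_derivative g (at t)) ^^ j"

definition classical_solution :: "real set \<Rightarrow> 'x dpoly set \<Rightarrow> (real \<Rightarrow> 'x \<Rightarrow> complex) \<Rightarrow> bool"
  where "classical_solution T G \<phi> \<longleftrightarrow>
    (\<forall>t\<in>T. \<forall>g\<in>G.
       (\<forall>(x, j)\<in>mvars g. \<forall>i<j. iter_deriv i (\<lambda>t. \<phi> t x) differentiable (at t)) \<and>
       meval (\<lambda>(x, j). iter_deriv j (\<lambda>t. \<phi> t x) t) g = 0)"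

definition real_analytic_on :: "(real \<Rightarrow> complex) \<Rightarrow> real set \<Rightarrow> bool"
  where "real_analytic_on g T \<longleftrightarrow>
    (\<forall>t0\<in>T. \<exists>r>0. \<exists>a. \<forall>t. \<bar>t - t0\<bar> < r \<longrightarrow> (\<lambda>k. a k * of_real (t - t0) ^ k) sums g t)"


section \<open>The system\<close>

text \<open>The indeterminates are \<open>1, \<dots>, n\<close>, and \<open>f i\<close> is the \<open>i\<close>-th equation.\<close>

type_synonym xvar = "nat \<times> nat"

definition Xupto :: "nat \<Rightarrow> nat \<Rightarrow> xvar set"
  where "Xupto n j = {1..n} \<times> {..j}"

definition diff_poly_ring :: "complex set \<Rightarrow> nat \<Rightarrow> nat dpoly ring"
  where "diff_poly_ring K n = mpoly_ring K ({1..n} \<times> UNIV)"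

definition Rring :: "complex set \<Rightarrow> nat \<Rightarrow> nat \<Rightarrow> nat dpoly ring"
  where "Rring K n j = mpoly_ring K (Xupto n j)"

definition fder :: "(nat \<Rightarrow> nat dpoly) \<Rightarrow> nat \<Rightarrow> nat \<Rightarrow> nat dpoly"
  where "fder f k i = (total_deriv ^^ k) (f i)"

text \<open>\<open>Fbelow n f j\<close> collects the derivatives of order strictly less than \<open>j\<close>.\<close>

definition Fbelow :: "nat \<Rightarrow> (nat \<Rightarrow> nat dpoly) \<Rightarrow> nat \<Rightarrow> nat dpoly set"
  where "Fbelow n f j = {fder f k i | k i. k < j \<and> i \<in> {1..n}}"

definition system_order :: "nat \<Rightarrow> (nat \<Rightarrow> nat dpoly) \<Rightarrow> nat"
  where "system_order n f = Max ((\<lambda>i. diff_order (f i)) ` {1..n})"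

definition diff_ideal :: "complex set \<Rightarrow> nat \<Rightarrow> (nat \<Rightarrow> nat dpoly) \<Rightarrow> nat dpoly set"
  where "diff_ideal K n f = \<Inter>{I. ideal I (diff_poly_ring K n) \<and>
           (\<forall>p\<in>I. total_deriv p \<in> I) \<and> f ` {1..n} \<subseteq> I}"

definition diff_ideal_upto ::
    "complex set \<Rightarrow> nat \<Rightarrow> (nat \<Rightarrow> nat dpoly) \<Rightarrow> nat \<Rightarrow> nat dpoly set"
  where "diff_ideal_upto K n f j = diff_ideal K n f \<inter> polys K (Xupto n j)"

text \<open>For \<open>e \<ge> 1\<close>, \<open>prolongation K n e f j\<close> is an ideal of \<open>Rring K n (e + j - 1)\<close>; for \<open>j = 0\<close>
  it is the zero ideal, being generated by the empty set.\<close>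

definition prolongation ::
    "complex set \<Rightarrow> nat \<Rightarrow> nat \<Rightarrow> (nat \<Rightarrow> nat dpoly) \<Rightarrow> nat \<Rightarrow> nat dpoly set"
  where "prolongation K n e f j = genideal (Rring K n (e + j - 1)) (Fbelow n f j)"

text \<open>Primality of these ideals does not depend on the polynomial ring chosen, as long as it contains
  the generators.\<close>

definition primality :: "complex set \<Rightarrow> nat \<Rightarrow> nat \<Rightarrow> (nat \<Rightarrow> nat dpoly) \<Rightarrow> bool"
  where "primality K n e f \<longleftrightarrow>
    (\<forall>j. \<forall>i\<le>n. primeideal
       (genideal (Rring K n (e + j)) (Fbelow n f j \<union> fder f j ` {1..i})) (Rring K n (e + j)))"

text \<open>Rows of Jacobian matrices are indexed by pairs \<open>(k, i)\<close>: the \<open>k\<close>-th derivative of \<open>f i\<close>.\<close>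

definition jacobian :: "(nat \<Rightarrow> nat dpoly) \<Rightarrow> nat \<times> nat \<Rightarrow> xvar \<Rightarrow> nat dpoly"
  where "jacobian f r v = mpderiv v (fder f (fst r) (snd r))"

definition quasi_regular :: "complex set \<Rightarrow> nat \<Rightarrow> nat \<Rightarrow> (nat \<Rightarrow> nat dpoly) \<Rightarrow> bool"
  where "quasi_regular K n e f \<longleftrightarrow>
    (\<forall>j. rank_mod (Rring K n (j + e)) (diff_ideal_upto K n f (j + e)) (jacobian f)
           ({..j} \<times> {1..n}) (Xupto n (j + e)) = card ({..j} \<times> {1..n}))"

definition rank_hypothesis :: "complex set \<Rightarrow> nat \<Rightarrow> nat \<Rightarrow> (nat \<Rightarrow> nat dpoly) \<Rightarrow> bool"
  where "rank_hypothesis K n e f \<longleftrightarrow>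
    (\<forall>j\<ge>1. \<forall>h\<ge>e - 1. \<forall>i.
       rank_mod (Rring K n (j + h + i)) (prolongation K n e f (j + h + i + 1 - e)) (jacobian f)
         ({h + 1 - e..h + j - e} \<times> {1..n}) ({1..n} \<times> {h + 1..h + j}) =
       rank_mod (Rring K n (j + h + i)) (diff_ideal_upto K n f (j + h + i)) (jacobian f)
         ({h + 1 - e..h + j - e} \<times> {1..n}) ({1..n} \<times> {h + 1..h + j}))"

definition is_diff_index ::
    "complex set \<Rightarrow> nat \<Rightarrow> nat \<Rightarrow> (nat \<Rightarrow> nat dpoly) \<Rightarrow> nat \<Rightarrow> bool"
  where "is_diff_index K n e f \<sigma> \<longleftrightarrow>
    is_arg_min id (\<lambda>j. prolongation K n e f j \<inter> polys K (Xupto n (e - 1)) =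
      diff_ideal_upto K n f (e - 1)) \<sigma>"

definition is_ideal_order :: "complex set \<Rightarrow> nat \<Rightarrow> (nat \<Rightarrow> nat dpoly) \<Rightarrow> nat \<Rightarrow> bool"
  where "is_ideal_order K n f d \<longleftrightarrow>
    (\<forall>\<^sub>F j in sequentially.
       trdeg_is K (\<lambda>c. quot_class (Rring K n j) (diff_ideal_upto K n f j) (mconst c))
         (quot_field (Rring K n j) (diff_ideal_upto K n f j)) d)"


section \<open>Specialization\<close>

definition specialize :: "'v set \<Rightarrow> ('v \<Rightarrow> complex) \<Rightarrow> 'v mpoly \<Rightarrow> 'v mpoly"
  where "specialize W w = msubst (\<lambda>v. if v \<in> W then mconst (w v) else mvar v)"

definition spec_sequence ::
    "nat \<Rightarrow> (nat \<Rightarrow> nat dpoly) \<Rightarrow> xvar set \<Rightarrow> (xvar \<Rightarrow> complex) \<Rightarrow> nat \<Rightarrow> nat dpoly list"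
  where "spec_sequence n f W w i =
    concat (map (\<lambda>k. map (\<lambda>l. specialize W w (fder f k l)) [1..<Suc n]) [0..<i])"

definition good_specialization ::
    "complex set \<Rightarrow> nat \<Rightarrow> nat \<Rightarrow> (nat \<Rightarrow> nat dpoly) \<Rightarrow> nat \<Rightarrow> xvar set \<Rightarrow> xvar set \<Rightarrow>
     (xvar \<Rightarrow> complex) \<Rightarrow> bool"
  where "good_specialization K n e f \<sigma> U W w \<longleftrightarrow>
    (\<forall>i\<in>{1..\<sigma> + 1}.
       reduced_regular_sequence (mpoly_ring K (Xupto n (e + \<sigma>) - W)) (spec_sequence n f W w i) \<and>
       (\<forall>P\<in>minimal_primes (Rring K n (e + \<sigma>))
              (genideal (Rring K n (e + \<sigma>)) (Fbelow n f i \<union> (\<lambda>v. mvar v - mconst (w v)) ` W)).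
          P \<inter> polys K U \<subseteq> {0}))"

definition spec_prolongation ::
    "complex set \<Rightarrow> nat \<Rightarrow> nat \<Rightarrow> (nat \<Rightarrow> nat dpoly) \<Rightarrow> nat \<Rightarrow> xvar set \<Rightarrow> (xvar \<Rightarrow> complex) \<Rightarrow>
     nat dpoly set"
  where "spec_prolongation K n e f \<sigma> W w =
    genideal (mpoly_ring K (Xupto n (e + \<sigma>) - W)) (specialize W w ` Fbelow n f (\<sigma> + 1))"

definition spec_variety ::
    "complex set \<Rightarrow> nat \<Rightarrow> nat \<Rightarrow> (nat \<Rightarrow> nat dpoly) \<Rightarrow> nat \<Rightarrow> xvar set \<Rightarrow> (xvar \<Rightarrow> complex) \<Rightarrow>
     (xvar \<Rightarrow> complex) set"
  where "spec_variety K n e f \<sigma> W w =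
    zero_set (Xupto n (e + \<sigma>) - W) (spec_prolongation K n e f \<sigma> W w)"


section \<open>Parametric geometric resolutions\<close>

text \<open>In \<open>'v option\<close>, \<open>None\<close> is the new indeterminate \<open>\<upsilon>\<close>, and \<open>Some u\<close> is the variable \<open>u\<close>.\<close>

definition Uups :: "'v set \<Rightarrow> 'v option set"
  where "Uups U = insert None (Some ` U)"

text \<open>The ring \<open>K(U)[Z]\<close>, as the localization of \<open>K[U, Z]\<close> at the nonzero elements of \<open>K[U]\<close>,
  and its quotient by the extension of an ideal \<open>I\<close> of \<open>K[U, Z]\<close>.\<close>

definition KU_poly_ring :: "complex set \<Rightarrow> 'v set \<Rightarrow> 'v set \<Rightarrow> ('v mpoly \<times> 'v mpoly) set ring"
  where "KU_poly_ring K U Z = localization (mpoly_ring K (U \<union> Z)) (polys K U - {0})"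

definition KU_frac ::
    "complex set \<Rightarrow> 'v set \<Rightarrow> 'v set \<Rightarrow> 'v mpoly \<Rightarrow> 'v mpoly \<Rightarrow> ('v mpoly \<times> 'v mpoly) set"
  where "KU_frac K U Z = loc_frac (mpoly_ring K (U \<union> Z)) (polys K U - {0})"

definition KU_ideal ::
    "complex set \<Rightarrow> 'v set \<Rightarrow> 'v set \<Rightarrow> 'v mpoly set \<Rightarrow> ('v mpoly \<times> 'v mpoly) set set"
  where "KU_ideal K U Z I = genideal (KU_poly_ring K U Z) ((\<lambda>p. KU_frac K U Z p 1) ` I)"

definition KU_algebra ::
    "complex set \<Rightarrow> 'v set \<Rightarrow> 'v set \<Rightarrow> 'v mpoly set \<Rightarrow> ('v mpoly \<times> 'v mpoly) set set ring"
  where "KU_algebra K U Z I = KU_poly_ring K U Z Quot KU_ideal K U Z I"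

definition KU_class ::
    "complex set \<Rightarrow> 'v set \<Rightarrow> 'v set \<Rightarrow> 'v mpoly set \<Rightarrow> 'v mpoly \<Rightarrow> 'v mpoly \<Rightarrow>
     ('v mpoly \<times> 'v mpoly) set set"
  where "KU_class K U Z I a b =
    KU_ideal K U Z I +>\<^bsub>KU_poly_ring K U Z\<^esub> KU_frac K U Z a b"

definition KU_generator :: "complex set \<Rightarrow> 'v set \<Rightarrow> 'v set \<Rightarrow> 'v mpoly set \<Rightarrow> 'v mpoly \<Rightarrow> bool"
  where "KU_generator K U Z I l \<longleftrightarrow>
    generate_ring (KU_algebra K U Z I)
      (insert (KU_class K U Z I l 1)
        {KU_class K U Z I a b | a b. a \<in> polys K U \<and> b \<in> polys K U - {0}}) =
    carrier (KU_algebra K U Z I)"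

definition subst_ups :: "'v mpoly \<Rightarrow> 'v option mpoly \<Rightarrow> 'v mpoly"
  where "subst_ups l = msubst (case_option l mvar)"

text \<open>Minimal polynomials over \<open>K(U)\<close> are taken up to nonzero factors in \<open>K(U)\<close>. As every nonzero
  element of \<open>K(U)[\<upsilon>]\<close> has such a multiple in \<open>K[U, \<upsilon>]\<close>, the latter ring suffices to test
  minimality of the degree.\<close>

definition KU_minimal_poly ::
    "complex set \<Rightarrow> 'v set \<Rightarrow> 'v set \<Rightarrow> 'v mpoly set \<Rightarrow> 'v mpoly \<Rightarrow> 'v option mpoly \<Rightarrow> bool"
  where "KU_minimal_poly K U Z I l q \<longleftrightarrow>
    q \<in> polys K (Uups U) \<and> q \<noteq> 0 \<and>
    KU_class K U Z I (subst_ups l q) 1 = \<zero>\<^bsub>KU_algebra K U Z I\<^esub> \<and>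
    (\<forall>g\<in>polys K (Uups U).
       g \<noteq> 0 \<and> KU_class K U Z I (subst_ups l g) 1 = \<zero>\<^bsub>KU_algebra K U Z I\<^esub> \<longrightarrow>
       mdeg None q \<le> mdeg None g)"

definition geometric_resolution ::
    "complex set \<Rightarrow> 'v set \<Rightarrow> 'v set \<Rightarrow> ('v \<Rightarrow> complex) set \<Rightarrow> 'v mpoly \<Rightarrow> 'v option mpoly \<Rightarrow>
     ('v \<Rightarrow> 'v option mpoly) \<Rightarrow> ('v \<Rightarrow> 'v option mpoly) \<Rightarrow> bool"
  where "geometric_resolution K U Z Y l q a b \<longleftrightarrow>
    (\<exists>c :: 'v \<Rightarrow> rat. l = (\<Sum>z\<in>Z. mconst (of_rat (c z)) * mvar z)) \<and>
    KU_generator K U Z (vanishing_ideal K (U \<union> Z) Y) l \<and>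
    KU_minimal_poly K U Z (vanishing_ideal K (U \<union> Z) Y) l q \<and>
    is_squarefree (mpoly_ring K (Uups U)) q \<and>
    mdeg None q > 0 \<and>
    (\<forall>g\<in>polys K (Some ` U). g divides\<^bsub>mpoly_ring K (Uups U)\<^esub> q \<longrightarrow> mvars g = {}) \<and>
    (\<forall>z\<in>Z.
       a z \<in> polys K (Uups U) \<and> b z \<in> polys K (Some ` U) - {0} \<and>
       is_coprime (mpoly_ring K (Uups U)) (a z) (b z) \<and>
       mdeg None (a z) < mdeg None q \<and>
       (\<forall>y\<in>Y. meval y (subst_ups l (b z * mpderiv None q) * mvar z - subst_ups l (a z)) = 0))"

definition hypersurface :: "'v set \<Rightarrow> 'v option mpoly \<Rightarrow> ('v option \<Rightarrow> complex) set"
  where "hypersurface U q = zero_set (Uups U) {q}"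

text \<open>Outside \<open>param_domain\<close> the values of \<open>param_map\<close> are meaningless.\<close>

definition param_map ::
    "'v set \<Rightarrow> 'v set \<Rightarrow> 'v option mpoly \<Rightarrow> ('v \<Rightarrow> 'v option mpoly) \<Rightarrow> ('v \<Rightarrow> 'v option mpoly) \<Rightarrow>
     ('v option \<Rightarrow> complex) \<Rightarrow> 'v \<Rightarrow> complex"
  where "param_map U Z q a b y = (\<lambda>v\<in>U \<union> Z.
    if v \<in> U then y (Some v) else meval y (a v) / (meval y (b v) * meval y (mpderiv None q)))"

definition param_domain ::
    "'v set \<Rightarrow> 'v set \<Rightarrow> 'v option mpoly \<Rightarrow> ('v \<Rightarrow> 'v option mpoly) \<Rightarrow> ('v option \<Rightarrow> complex) set"
  where "param_domain U Z q b = {y \<in> affine_space (Uups U).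
    meval y (mpderiv None q) \<noteq> 0 \<and> (\<forall>z\<in>Z. meval y (b z) \<noteq> 0)}"


section \<open>The reduced system\<close>

text \<open>The unknowns are the elements of \<open>Uups U\<close>; \<open>order0\<close> views polynomials in them as
  differential polynomials of order zero.\<close>

definition order0 :: "'y mpoly \<Rightarrow> 'y dpoly"
  where "order0 = msubst (\<lambda>y. mvar (y, 0))"

definition dvar :: "xvar \<Rightarrow> xvar"
  where "dvar v = (fst v, Suc (snd v))"

text \<open>If \<open>dvar u \<notin> U\<close> for some \<open>u \<in> U\<close>, then \<open>dvar u\<close> is one of the variables \<open>Z\<close>, because \<open>U\<close>
  has orders below \<open>e\<close> and \<open>W\<close> has orders above \<open>e\<close>.\<close>

definition reduced_system ::
    "xvar set \<Rightarrow> xvar option mpoly \<Rightarrow> (xvar \<Rightarrow> xvar option mpoly) \<Rightarrow> (xvar \<Rightarrow> xvar option mpoly) \<Rightarrow>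
     xvar option dpoly set"
  where "reduced_system U q a b =
    {mvar (Some u, 1) - mvar (Some (dvar u), 0) | u. u \<in> U \<and> dvar u \<in> U} \<union>
    {order0 (b (dvar u) * mpderiv None q) * mvar (Some u, 1) - order0 (a (dvar u)) | u.
       u \<in> U \<and> dvar u \<notin> U} \<union>
    {order0 q}"


definition is_eliminant_family ::
    "complex set \<Rightarrow> 'v set \<Rightarrow> 'v set \<Rightarrow> 'v mpoly set set \<Rightarrow> ('v \<Rightarrow> 'v mpoly set \<Rightarrow> 'v mpoly) \<Rightarrow>
     ('v \<Rightarrow> 'v mpoly) \<Rightarrow> bool"
  where "is_eliminant_family K U A Ps Pp P \<longleftrightarrow>
    (\<forall>x\<in>A.
       (\<forall>\<pp>\<in>Ps. Pp x \<pp> \<in> polys K (insert x U) \<and>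
          ring_irreducible\<^bsub>mpoly_ring K (insert x U)\<^esub> (Pp x \<pp>) \<and> Pp x \<pp> \<in> \<pp>) \<and>
       is_lcm_of (mpoly_ring K (insert x U)) (P x) (Pp x ` Ps))"

text \<open>\<open>P0\<close> is the polynomial that, as a rational function, equals
  \<open>B\<^sup>h q'\<^sup>h \<Prod>\<^sub>x (\<partial>P\<^sub>x/\<partial>x)(\<Phi>(U, \<upsilon>))\<close>. The denominators of the latter divide a power of \<open>B q'\<close>, so that
  equality can be tested on the dense open set where \<open>B q'\<close> does not vanish.\<close>

definition is_G0_poly ::
    "complex set \<Rightarrow> 'v set \<Rightarrow> 'v set \<Rightarrow> 'v option mpoly \<Rightarrow> ('v \<Rightarrow> 'v option mpoly) \<Rightarrow>
     ('v \<Rightarrow> 'v option mpoly) \<Rightarrow> 'v set \<Rightarrow> ('v \<Rightarrow> 'v mpoly) \<Rightarrow> nat \<Rightarrow> 'v option mpoly \<Rightarrow> bool"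
  where "is_G0_poly K U Z q a b A P h P0 \<longleftrightarrow>
    P0 \<in> polys K (Uups U) \<and>
    (\<forall>y\<in>param_domain U Z q b.
       meval y P0 = meval y (\<Prod>z\<in>Z. b z) ^ h * meval y (mpderiv None q) ^ h *
         (\<Prod>x\<in>A. meval (param_map U Z q a b y) (mpderiv x (P x)))) \<and>
    ((\<Prod>z\<in>Z. b z) * mpderiv None q) divides\<^bsub>mpoly_ring K (Uups U)\<^esub> P0"

end

theory Submission
  imports Defs "HOL-Complex_Analysis.Complex_Analysis"
    "HOL-Computational_Algebra.Fundamental_Theorem_Algebra"
begin

text \<open>The equations of \<open>\<Sigma>\<close> vanish along \<open>\<Phi>(\<psi>(t))\<close>, because \<open>\<Phi>\<close> maps the part of the hypersurface
  where \<open>B q' \<noteq> 0\<close> into \<open>\<V>\<close>. It remains to see that the coordinate \<open>(i, j + 1)\<close> is the derivative of the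
  coordinate \<open>(i, j)\<close> for \<open>j < e\<close>. For variables in \<open>U\<close> this is what the reduced system says. For any
  other variable \<open>x\<close>, the eliminant \<open>P\<close> lies in the part of \<open>[F]\<close> of order at most \<open>e - 1\<close>, which by
  definition of the index is contained in the \<open>\<sigma>\<close>-th prolongation: the associated primes of the
  specialized ideal contain no nonzero element of \<open>K[U]\<close>, whereas modulo \<open>[F]\<close> every nonzero polynomial of
  order at most \<open>e - 1\<close> has a nonzero multiple in \<open>K[U]\<close>. Hence the total derivative of \<open>P\<close> lies in the
  \<open>(\<sigma> + 1)\<close>-st prolongation, involves none of the variables \<open>W\<close>, and so vanishes at \<open>\<Phi>(\<psi>(t))\<close>. Comparing
  it with the derivative of \<open>P(\<Phi>(\<psi>(t))) = 0\<close> gives the claim, as \<open>\<partial>P/\<partial>x\<close> does not vanish on \<open>G0\<close>.\<close>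

section \<open>Polynomials and their evaluation\<close>

text \<open>The delicate point is that the curve may pass through non-generic points. The identities
  of a resolution hold over K(U), that is, up to factors in K[U], whereas \<open>P0\<close> only
  excludes zeros of \<open>B\<close>, of \<open>q'\<close> and of the derivatives of the eliminants.
  Such a factor may well vanish at the point at hand. The gap is closed by perturbation: where
  \<open>q'\<close> is nonzero, a root of \<open>q\<close> moves continuously with the other
  coordinates, so the point is a limit of zeros of \<open>q\<close> at which the factor is nonzero.
  The orders fit tightly. The index compares ideals only up to order e - 1; one differentiation
  costs one prolongation and one order, and order e is the last one before \<open>W\<close> begins.
  The eliminants belong to associated primes in the ring without \<open>W\<close>, but genericity is
  assumed for minimal primes in the ring with \<open>W\<close>. Radicality turns associated primes
  into minimal ones, and pulling back along the specialization passes from one ring to the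
  other.\<close>

lemma poly_mapping_sum_single:
  "(\<Sum>m\<in>Poly_Mapping.keys p. Poly_Mapping.single m (Poly_Mapping.lookup p m)) = p"
  by (rule poly_mapping_eqI) (simp add: lookup_sum lookup_single when_def sum.delta in_keys_iff)

definition monomial_eval :: "('v \<Rightarrow> 'a::comm_ring_1) \<Rightarrow> ('v \<Rightarrow>\<^sub>0 nat) \<Rightarrow> 'a"
  where "monomial_eval \<rho> m = (\<Prod>v\<in>Poly_Mapping.keys m. \<rho> v ^ Poly_Mapping.lookup m v)"

lemma monomial_eval_superset:
  assumes "finite A" "Poly_Mapping.keys m \<subseteq> A"
  shows "monomial_eval \<rho> m = (\<Prod>v\<in>A. \<rho> v ^ Poly_Mapping.lookup m v)"
  unfolding monomial_eval_def
  by (rule prod.mono_neutral_left) (use assms in \<open>auto simp: in_keys_iff\<close>)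

lemma monomial_eval_zero [simp]: "monomial_eval \<rho> 0 = 1"
  by (simp add: monomial_eval_def)

lemma monomial_eval_single [simp]: "monomial_eval \<rho> (Poly_Mapping.single v k) = \<rho> v ^ k"
  by (cases "k = 0") (simp_all add: monomial_eval_def)

lemma monomial_eval_add: "monomial_eval \<rho> (m + m') = monomial_eval \<rho> m * monomial_eval \<rho> m'"
proof -
  let ?A = "Poly_Mapping.keys m \<union> Poly_Mapping.keys m'"
  have "Poly_Mapping.keys (m + m') \<subseteq> ?A"
    by (rule keys_add)
  then show ?thesis
    by (simp add: monomial_eval_superset[of ?A] lookup_add power_add prod.distrib)
qed

text \<open>Evaluation, substitution and the passage to univariate polynomials are all
  \<open>mhom\<close> for different coefficient maps. One proof that \<open>mhom\<close> is a ring
  homomorphism, for any ring homomorphism \<open>c\<close>, serves all of them.\<close>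

locale coeff_hom =
  fixes c :: "complex \<Rightarrow> 'a::comm_ring_1"
  assumes coeff_add: "c (x + y) = c x + c y"
    and coeff_mult: "c (x * y) = c x * c y"
    and coeff_one: "c 1 = 1"
begin

lemma coeff_zero: "c 0 = 0"
  using coeff_add[of 0 0] by simp

lemma mhom_superset:
  assumes "finite A" "Poly_Mapping.keys p \<subseteq> A"
  shows "mhom c \<rho> p = (\<Sum>m\<in>A. c (Poly_Mapping.lookup p m) * monomial_eval \<rho> m)"
  unfolding mhom_def monomial_eval_def[symmetric]
  by (rule sum.mono_neutral_left) (use assms in \<open>auto simp: in_keys_iff coeff_zero\<close>)

lemma mhom_zero: "mhom c \<rho> 0 = 0"
  by (simp add: mhom_def)

lemma mhom_add: "mhom c \<rho> (p + q) = mhom c \<rho> p + mhom c \<rho> q"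
proof -
  let ?A = "Poly_Mapping.keys p \<union> Poly_Mapping.keys q"
  have "Poly_Mapping.keys (p + q) \<subseteq> ?A"
    by (rule keys_add)
  then show ?thesis
    by (simp add: mhom_superset[of ?A] lookup_add coeff_add distrib_right sum.distrib)
qed

lemma mhom_sum: "mhom c \<rho> (\<Sum>i\<in>I. g i) = (\<Sum>i\<in>I. mhom c \<rho> (g i))"
  by (induction I rule: infinite_finite_induct) (simp_all add: mhom_zero mhom_add)

lemma mhom_single: "mhom c \<rho> (Poly_Mapping.single m x) = c x * monomial_eval \<rho> m"
  by (cases "x = 0") (simp_all add: mhom_zero coeff_zero mhom_def monomial_eval_def)

text \<open>Both sides are additive in each factor, which reduces the claim to products of two
  monomials.\<close>

lemma mhom_mult: "mhom c \<rho> (p * q) = mhom c \<rho> p * mhom c \<rho> q"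
proof -
  have s: "mhom c \<rho> (Poly_Mapping.single m x * q) = mhom c \<rho> (Poly_Mapping.single m x) * mhom c \<rho> q"
    for m x
  proof -
    have "mhom c \<rho> (Poly_Mapping.single m x * Poly_Mapping.single m' y) =
        mhom c \<rho> (Poly_Mapping.single m x) * mhom c \<rho> (Poly_Mapping.single m' y)" for m' y
      by (simp add: mult_single mhom_single monomial_eval_add coeff_mult algebra_simps)
    then show ?thesis
      by (subst (1 2) poly_mapping_sum_single[of q, symmetric])
        (simp only: sum_distrib_left mhom_sum)
  qed
  show ?thesis
    by (subst (1 2) poly_mapping_sum_single[of p, symmetric])
      (simp only: sum_distrib_right mhom_sum s)
qed

lemma mhom_mconst: "mhom c \<rho> (mconst x) = c x"
  by (simp add: mconst_def mhom_single)

lemma mhom_mvar: "mhom c \<rho> (mvar v) = \<rho> v"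
  by (simp add: mvar_def mhom_single coeff_one)

lemma mhom_one: "mhom c \<rho> 1 = 1"
  using mhom_mconst[of \<rho> 1] by (simp add: mconst_def coeff_one)

lemma mhom_uminus: "mhom c \<rho> (- p) = - mhom c \<rho> p"
  using mhom_add[of \<rho> p "- p"] by (simp add: mhom_zero eq_neg_iff_add_eq_0 add.commute)

lemma mhom_diff: "mhom c \<rho> (p - q) = mhom c \<rho> p - mhom c \<rho> q"
  using mhom_add[of \<rho> p "- q"] by (simp add: mhom_uminus)

lemma mhom_power: "mhom c \<rho> (p ^ k) = mhom c \<rho> p ^ k"
  by (induction k) (simp_all add: mhom_one mhom_mult)

lemma mhom_prod: "mhom c \<rho> (\<Prod>i\<in>I. g i) = (\<Prod>i\<in>I. mhom c \<rho> (g i))"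
  by (induction I rule: infinite_finite_induct) (simp_all add: mhom_one mhom_mult)

lemmas mhom_simps = mhom_zero mhom_one mhom_add mhom_mult mhom_uminus mhom_diff mhom_power
  mhom_sum mhom_prod mhom_mconst mhom_mvar

end

lemma mhom_cong:
  assumes "\<And>v. v \<in> mvars p \<Longrightarrow> \<rho> v = \<rho>' v"
  shows "mhom c \<rho> p = mhom c \<rho>' p"
  unfolding mhom_def
  by (intro sum.cong prod.cong refl arg_cong2[of _ _ _ _ "(*)"] arg_cong2[of _ _ _ _ "(^)"] assms)
    (auto simp: mvars_def)

lemma mconst_0 [simp]: "mconst 0 = 0"
  and mconst_1 [simp]: "mconst 1 = 1"
  and mconst_add: "mconst (x + y) = mconst x + mconst y"
  and mconst_mult: "mconst (x * y) = mconst x * mconst y"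
  by (simp_all add: mconst_def single_add mult_single)

lemma mconst_eq_0_iff [simp]: "(mconst x :: 'v mpoly) = 0 \<longleftrightarrow> x = 0"
proof
  assume "(mconst x :: 'v mpoly) = 0"
  then have "Poly_Mapping.lookup (mconst x :: 'v mpoly) 0 = 0"
    by (simp only: lookup_zero)
  then show "x = 0"
    by (simp add: mconst_def)
qed simp

interpretation meval: coeff_hom "\<lambda>c. c"
  by unfold_locales simp_all

interpretation msubst: coeff_hom mconst
  by unfold_locales (simp_all add: mconst_add mconst_mult)

lemmas meval_simps [simp] = meval.mhom_simps[folded meval_def]
lemmas msubst_simps [simp] = msubst.mhom_simps[folded msubst_def]

lemma meval_cong: "(\<And>v. v \<in> mvars p \<Longrightarrow> x v = y v) \<Longrightarrow> meval x p = meval y p"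
  unfolding meval_def by (rule mhom_cong)

lemma msubst_cong: "(\<And>v. v \<in> mvars p \<Longrightarrow> x v = y v) \<Longrightarrow> msubst x p = msubst y p"
  unfolding msubst_def by (rule mhom_cong)


subsection \<open>Coefficients in a subfield\<close>

lemma mvars_0 [simp]: "mvars 0 = {}"
  and mvars_mvar [simp]: "mvars (mvar v) = {v}"
  and mvars_mconst [simp]: "mvars (mconst x) = {}"
  by (simp_all add: mvars_def mvar_def mconst_def)

lemma mvars_1 [simp]: "mvars 1 = {}"
  using mvars_mconst[of 1] unfolding mconst_1 .

lemma finite_mvars [simp]: "finite (mvars p)"
  by (simp add: mvars_def)

lemma mvars_add: "mvars (p + q) \<subseteq> mvars p \<union> mvars q"
  using keys_add[of p q] by (auto simp: mvars_def)

lemma mvars_uminus [simp]: "mvars (- p) = mvars p"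
  by (simp add: mvars_def)

lemma mvars_mult: "mvars (p * q) \<subseteq> mvars p \<union> mvars q"
proof
  fix v assume "v \<in> mvars (p * q)"
  then obtain m where "m \<in> Poly_Mapping.keys (p * q)" and v: "v \<in> Poly_Mapping.keys m"
    by (auto simp: mvars_def)
  with keys_mult[of p q] obtain s t where
    "s \<in> Poly_Mapping.keys p" "t \<in> Poly_Mapping.keys q" "m = s + t"
    by blast
  moreover have "v \<in> Poly_Mapping.keys s \<union> Poly_Mapping.keys t"
    using v keys_add[of s t] \<open>m = s + t\<close> by blast
  ultimately show "v \<in> mvars p \<union> mvars q"
    by (auto simp: mvars_def)
qed

text \<open>\<open>K\<close> is a subfield in the sense of HOL-Algebra, whereas polynomials carry
  type class operations. The closure lemmas that follow translate between the two.\<close>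

locale const_field =
  fixes K :: "complex set"
  assumes subfield: "subfield K (cring_on UNIV)"
begin

lemma subring: "subring K (cring_on UNIV)"
  using subfield by (rule subfieldE(1))

lemma K_zero [simp]: "0 \<in> K"
  using subringE(2)[OF subring] by (simp add: cring_on_def)

lemma K_one [simp]: "1 \<in> K"
  using subringE(3)[OF subring] by (simp add: cring_on_def)

lemma K_mult: "x \<in> K \<Longrightarrow> y \<in> K \<Longrightarrow> x * y \<in> K"
  using subringE(6)[OF subring] by (simp add: cring_on_def)

lemma K_add: "x \<in> K \<Longrightarrow> y \<in> K \<Longrightarrow> x + y \<in> K"
  using subringE(7)[OF subring] by (simp add: cring_on_def)

lemma K_inverse_ex:
  assumes "x \<in> K" "x \<noteq> 0"
  obtains y where "y \<in> K" "x * y = 1"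
proof -
  interpret subfield K "cring_on UNIV" by (rule subfield)
  have "x \<in> Units (cring_on UNIV \<lparr>carrier := K\<rparr>)"
    using assms subfield_Units by (simp add: cring_on_def)
  then show ?thesis
    using that by (auto simp: Units_def cring_on_def)
qed

lemma K_uminus:
  assumes "x \<in> K" shows "- x \<in> K"
proof -
  interpret R: ring "cring_on (UNIV :: complex set)"
  proof -
    show "ring (cring_on (UNIV :: complex set))"
      by (unfold_locales) (auto simp: cring_on_def Units_def algebra_simps intro: exI[of _ "- _"])
  qed
  have "\<ominus>\<^bsub>cring_on UNIV\<^esub> x \<in> K"
    using subringE(5)[OF subring assms] .
  moreover have "\<ominus>\<^bsub>cring_on UNIV\<^esub> x = - x"
    by (rule R.minus_equality) (simp_all add: cring_on_def)
  ultimately show ?thesis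
    by simp
qed

lemma K_inverse:
  assumes "x \<in> K" shows "inverse x \<in> K"
proof (cases "x = 0")
  case False
  with assms obtain y where "y \<in> K" "x * y = 1"
    using K_inverse_ex by blast
  then show ?thesis
    using inverse_unique[of x y] by simp
qed simp

lemma K_of_nat: "of_nat k \<in> K"
  by (induction k) (simp_all add: K_add)

lemma K_of_rat: "of_rat r \<in> K"
proof -
  obtain i j where r: "r = Rat.Fract i j" "j > 0"
    using Rat_cases by blast
  have int: "of_int k \<in> K" for k
    by (cases k rule: int_cases2) (simp_all add: K_of_nat K_uminus)
  show ?thesis
    using r by (simp add: of_rat_rat divide_inverse K_mult K_inverse int)
qed

lemma K_sum: "(\<And>i. i \<in> I \<Longrightarrow> g i \<in> K) \<Longrightarrow> sum g I \<in> K"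
  by (induction I rule: infinite_finite_induct) (auto intro: K_add)

lemma polys_mono: "V \<subseteq> V' \<Longrightarrow> polys K V \<subseteq> polys K V'"
  by (auto simp: polys_def)

lemma polys_zero [simp]: "0 \<in> polys K V"
  by (simp add: polys_def)

lemma polys_mconst: "x \<in> K \<Longrightarrow> mconst x \<in> polys K V"
  by (simp add: polys_def mvars_def mconst_def lookup_single when_def)

lemma polys_one [simp]: "1 \<in> polys K V"
  using polys_mconst[of 1 V] by simp

lemma polys_mvar: "v \<in> V \<Longrightarrow> mvar v \<in> polys K V"
  by (simp add: polys_def) (simp add: mvar_def lookup_single when_def)

lemma polys_add:
  assumes "p \<in> polys K V" "q \<in> polys K V" shows "p + q \<in> polys K V"
  using assms mvars_add[of p q] by (auto simp: polys_def lookup_add K_add)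

lemma polys_uminus: "p \<in> polys K V \<Longrightarrow> - p \<in> polys K V"
  by (simp add: polys_def K_uminus)

lemma polys_diff: "p \<in> polys K V \<Longrightarrow> q \<in> polys K V \<Longrightarrow> p - q \<in> polys K V"
  using polys_add[of p V "- q"] polys_uminus[of q V] by simp

lemma polys_sum: "(\<And>i. i \<in> I \<Longrightarrow> g i \<in> polys K V) \<Longrightarrow> sum g I \<in> polys K V"
  by (induction I rule: infinite_finite_induct) (auto intro: polys_add)

lemma polys_mult:
  assumes "p \<in> polys K V" "q \<in> polys K V" shows "p * q \<in> polys K V"
proof -
  have "Poly_Mapping.lookup (p * q) m \<in> K" for m
  proof -
    have "Poly_Mapping.lookup (p * q) m =
        (\<Sum>(s, t)\<in>Poly_Mapping.keys p \<times> Poly_Mapping.keys q.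
           (Poly_Mapping.lookup p s * Poly_Mapping.lookup q t when m = s + t))"
    proof -
      have "p * q = (\<Sum>s\<in>Poly_Mapping.keys p. Poly_Mapping.single s (Poly_Mapping.lookup p s)) *
          (\<Sum>t\<in>Poly_Mapping.keys q. Poly_Mapping.single t (Poly_Mapping.lookup q t))"
        by (simp only: poly_mapping_sum_single)
      also have "\<dots> = (\<Sum>(s, t)\<in>Poly_Mapping.keys p \<times> Poly_Mapping.keys q.
          Poly_Mapping.single (s + t) (Poly_Mapping.lookup p s * Poly_Mapping.lookup q t))"
        by (simp add: sum_product sum.cartesian_product mult_single)
      finally show ?thesis
        by (simp add: lookup_sum case_prod_beta' lookup_single when_def eq_commute)
    qed
    also have "\<dots> \<in> K"
      using assms by (intro K_sum) (auto simp: polys_def when_def K_mult)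
    finally show ?thesis .
  qed
  then show ?thesis
    using assms mvars_mult[of p q] by (auto simp: polys_def)
qed

lemma polys_power: "p \<in> polys K V \<Longrightarrow> p ^ k \<in> polys K V"
  by (induction k) (auto intro: polys_mult)

lemma polys_prod: "(\<And>i. i \<in> I \<Longrightarrow> g i \<in> polys K V) \<Longrightarrow> prod g I \<in> polys K V"
  by (induction I rule: infinite_finite_induct) (auto intro: polys_mult)

end

lemma polys_UNIV: "p \<in> polys UNIV (mvars p)"
  by (simp add: polys_def)

lemma polys_mvars: "p \<in> polys K V \<Longrightarrow> mvars p \<subseteq> V"
  by (simp add: polys_def)

lemma single_eq_mconst_monomial:
  "Poly_Mapping.single m x = mconst x * monomial_eval mvar m"
proof -
  have "finite A \<Longrightarrow> (\<Prod>v\<in>A. mvar v ^ k v :: 'a mpoly) =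
      Poly_Mapping.single (\<Sum>v\<in>A. Poly_Mapping.single v (k v)) 1" for A :: "'a set" and k
  proof (induction A rule: finite_induct)
    case (insert v A)
    have "mvar v ^ j = Poly_Mapping.single (Poly_Mapping.single v j) (1::complex)" for j
      by (induction j) (simp_all add: mvar_def mult_single single_add[symmetric] single_one)
    with insert show ?case
      by (simp add: mult_single)
  qed (simp add: single_one)
  then have "monomial_eval mvar m = Poly_Mapping.single m (1::complex)"
    unfolding monomial_eval_def by (simp add: poly_mapping_sum_single)
  then show ?thesis
    by (simp add: mconst_def mult_single)
qed

text \<open>Every element of K[V] is a finite sum of products of constants from \<open>K\<close> and
  variables from \<open>V\<close>; \<open>0\<close> and \<open>1\<close> in \<open>K\<close> account
  for empty sums and products. Most facts about polynomials below, up to the chain rule along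
  curves, are proved by this induction, without touching monomials again.\<close>

lemma polys_induct [consumes 3, case_names const var add mult]:
  assumes p: "p \<in> polys K V"
    and K: "0 \<in> K" "1 \<in> K"
    and const: "\<And>x. x \<in> K \<Longrightarrow> P (mconst x)"
    and var: "\<And>v. v \<in> V \<Longrightarrow> P (mvar v)"
    and add: "\<And>p q. P p \<Longrightarrow> P q \<Longrightarrow> P (p + q)"
    and mult: "\<And>p q. P p \<Longrightarrow> P q \<Longrightarrow> P (p * q)"
  shows "P p"
proof -
  have 0: "P 0" and 1: "P 1"
    using const[OF K(1)] const[OF K(2)] by simp_all
  have pow: "P q \<Longrightarrow> P (q ^ k)" for q k
    by (induction k) (auto simp: 1 mult)
  have prod: "(\<And>i. i \<in> I \<Longrightarrow> P (g i)) \<Longrightarrow> P (prod g I)" for I :: "'a set" and g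
    by (induction I rule: infinite_finite_induct) (auto simp: 1 mult)
  have sum: "(\<And>i. i \<in> I \<Longrightarrow> P (g i)) \<Longrightarrow> P (sum g I)" for I :: "('a \<Rightarrow>\<^sub>0 nat) set" and g
    by (induction I rule: infinite_finite_induct) (auto simp: 0 add)
  have "P (\<Sum>m\<in>Poly_Mapping.keys p. Poly_Mapping.single m (Poly_Mapping.lookup p m))"
  proof (rule sum)
    fix m assume m: "m \<in> Poly_Mapping.keys p"
    show "P (Poly_Mapping.single m (Poly_Mapping.lookup p m))"
      unfolding single_eq_mconst_monomial monomial_eval_def
      using m p by (intro mult const prod pow var) (auto simp: polys_def mvars_def)
  qed
  then show ?thesis
    by (simp add: poly_mapping_sum_single)
qed

lemmas mpoly_induct = polys_induct[OF polys_UNIV, simplified, case_names const var add mult]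

lemma (in coeff_hom) mhom_msubst: "mhom c \<rho> (msubst s p) = mhom c (\<lambda>v. mhom c \<rho> (s v)) p"
  by (induction p rule: mpoly_induct) (simp_all add: mhom_simps)

lemmas meval_msubst = meval.mhom_msubst[folded meval_def]
lemmas msubst_msubst = msubst.mhom_msubst[folded msubst_def]

lemma msubst_mvar [simp]: "msubst mvar p = p"
  by (induction p rule: mpoly_induct) simp_all

lemma (in const_field) polys_msubst:
  assumes "p \<in> polys K V" "\<And>v. v \<in> V \<Longrightarrow> s v \<in> polys K V'"
  shows "msubst s p \<in> polys K V'"
  using assms(1) K_zero K_one
  by (induction rule: polys_induct) (auto intro: polys_mconst assms(2) polys_add polys_mult)


subsection \<open>Derivations\<close>

lemma mpderiv_superset:
  assumes "finite A" "Poly_Mapping.keys p \<subseteq> A"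
  shows "mpderiv v p = (\<Sum>m\<in>A. Poly_Mapping.single (m - Poly_Mapping.single v 1)
    (of_nat (Poly_Mapping.lookup m v) * Poly_Mapping.lookup p m))"
  unfolding mpderiv_def
  by (rule sum.mono_neutral_left) (use assms in \<open>auto simp: in_keys_iff\<close>)

lemma mpderiv_0 [simp]: "mpderiv v 0 = 0"
  by (simp add: mpderiv_def)

lemma mpderiv_add [simp]: "mpderiv v (p + q) = mpderiv v p + mpderiv v q"
proof -
  let ?A = "Poly_Mapping.keys p \<union> Poly_Mapping.keys q"
  have "Poly_Mapping.keys (p + q) \<subseteq> ?A"
    by (rule keys_add)
  then show ?thesis
    by (simp add: mpderiv_superset[of ?A] lookup_add distrib_left single_add sum.distrib)
qed

lemma mpderiv_sum: "mpderiv v (sum g I) = (\<Sum>i\<in>I. mpderiv v (g i))"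
  by (induction I rule: infinite_finite_induct) simp_all

lemma mpderiv_single: "mpderiv v (Poly_Mapping.single m x) =
    Poly_Mapping.single (m - Poly_Mapping.single v 1) (of_nat (Poly_Mapping.lookup m v) * x)"
  by (cases "x = 0") (simp_all add: mpderiv_def)

lemma mpderiv_mult [simp]: "mpderiv v (p * q) = p * mpderiv v q + mpderiv v p * q"
proof -
  have base: "mpderiv v (Poly_Mapping.single m x * Poly_Mapping.single m' y) =
      Poly_Mapping.single m x * mpderiv v (Poly_Mapping.single m' y) +
      mpderiv v (Poly_Mapping.single m x) * Poly_Mapping.single m' y" for m m' x y
  proof -
    let ?e = "Poly_Mapping.single v (1::nat)"
    \<comment> \<open>Exponents are natural numbers, so \<open>m' - ?e\<close> truncates when
      \<open>v\<close> does not occur in \<open>m'\<close>. The factor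
      \<open>of_nat (Poly_Mapping.lookup m' v)\<close> is zero in exactly that case.\<close>
    have 1: "Poly_Mapping.single (m + (m' - ?e)) (of_nat (Poly_Mapping.lookup m' v) * z) =
        Poly_Mapping.single (m + m' - ?e) (of_nat (Poly_Mapping.lookup m' v) * z)" for m m' and z :: complex
    proof (cases "Poly_Mapping.lookup m' v = 0")
      case False
      have "m + (m' - ?e) = m + m' - ?e"
        using False by (intro poly_mapping_eqI)
          (auto simp: lookup_add lookup_minus lookup_single when_def)
      then show ?thesis by simp
    qed simp
    have 2: "Poly_Mapping.single (m - ?e + m') (of_nat (Poly_Mapping.lookup m v) * z) =
        Poly_Mapping.single (m + m' - ?e) (of_nat (Poly_Mapping.lookup m v) * z)" for z :: complex
      using 1[of m' m z] by (simp add: add.commute)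
    show ?thesis
      using 1[of m m' "x * y"] 2[of "x * y"]
      by (simp add: mult_single mpderiv_single lookup_add distrib_right distrib_left single_add[symmetric]
          mult.left_commute mult.assoc) (simp add: single_add add.commute)
  qed
  have "mpderiv v (Poly_Mapping.single m x * q) =
      Poly_Mapping.single m x * mpderiv v q + mpderiv v (Poly_Mapping.single m x) * q" for m x
    by (subst (1 2 3) poly_mapping_sum_single[of q, symmetric])
      (simp only: sum_distrib_left mpderiv_sum base sum.distrib)
  then show ?thesis
    by (subst (1 2 3) poly_mapping_sum_single[of p, symmetric])
      (simp only: sum_distrib_right mpderiv_sum sum.distrib)
qed

lemma mpderiv_mconst [simp]: "mpderiv v (mconst x) = 0"
  by (simp add: mconst_def mpderiv_single)

lemma mpderiv_mvar [simp]: "mpderiv v (mvar v') = (if v = v' then 1 else 0)"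
  by (auto simp: mvar_def mpderiv_single lookup_single single_one)

lemma mpderiv_notin: "v \<notin> mvars p \<Longrightarrow> mpderiv v p = 0"
  unfolding mpderiv_def
  by (rule sum.neutral) (auto simp: mvars_def in_keys_iff)

lemma (in const_field) polys_mpderiv: "p \<in> polys K V \<Longrightarrow> mpderiv v p \<in> polys K V"
proof -
  assume p: "p \<in> polys K V"
  from p K_zero K_one have "p \<in> polys K V \<and> mpderiv v p \<in> polys K V"
  proof (induction rule: polys_induct)
    case (var v')
    then show ?case by (simp add: polys_mvar)
  qed (auto intro: polys_mconst polys_add polys_mult)
  then show ?thesis ..
qed

text \<open>Variables may cancel in a sum or a product. Summing over a common superset of the
  variables lets the derivatives of several polynomials be compared term by term.\<close>

lemma total_deriv_superset:
  assumes "finite A" "mvars p \<subseteq> A"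
  shows "total_deriv p = (\<Sum>v\<in>A. mpderiv v p * mvar (fst v, Suc (snd v)))"
  unfolding total_deriv_def
  by (rule sum.mono_neutral_left) (use assms in \<open>auto simp: mpderiv_notin\<close>)

lemma total_deriv_add: "total_deriv (p + q) = total_deriv p + total_deriv q"
  using mvars_add[of p q]
  by (simp add: total_deriv_superset[of "mvars p \<union> mvars q"] distrib_right sum.distrib)

lemma total_deriv_mult: "total_deriv (p * q) = p * total_deriv q + total_deriv p * q"
  using mvars_mult[of p q]
  by (simp add: total_deriv_superset[of "mvars p \<union> mvars q"] distrib_right sum.distrib
      sum_distrib_left sum_distrib_right distrib_left mult_ac)

lemma total_deriv_0 [simp]: "total_deriv 0 = 0"
  by (simp add: total_deriv_def)

lemma (in const_field) polys_total_deriv: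
  assumes "p \<in> polys K V" "(\<lambda>v. (fst v, Suc (snd v))) ` V \<subseteq> V'" "V \<subseteq> V'"
  shows "total_deriv p \<in> polys K V'"
  unfolding total_deriv_def using assms polys_mvars[OF assms(1)] polys_mono[OF assms(3)]
  by (intro polys_sum polys_mult polys_mvar) (auto intro: polys_mpderiv)


subsection \<open>Polynomials as univariate polynomials\<close>

lemma pCons_const_hom: "coeff_hom h \<Longrightarrow> coeff_hom (\<lambda>c. [:h c:])"
  by (simp add: coeff_hom_def one_pCons)

interpretation pconst: coeff_hom "\<lambda>c. [:c:]"
  by (rule pCons_const_hom) (rule meval.coeff_hom_axioms)

interpretation pmconst: coeff_hom "\<lambda>c. [:mconst c:]"
  by (rule pCons_const_hom) (rule msubst.coeff_hom_axioms)

lemma poly_mhom: "poly (mhom (\<lambda>c. [:c:]) \<rho> p) s = meval (\<lambda>v. poly (\<rho> v) s) p"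
  by (induction p rule: mpoly_induct) (simp_all add: pconst.mhom_simps)

text \<open>Sorts a polynomial by powers of \<open>v\<close>, with coefficients free of
  \<open>v\<close>; this is the form in which pseudo-division by \<open>q\<close> is carried
  out.\<close>

definition to_univ :: "'v \<Rightarrow> 'v mpoly \<Rightarrow> 'v mpoly poly"
  where "to_univ v = mhom (\<lambda>c. [:mconst c:]) (\<lambda>x. if x = v then [:0, 1:] else [:mvar x:])"

text \<open>The restriction to the line through \<open>x\<close> in direction \<open>v\<close>, as a
  complex polynomial, so that roots and derivatives in one variable become available.\<close>

definition to_univ_at :: "('v \<Rightarrow> complex) \<Rightarrow> 'v \<Rightarrow> 'v mpoly \<Rightarrow> complex poly"
  where "to_univ_at x v = mhom (\<lambda>c. [:c:]) (\<lambda>y. if y = v then [:0, 1:] else [:x y:])"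

lemmas to_univ_simps = pmconst.mhom_simps[where \<rho> = "\<lambda>x. if x = v then [:0, 1:] else [:mvar x:]" for v,
  folded to_univ_def]
lemmas to_univ_at_simps = pconst.mhom_simps[where \<rho> = "\<lambda>y. if y = v then [:0, 1:] else [:x y:]" for x v,
  folded to_univ_at_def]

lemma poly_to_univ: "poly (to_univ v p) (mvar v) = p"
  by (induction p rule: mpoly_induct) (simp_all add: to_univ_simps)

lemma (in const_field) coeff_to_univ:
  assumes "p \<in> polys K V"
  shows "Polynomial.coeff (to_univ v p) k \<in> polys K (V - {v})"
  using assms K_zero K_one
proof (induction arbitrary: k rule: polys_induct)
  case (const x)
  then show ?case
    by (simp add: to_univ_simps coeff_pCons polys_mconst split: nat.split)
next
  case (var y)
  then show ?case
    by (simp add: to_univ_simps coeff_pCons polys_mvar split: nat.split)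
next
  case (add p q)
  then show ?case
    by (simp add: to_univ_simps polys_add)
next
  case (mult p q)
  then show ?case
    by (auto simp: to_univ_simps coeff_mult intro!: polys_sum polys_mult)
qed

lemma coeff_to_univ_at: "Polynomial.coeff (to_univ_at x v p) k = meval x (Polynomial.coeff (to_univ v p) k)"
proof (induction p arbitrary: k rule: mpoly_induct)
  case (mult p q)
  then show ?case
    by (simp add: to_univ_at_simps to_univ_simps coeff_mult)
qed (simp_all add: to_univ_at_simps to_univ_simps coeff_pCons split: nat.split)

lemma poly_to_univ_at: "poly (to_univ_at x v p) s = meval (x(v := s)) p"
  by (induction p rule: mpoly_induct) (simp_all add: to_univ_at_simps)

lemma pderiv_to_univ_at: "pderiv (to_univ_at x v p) = to_univ_at x v (mpderiv v p)"
  by (induction p rule: mpoly_induct)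
    (simp_all add: to_univ_at_simps pderiv_add pderiv_mult pderiv_pCons algebra_simps)

lemma lookup_le_mdeg:
  assumes "m \<in> Poly_Mapping.keys p" shows "Poly_Mapping.lookup m v \<le> mdeg v p"
  unfolding mdeg_def using assms by (intro Max_ge) auto

lemma mdeg_leI:
  assumes "\<And>m. m \<in> Poly_Mapping.keys p \<Longrightarrow> Poly_Mapping.lookup m v \<le> k"
  shows "mdeg v p \<le> k"
  unfolding mdeg_def using assms by (intro Max.boundedI) auto

lemma mdeg_add: "mdeg v (p + q) \<le> max (mdeg v p) (mdeg v q)"
  using keys_add[of p q] by (intro mdeg_leI) (force simp: le_max_iff_disj dest: lookup_le_mdeg)

lemma mdeg_sum:
  assumes "\<And>i. i \<in> I \<Longrightarrow> mdeg v (g i) \<le> k" shows "mdeg v (sum g I) \<le> k"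
  using assms
proof (induction I rule: infinite_finite_induct)
  case (insert i I)
  have "mdeg v (g i + sum g I) \<le> max (mdeg v (g i)) (mdeg v (sum g I))"
    by (rule mdeg_add)
  also have "\<dots> \<le> k"
    using insert by simp
  finally show ?case
    using insert by simp
qed (simp_all add: mdeg_def)

lemma mdeg_mult: "mdeg v (p * q) \<le> mdeg v p + mdeg v q"
proof (rule mdeg_leI)
  fix m assume "m \<in> Poly_Mapping.keys (p * q)"
  with keys_mult[of p q] obtain s t where
    "s \<in> Poly_Mapping.keys p" "t \<in> Poly_Mapping.keys q" "m = s + t"
    by blast
  then show "Poly_Mapping.lookup m v \<le> mdeg v p + mdeg v q"
    using lookup_le_mdeg[of s p v] lookup_le_mdeg[of t q v] by (simp add: lookup_add)
qed

lemma mdeg_notin: "v \<notin> mvars p \<Longrightarrow> mdeg v p = 0"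
  using mdeg_leI[of p v 0] by (auto simp: mvars_def in_keys_iff)

lemma mdeg_mvar_power: "mdeg v (mvar v ^ k) \<le> k"
proof (induction k)
  case 0
  show ?case
    by (simp add: mdeg_notin)
next
  case (Suc k)
  have "mdeg v (mvar v) = 1"
    by (simp add: mdeg_def mvar_def)
  with Suc show ?case
    using mdeg_mult[of v "mvar v" "mvar v ^ k"] by simp
qed

lemma mdeg_poly:
  assumes "\<And>k. v \<notin> mvars (Polynomial.coeff r k)"
  shows "mdeg v (poly r (mvar v)) \<le> Polynomial.degree r"
  unfolding poly_altdef
proof (rule mdeg_sum)
  fix k assume "k \<in> {..Polynomial.degree r}"
  then show "mdeg v (Polynomial.coeff r k * mvar v ^ k) \<le> Polynomial.degree r"
    using mdeg_mult[of v "Polynomial.coeff r k" "mvar v ^ k"] mdeg_mvar_power[of v k] mdeg_notin[OF assms, of k]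
    by simp
qed

lemma degree_mhom_le:
  fixes c :: "complex \<Rightarrow> 'a::comm_ring_1"
  assumes "Polynomial.degree (\<rho> v) \<le> 1" "\<And>y. y \<noteq> v \<Longrightarrow> Polynomial.degree (\<rho> y) = 0"
  shows "Polynomial.degree (mhom (\<lambda>c'. [:c c':]) \<rho> p) \<le> mdeg v p"
  unfolding mhom_def
proof (rule degree_sum_le)
  fix m assume m: "m \<in> Poly_Mapping.keys p"
  have "Polynomial.degree (\<Prod>y\<in>Poly_Mapping.keys m. \<rho> y ^ Poly_Mapping.lookup m y)
      \<le> (\<Sum>y\<in>Poly_Mapping.keys m. Polynomial.degree (\<rho> y ^ Poly_Mapping.lookup m y))"
    using degree_prod_sum_le[of "Poly_Mapping.keys m" "\<lambda>y. \<rho> y ^ Poly_Mapping.lookup m y"] by (simp add: o_def)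
  also have "\<dots> \<le> (\<Sum>y\<in>Poly_Mapping.keys m. if y = v then Poly_Mapping.lookup m v else 0)"
  proof (rule sum_mono)
    fix y
    have "Polynomial.degree (\<rho> y ^ Poly_Mapping.lookup m y) \<le> Polynomial.degree (\<rho> y) * Poly_Mapping.lookup m y"
      by (rule degree_power_le)
    also have "\<dots> \<le> (if y = v then Poly_Mapping.lookup m v else 0)"
      using assms by simp
    finally show "Polynomial.degree (\<rho> y ^ Poly_Mapping.lookup m y) \<le> (if y = v then Poly_Mapping.lookup m v else 0)" .
  qed
  also have "\<dots> \<le> mdeg v p"
    using lookup_le_mdeg[OF m, of v] by (simp add: sum.delta)
  finally show "Polynomial.degree ([:c (Poly_Mapping.lookup p m):] *
      (\<Prod>y\<in>Poly_Mapping.keys m. \<rho> y ^ Poly_Mapping.lookup m y)) \<le> mdeg v p"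
    by (simp add: order.trans[OF degree_smult_le])
qed simp

lemma degree_to_univ_le: "Polynomial.degree (to_univ v p) \<le> mdeg v p"
  unfolding to_univ_def by (rule degree_mhom_le) simp_all

lemma degree_to_univ_at_le: "Polynomial.degree (to_univ_at x v p) \<le> mdeg v p"
  unfolding to_univ_at_def using degree_mhom_le[of _ v "\<lambda>c. c"] by simp

lemma const_field_UNIV: "const_field UNIV"
proof (rule const_field.intro)
  have "field (cring_on (UNIV :: complex set))"
  proof (rule cring.cring_fieldI2)
    show "cring (cring_on (UNIV :: complex set))"
      by (unfold_locales) (auto simp: cring_on_def Units_def algebra_simps intro: exI[of _ "- _"])
  next
    show "\<exists>y\<in>carrier (cring_on UNIV). x \<otimes>\<^bsub>cring_on UNIV\<^esub> y = \<one>\<^bsub>cring_on UNIV\<^esub>"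
      if "x \<in> carrier (cring_on UNIV)" "x \<noteq> \<zero>\<^bsub>cring_on UNIV\<^esub>" for x :: complex
      using that by (auto simp: cring_on_def intro: exI[of _ "inverse x"])
  qed (simp add: cring_on_def)
  then have "subfield (carrier (cring_on (UNIV :: complex set))) (cring_on UNIV)"
    by (rule field.carrier_is_subfield)
  moreover have "carrier (cring_on (UNIV :: complex set)) = UNIV"
    by (simp add: cring_on_def)
  ultimately show "subfield UNIV (cring_on (UNIV :: complex set))"
    by simp
qed

lemma polys_empty: "p \<in> polys UNIV {} \<Longrightarrow> \<exists>x. p = mconst x"
proof -
  assume "p \<in> polys UNIV {}"
  then show ?thesis
    using UNIV_I UNIV_I by (induction rule: polys_induct)
      (auto simp: mconst_add[symmetric] mconst_mult[symmetric])
qed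

text \<open>Induction on the number of variables: the leading coefficient with respect to
  \<open>v\<close> is nonzero and free of \<open>v\<close>, hence nonzero at some point. Over that
  point a nonzero polynomial in \<open>v\<close> remains, and it cannot vanish everywhere.\<close>

lemma ex_meval_nonzero_aux:
  "finite V \<Longrightarrow> p \<in> polys UNIV V \<Longrightarrow> p \<noteq> 0 \<Longrightarrow> \<exists>x. meval x p \<noteq> 0"
proof (induction V arbitrary: p rule: finite_induct)
  case empty
  then show ?case
    using polys_empty[of p] by auto
next
  case (insert v V)
  interpret const_field UNIV by (rule const_field_UNIV)
  have "to_univ v p \<noteq> 0"
    using insert.prems poly_to_univ[of v p] by auto
  moreover have "Polynomial.lead_coeff (to_univ v p) \<in> polys UNIV V"
    using coeff_to_univ[OF insert.prems(1), of v "Polynomial.degree (to_univ v p)"] insert.hyps by simp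
  ultimately obtain x where "meval x (Polynomial.lead_coeff (to_univ v p)) \<noteq> 0"
    using insert.IH by (metis leading_coeff_0_iff)
  then have "to_univ_at x v p \<noteq> 0"
    using coeff_to_univ_at[of x v p "Polynomial.degree (to_univ v p)"] by auto
  then obtain s where "poly (to_univ_at x v p) s \<noteq> 0"
    using poly_all_0_iff_0 by blast
  then show ?case
    by (auto simp: poly_to_univ_at)
qed

lemma ex_meval_nonzero: "p \<noteq> 0 \<Longrightarrow> \<exists>x. meval x p \<noteq> 0"
  using ex_meval_nonzero_aux[OF finite_mvars polys_UNIV] .

text \<open>Two nonvanishing points are joined by a line on which both polynomials become univariate.\<close>

lemma mpoly_mult_eq_0_iff: "p * q = 0 \<longleftrightarrow> p = 0 \<or> q = (0 :: 'v mpoly)"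
proof
  assume pq: "p * q = 0"
  show "p = 0 \<or> q = 0"
  proof (rule ccontr)
    assume "\<not> (p = 0 \<or> q = 0)"
    then obtain x y where x: "meval x p \<noteq> 0" and y: "meval y q \<noteq> 0"
      using ex_meval_nonzero by metis
    define L where "L = mhom (\<lambda>c. [:c:]) (\<lambda>v. [:x v, y v - x v:])"
    have "poly (L p) 0 \<noteq> 0" "poly (L q) 1 \<noteq> 0"
      using x y by (simp_all add: L_def poly_mhom)
    then have "L p * L q \<noteq> 0"
      by auto
    moreover have "L p * L q = L (p * q)"
      by (simp add: L_def pconst.mhom_mult)
    ultimately show False
      using pq by (simp add: L_def pconst.mhom_zero)
  qed
qed auto

text \<open>Division without inverting the leading coefficient: each step multiplies
  \<open>g\<close> by the leading coefficient of \<open>q\<close> and cancels the top term, so that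
  the degree drops. \<open>S\<close> stands for a subring such as K[U] inside the type of all
  polynomials; its closure properties keep the coefficients of the remainder there.\<close>

lemma pseudo_division:
  fixes q g :: "'a::comm_ring_1 poly"
  assumes S: "0 \<in> S" "\<And>x y. x \<in> S \<Longrightarrow> y \<in> S \<Longrightarrow> x - y \<in> S" "\<And>x y. x \<in> S \<Longrightarrow> y \<in> S \<Longrightarrow> x * y \<in> S"
    and q: "Polynomial.degree q > 0" "\<And>k. Polynomial.coeff q k \<in> S"
    and g: "\<And>k. Polynomial.coeff g k \<in> S"
  shows "\<exists>k h r. Polynomial.smult (Polynomial.lead_coeff q ^ k) g = q * h + r \<and>
    Polynomial.degree r < Polynomial.degree q \<and> (\<forall>k. Polynomial.coeff r k \<in> S)"
  using g
proof (induction "Polynomial.degree g" arbitrary: g rule: less_induct)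
  case less
  let ?m = "Polynomial.degree g" and ?n = "Polynomial.degree q"
  show ?case
  proof (cases "?m < ?n")
    case True
    then show ?thesis
      using less.prems by (intro exI[of _ 0] exI[of _ g]) simp
  next
    case False
    let ?t = "Polynomial.monom (Polynomial.lead_coeff g) (?m - ?n)"
    let ?g = "Polynomial.smult (Polynomial.lead_coeff q) g - ?t * q"
    have c: "Polynomial.coeff (?t * q) k =
        (if k < ?m - ?n then 0 else Polynomial.lead_coeff g * Polynomial.coeff q (k - (?m - ?n)))" for k
      by (simp add: coeff_monom_mult)
    have "Polynomial.coeff ?g ?m = 0"
      using False by (simp add: c)
    moreover have "Polynomial.degree ?g \<le> ?m"
    proof (rule degree_diff_le)
      show "Polynomial.degree (Polynomial.smult (Polynomial.lead_coeff q) g) \<le> ?m"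
        by (rule degree_smult_le)
      show "Polynomial.degree (?t * q) \<le> ?m"
        using False by (intro degree_le) (auto simp: c coeff_eq_0)
    qed
    ultimately have "Polynomial.degree ?g < ?m"
      using False q(1) by (metis le_neq_implies_less leading_coeff_0_iff degree_0 not_less gr_implies_not0 bot_nat_0.extremum_strict)
    moreover have "Polynomial.coeff ?g k \<in> S" for k
      by (auto simp: c intro!: S q less.prems)
    ultimately obtain k h r where *: "Polynomial.smult (Polynomial.lead_coeff q ^ k) ?g = q * h + r"
      "Polynomial.degree r < ?n" "\<forall>k. Polynomial.coeff r k \<in> S"
      using less.hyps[of ?g] by blast
    have "Polynomial.smult (Polynomial.lead_coeff q ^ Suc k) g =
        q * (h + Polynomial.smult (Polynomial.lead_coeff q ^ k) ?t) + r"
      using *(1) by (simp add: smult_diff_right algebra_simps)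
    with *(2,3) show ?thesis
      by blast
  qed
qed


subsection \<open>Points near a simple zero\<close>

text \<open>This is the bound of the logarithmic derivative Q'/Q, the sum of 1/(z - r) over the
  roots, by degree/M. It is freed of denominators so that \<open>z\<close> may itself be a root, and
  proved by splitting off one linear factor at a time.\<close>

lemma root_distance_aux:
  fixes Q :: "complex poly"
  assumes "0 \<le> M" "\<And>r. poly Q r = 0 \<Longrightarrow> M \<le> norm (z - r)" "Q \<noteq> 0"
  shows "M * norm (poly (pderiv Q) z) \<le> Polynomial.degree Q * norm (poly Q z)"
  using assms
proof (induction "Polynomial.degree Q" arbitrary: Q)
  case 0
  then have "pderiv Q = 0"
    by (simp add: pderiv_eq_0_iff)
  then show ?case by simp
next
  case (Suc n)
  then obtain r where r: "poly Q r = 0"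
    using alg_closed_imp_poly_has_root[of Q] by auto
  then obtain Q1 where Q: "Q = [:- r, 1:] * Q1"
    by (metis dvdE poly_eq_0_iff_dvd)
  with Suc.prems have "Q1 \<noteq> 0"
    by auto
  with Suc.hyps(2) have deg: "n = Polynomial.degree Q1"
    by (simp add: Q degree_mult_eq del: mult_pCons_left)
  have IH: "M * norm (poly (pderiv Q1) z) \<le> n * norm (poly Q1 z)"
    using Suc.hyps(1)[OF deg] Suc.prems \<open>Q1 \<noteq> 0\<close> by (simp add: Q deg del: mult_pCons_left)
  have M: "M \<le> norm (z - r)"
    using Suc.prems(2) r .
  have "poly (pderiv Q) z = poly Q1 z + (z - r) * poly (pderiv Q1) z"
    unfolding Q pderiv_mult by (simp add: pderiv_pCons algebra_simps)
  then have "M * norm (poly (pderiv Q) z) \<le> M * (norm (poly Q1 z) + norm (z - r) * norm (poly (pderiv Q1) z))"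
    using Suc.prems(1) by (metis mult_left_mono norm_mult norm_triangle_ineq)
  also have "\<dots> = M * norm (poly Q1 z) + norm (z - r) * (M * norm (poly (pderiv Q1) z))"
    by (simp add: algebra_simps)
  also have "\<dots> \<le> norm (z - r) * norm (poly Q1 z) + norm (z - r) * (n * norm (poly Q1 z))"
    using M IH by (intro add_mono mult_right_mono mult_left_mono) simp_all
  also have "\<dots> = Polynomial.degree Q * norm (poly Q z)"
    using Suc.hyps(2)[symmetric] by (simp add: Q norm_mult algebra_simps del: mult_pCons_left)
      (simp add: norm_mult[symmetric] algebra_simps)
  finally show ?case .
qed

text \<open>Taking for \<open>M\<close> the distance to the nearest root shows that a small value
  with a derivative bounded away from 0 forces a root nearby. It takes the place of the implicit
  function theorem; the constant is the degree only, hence uniform along a sequence of polynomials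
  of bounded degree.\<close>

lemma root_distance:
  fixes Q :: "complex poly"
  assumes "poly (pderiv Q) z \<noteq> 0"
  shows "\<exists>r. poly Q r = 0 \<and> norm (z - r) * norm (poly (pderiv Q) z) \<le> Polynomial.degree Q * norm (poly Q z)"
proof -
  have "Q \<noteq> 0" and "Polynomial.degree Q \<noteq> 0"
    using assms by (auto simp: pderiv_eq_0_iff[symmetric])
  then have fin: "finite {r. poly Q r = 0}" and ne: "{r. poly Q r = 0} \<noteq> {}"
    using poly_roots_finite alg_closed_imp_poly_has_root[of Q] by auto
  obtain r where r: "poly Q r = 0" "\<And>r'. poly Q r' = 0 \<Longrightarrow> norm (z - r) \<le> norm (z - r')"
    using ex_is_arg_min_if_finite[OF fin ne, of "\<lambda>r. norm (z - r)"]
    by (auto simp: is_arg_min_linorder)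
  then show ?thesis
    using root_distance_aux[of "norm (z - r)" Q z] \<open>Q \<noteq> 0\<close> by auto
qed

lemma tendsto_meval:
  assumes "\<And>v. ((\<lambda>t. \<rho> t v) \<longlongrightarrow> x v) F"
  shows "((\<lambda>t. meval (\<rho> t) p) \<longlongrightarrow> meval x p) F"
  by (induction p rule: mpoly_induct) (auto intro: tendsto_intros assms)

text \<open>Move the coordinates of \<open>y\<close> other than \<open>v\<close> towards a point
  \<open>u\<close> where \<open>c\<close> does not vanish. Since \<open>y\<close> is a simple zero
  of \<open>q\<close> in direction \<open>v\<close>, a root in \<open>v\<close> follows, which gives
  zeros of \<open>q\<close> converging to \<open>y\<close>. On the line \<open>c\<close> has
  finitely many zeros, so \<open>g\<close> vanishes at almost all of these points and, by
  continuity, at \<open>y\<close>.\<close>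

lemma meval_eq_0_of_generic:
  fixes q g c :: "'v mpoly"
  assumes y: "meval y q = 0" "meval y (mpderiv v q) \<noteq> 0"
    and c: "c \<noteq> 0" "v \<notin> mvars c"
    and g: "\<And>x. meval x q = 0 \<Longrightarrow> meval x (c * g) = 0"
  shows "meval y g = 0"
proof -
  obtain u where u: "meval u c \<noteq> 0"
    using c(1) ex_meval_nonzero by blast
  \<comment> \<open>The parameters tend to 0 and are pairwise distinct; the latter turns finitely
    many zeros of \<open>c\<close> on the line into finitely many bad indices.\<close>
  define s :: "nat \<Rightarrow> complex" where "s k = of_real (inverse (real (Suc k)))" for k
  have s: "s \<longlonglongrightarrow> 0"
    unfolding s_def using tendsto_of_real[OF LIMSEQ_inverse_real_of_nat, where 'a = complex] by simp
  define x where "x k = (\<lambda>v. y v + s k * (u v - y v))" for k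
  have x: "(\<lambda>k. x k w) \<longlonglongrightarrow> y w" for w
    unfolding x_def using s by (auto intro!: tendsto_eq_intros)
  define Q where "Q k = to_univ_at (x k) v q" for k
  have Q: "poly (Q k) z = meval ((x k)(v := z)) q"
    and Q': "poly (pderiv (Q k)) z = meval ((x k)(v := z)) (mpderiv v q)" for k z
    by (simp_all add: Q_def pderiv_to_univ_at poly_to_univ_at)
  have xy: "(\<lambda>k. ((x k)(v := y v)) w) \<longlonglongrightarrow> y w" for w
    using x by (cases "w = v") simp_all
  have lim: "(\<lambda>k. poly (Q k) (y v)) \<longlonglongrightarrow> 0"
    and lim': "(\<lambda>k. poly (pderiv (Q k)) (y v)) \<longlonglongrightarrow> meval y (mpderiv v q)"
    using tendsto_meval[where \<rho> = "\<lambda>k. (x k)(v := y v)" and x = y, OF xy] y(1)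
    unfolding Q Q' by metis+
  have ev: "\<forall>\<^sub>F k in sequentially. poly (pderiv (Q k)) (y v) \<noteq> 0"
    using tendsto_imp_eventually_ne[OF lim' y(2)] .
  \<comment> \<open>The choice is meaningful only where the derivative does not vanish, which by
    \<open>ev\<close> is the case for all large \<open>k\<close>.\<close>
  define r where "r k = (SOME r. poly (Q k) r = 0 \<and>
      norm (y v - r) * norm (poly (pderiv (Q k)) (y v)) \<le> Polynomial.degree (Q k) * norm (poly (Q k) (y v)))" for k
  have r: "poly (Q k) (r k) = 0 \<and> norm (y v - r k) * norm (poly (pderiv (Q k)) (y v)) \<le>
      Polynomial.degree (Q k) * norm (poly (Q k) (y v))" if "poly (pderiv (Q k)) (y v) \<noteq> 0" for k
    unfolding r_def using root_distance[OF that] by (rule someI_ex)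
  have "r \<longlonglongrightarrow> y v"
  proof -
    have "(\<lambda>k. mdeg v q * norm (poly (Q k) (y v)) / norm (poly (pderiv (Q k)) (y v))) \<longlonglongrightarrow> 0"
      using lim lim' y(2) by (auto intro!: tendsto_eq_intros)
    moreover have "\<forall>\<^sub>F k in sequentially. norm (r k - y v) \<le>
        mdeg v q * norm (poly (Q k) (y v)) / norm (poly (pderiv (Q k)) (y v))"
      using ev
    proof eventually_elim
      case (elim k)
      have "norm (y v - r k) * norm (poly (pderiv (Q k)) (y v)) \<le> Polynomial.degree (Q k) * norm (poly (Q k) (y v))"
        using r[OF elim] by simp
      also have "\<dots> \<le> mdeg v q * norm (poly (Q k) (y v))"
        unfolding Q_def by (intro mult_right_mono) (simp_all add: degree_to_univ_at_le)
      finally show ?case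
        using elim by (simp add: field_simps norm_minus_commute)
    qed
    ultimately have "(\<lambda>k. r k - y v) \<longlonglongrightarrow> 0"
      by (rule Lim_null_comparison[rotated])
    then show ?thesis
      by (rule LIM_zero_cancel)
  qed
  then have "(\<lambda>k. ((x k)(v := r k)) w) \<longlonglongrightarrow> y w" for w
    using x by (cases "w = v") simp_all
  then have "(\<lambda>k. meval ((x k)(v := r k)) g) \<longlonglongrightarrow> meval y g"
    by (rule tendsto_meval)
  moreover have "(\<lambda>k. meval ((x k)(v := r k)) g) \<longlonglongrightarrow> 0"
  proof (rule tendsto_eventually)
    \<comment> \<open>This is \<open>c\<close> along the line from \<open>y\<close> to
      \<open>u\<close>; it is not the zero polynomial, since its value at 1 is that of
      \<open>c\<close> at \<open>u\<close>. Replacing the coordinate \<open>v\<close> by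
      \<open>r k\<close> does not affect \<open>c\<close>.\<close>
    define C where "C = mhom (\<lambda>c. [:c:]) (\<lambda>w. [:y w, u w - y w:]) c"
    have C: "poly C z = meval (\<lambda>w. y w + z * (u w - y w)) c" for z
      by (simp add: C_def poly_mhom)
    then have "poly C 1 \<noteq> 0"
      using u by simp
    then have "C \<noteq> 0"
      by auto
    have "inj s"
      by (auto simp: inj_def s_def)
    then have "finite {k. poly C (s k) = 0}"
      using finite_vimageI[OF poly_roots_finite[OF \<open>C \<noteq> 0\<close>], of s] by (simp add: vimage_def)
    then have "\<forall>\<^sub>F k in sequentially. poly C (s k) \<noteq> 0"
        by (simp add: cofinite_eq_sequentially[symmetric] eventually_cofinite)
    then show "\<forall>\<^sub>F k in sequentially. meval ((x k)(v := r k)) g = 0"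
      using ev
    proof eventually_elim
      case (elim k)
      have "meval ((x k)(v := r k)) (c * g) = 0"
        using g r[OF elim(2)] by (simp add: Q)
      moreover have "meval ((x k)(v := r k)) c = meval (x k) c"
        using c(2) by (intro meval_cong) auto
      moreover have "meval (x k) c = poly C (s k)"
        by (simp add: C x_def)
      ultimately show ?case
        using elim(1) by simp
    qed
  qed
  ultimately show ?thesis
    using LIMSEQ_unique by blast
qed


section \<open>Ideals of polynomial rings and localization\<close>

context const_field
begin

lemma mpoly_ring_simps [simp]:
  "carrier (mpoly_ring K V) = polys K V"
  "p \<otimes>\<^bsub>mpoly_ring K V\<^esub> q = p * q"
  "p \<oplus>\<^bsub>mpoly_ring K V\<^esub> q = p + q"
  "\<one>\<^bsub>mpoly_ring K V\<^esub> = 1"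
  "\<zero>\<^bsub>mpoly_ring K V\<^esub> = 0"
  by (simp_all add: mpoly_ring_def cring_on_def)

lemma cring_mpoly_ring: "cring (mpoly_ring K V)"
proof (rule cringI)
  show "abelian_group (mpoly_ring K V)"
  proof (rule abelian_groupI)
    fix p assume "p \<in> carrier (mpoly_ring K V)"
    then show "\<exists>q\<in>carrier (mpoly_ring K V). q \<oplus>\<^bsub>mpoly_ring K V\<^esub> p = \<zero>\<^bsub>mpoly_ring K V\<^esub>"
      by (intro bexI[of _ "- p"]) (simp_all add: polys_uminus)
  qed (simp_all add: polys_add algebra_simps)
  show "comm_monoid (mpoly_ring K V)"
    by (rule comm_monoidI) (simp_all add: polys_mult algebra_simps)
qed (simp add: algebra_simps)

lemma ring_mpoly_ring: "ring (mpoly_ring K V)"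
  using cring_mpoly_ring by (rule cring.axioms)

lemma domain_mpoly_ring: "domain (mpoly_ring K V)"
  using cring_mpoly_ring by (rule domain.intro) (simp add: domain_axioms_def mpoly_mult_eq_0_iff)

lemma mpoly_ring_uminus:
  assumes "p \<in> polys K V" shows "\<ominus>\<^bsub>mpoly_ring K V\<^esub> p = - p"
proof -
  interpret cring "mpoly_ring K V" by (rule cring_mpoly_ring)
  show ?thesis
    using assms by (intro minus_equality) (simp_all add: polys_uminus)
qed

lemma mpoly_ring_pow: "p [^]\<^bsub>mpoly_ring K V\<^esub> (k::nat) = p ^ k"
  by (induction k) (simp_all add: nat_pow_def mult.commute)

lemma ideal_mpoly_ringI:
  assumes "I \<subseteq> polys K V" "0 \<in> I" "\<And>p q. p \<in> I \<Longrightarrow> q \<in> I \<Longrightarrow> p + q \<in> I"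
    and mult: "\<And>p q. p \<in> polys K V \<Longrightarrow> q \<in> I \<Longrightarrow> p * q \<in> I"
  shows "ideal I (mpoly_ring K V)"
proof -
  interpret cring "mpoly_ring K V" by (rule cring_mpoly_ring)
  have "- p \<in> I" if "p \<in> I" for p
    using mult[of "- 1" p] that polys_uminus[of 1 V] by simp
  moreover have "q * p \<in> I" if "p \<in> polys K V" "q \<in> I" for p q
    using mult[OF that] by (simp add: mult.commute)
  ultimately show ?thesis
    using assms
    by (intro idealI ring_axioms add.subgroupI)
      (auto simp: mpoly_ring_uminus a_inv_def[symmetric] subset_iff)
qed

lemma ideal_mpoly_ringD:
  assumes "ideal I (mpoly_ring K V)"
  shows "I \<subseteq> polys K V" "0 \<in> I" "\<And>p q. p \<in> I \<Longrightarrow> q \<in> I \<Longrightarrow> p + q \<in> I"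
    "\<And>p q. p \<in> polys K V \<Longrightarrow> q \<in> I \<Longrightarrow> p * q \<in> I"
    "\<And>p q. p \<in> I \<Longrightarrow> q \<in> I \<Longrightarrow> p - q \<in> I"
proof -
  interpret ideal I "mpoly_ring K V" by fact
  show sub: "I \<subseteq> polys K V"
    using a_subset by simp
  show "0 \<in> I" and add: "\<And>p q. p \<in> I \<Longrightarrow> q \<in> I \<Longrightarrow> p + q \<in> I"
    using additive_subgroup.zero_closed[OF additive_subgroup_axioms]
      additive_subgroup.a_closed[OF additive_subgroup_axioms] by simp_all
  show mult: "p * q \<in> I" if "p \<in> polys K V" "q \<in> I" for p q
    using I_l_closed[of q p] that by simp
  show "p - q \<in> I" if "p \<in> I" "q \<in> I" for p q
    using add[of p "- q"] mult[of "- 1" q] polys_uminus[of 1 V] that by simp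
qed

lemma genideal_mpoly_ring:
  assumes "S \<subseteq> polys K V"
  shows "ideal (genideal (mpoly_ring K V) S) (mpoly_ring K V)"
    "S \<subseteq> genideal (mpoly_ring K V) S"
    "\<And>I. ideal I (mpoly_ring K V) \<Longrightarrow> S \<subseteq> I \<Longrightarrow> genideal (mpoly_ring K V) S \<subseteq> I"
  using assms ring.genideal_ideal[OF ring_mpoly_ring] ring.genideal_self[OF ring_mpoly_ring]
    ring.genideal_minimal[OF ring_mpoly_ring] by simp_all

lemma primeideal_mpoly_ring_iff:
  "primeideal P (mpoly_ring K V) \<longleftrightarrow> ideal P (mpoly_ring K V) \<and> 1 \<notin> P \<and>
    (\<forall>p\<in>polys K V. \<forall>q\<in>polys K V. p * q \<in> P \<longrightarrow> p \<in> P \<or> q \<in> P)"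
proof
  assume "primeideal P (mpoly_ring K V)"
  then interpret primeideal P "mpoly_ring K V" .
  show "ideal P (mpoly_ring K V) \<and> 1 \<notin> P \<and>
    (\<forall>p\<in>polys K V. \<forall>q\<in>polys K V. p * q \<in> P \<longrightarrow> p \<in> P \<or> q \<in> P)"
    using is_ideal one_imp_carrier I_notcarr I_prime by auto
next
  assume *: "ideal P (mpoly_ring K V) \<and> 1 \<notin> P \<and>
    (\<forall>p\<in>polys K V. \<forall>q\<in>polys K V. p * q \<in> P \<longrightarrow> p \<in> P \<or> q \<in> P)"
  then have "polys K V \<noteq> P"
    using polys_one by blast
  with * show "primeideal P (mpoly_ring K V)"
    by (intro primeidealI cring_mpoly_ring) simp_all
qed

lemma ideal_vimage_mpoly_ring:
  assumes "ideal I (mpoly_ring K V')"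
    and h: "h 0 = 0" "\<And>p. p \<in> polys K V \<Longrightarrow> h p \<in> polys K V'"
      "\<And>p q. p \<in> polys K V \<Longrightarrow> q \<in> polys K V \<Longrightarrow> h (p + q) = h p + h q"
      "\<And>p q. p \<in> polys K V \<Longrightarrow> q \<in> polys K V \<Longrightarrow> h (p * q) = h p * h q"
  shows "ideal {p \<in> polys K V. h p \<in> I} (mpoly_ring K V)"
  using ideal_mpoly_ringD[OF assms(1)] h
  by (intro ideal_mpoly_ringI) (auto intro: polys_add polys_mult)

end

section \<open>Localization at a multiplicative subset, and fraction fields\<close>

lemma carrier_localization: "carrier (localization D S) = (carrier D \<times> S) // loc_rel D S"
  by (simp add: localization_def)

text \<open>Shared by the two localizations in use: the fraction field of the quotient by a prime
  ideal, and K(U)[Z] as K[U, Z] localized at the nonzero elements of K[U]. The ring may have zero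
  divisors, hence the factor \<open>w\<close> in \<open>loc_rel\<close>.\<close>

locale mult_subset = cring D for D (structure) +
  fixes S
  assumes S_carrier: "S \<subseteq> carrier D" and S_one: "\<one> \<in> S" and S_mult: "s \<in> S \<Longrightarrow> t \<in> S \<Longrightarrow> s \<otimes> t \<in> S"
begin

lemma S_closed [simp]: "s \<in> S \<Longrightarrow> s \<in> carrier D"
  using S_carrier by blast

lemma loc_relI:
  assumes "a \<in> carrier D" "b \<in> carrier D" "s \<in> S" "t \<in> S" "w \<in> S" "w \<otimes> (a \<otimes> t) = w \<otimes> (b \<otimes> s)"
  shows "((a, s), (b, t)) \<in> loc_rel D S"
  using assms unfolding loc_rel_def by blast

lemma equiv_loc_rel: "equiv (carrier D \<times> S) (loc_rel D S)"
proof (rule equivI)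
  show "loc_rel D S \<subseteq> (carrier D \<times> S) \<times> (carrier D \<times> S)"
    by (auto simp: loc_rel_def)
  show "refl_on (carrier D \<times> S) (loc_rel D S)"
    by (auto simp: refl_on_def intro: loc_relI[OF _ _ _ _ S_one])
  show "sym (loc_rel D S)"
    by (auto simp: sym_def loc_rel_def intro: sym)
  show "trans (loc_rel D S)"
  proof (rule transI, clarify)
    fix a s b t c u
    assume "((a, s), (b, t)) \<in> loc_rel D S" "((b, t), (c, u)) \<in> loc_rel D S"
    then obtain w w' where *: "a \<in> carrier D" "b \<in> carrier D" "c \<in> carrier D" "s \<in> S" "t \<in> S" "u \<in> S"
      "w \<in> S" "w' \<in> S" "w \<otimes> (a \<otimes> t) = w \<otimes> (b \<otimes> s)" "w' \<otimes> (b \<otimes> u) = w' \<otimes> (c \<otimes> t)"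
      by (auto simp: loc_rel_def)
    \<comment> \<open>The middle denominator \<open>t\<close> cannot be cancelled in general, so it
      joins \<open>w\<close> and \<open>w'\<close> in the witness.\<close>
    have "w \<otimes> w' \<otimes> t \<otimes> (a \<otimes> u) = w \<otimes> (a \<otimes> t) \<otimes> (w' \<otimes> u)"
      using *(1-8) by (simp add: m_ac)
    also have "\<dots> = w' \<otimes> (b \<otimes> u) \<otimes> (w \<otimes> s)"
      using *(1-8) unfolding *(9) by (simp add: m_ac)
    also have "\<dots> = w \<otimes> w' \<otimes> t \<otimes> (c \<otimes> s)"
      using *(1-8) unfolding *(10) by (simp add: m_ac)
    finally show "((a, s), (c, u)) \<in> loc_rel D S"
      using *(1-8) by (intro loc_relI[of _ _ _ _ "w \<otimes> w' \<otimes> t"] S_mult)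
  qed
qed

lemma frac_eqI:
  assumes "a \<in> carrier D" "b \<in> carrier D" "s \<in> S" "t \<in> S" "w \<in> S" "w \<otimes> (a \<otimes> t) = w \<otimes> (b \<otimes> s)"
  shows "loc_frac D S a s = loc_frac D S b t"
  unfolding loc_frac_def using equiv_loc_rel loc_relI[OF assms] by (rule equiv_class_eq)

lemma frac_eqI':
  assumes "a \<in> carrier D" "b \<in> carrier D" "s \<in> S" "t \<in> S" "a \<otimes> t = b \<otimes> s"
  shows "loc_frac D S a s = loc_frac D S b t"
  using assms by (intro frac_eqI[OF _ _ _ _ S_one]) simp_all

lemma frac_eqD:
  assumes "loc_frac D S a s = loc_frac D S b t" "a \<in> carrier D" "b \<in> carrier D" "s \<in> S" "t \<in> S"
  shows "\<exists>w\<in>S. w \<otimes> (a \<otimes> t) = w \<otimes> (b \<otimes> s)"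
  using assms eq_equiv_class_iff[OF equiv_loc_rel, of "(a, s)" "(b, t)"]
  unfolding loc_frac_def by (auto simp: loc_rel_def)

lemma frac_closed: "a \<in> carrier D \<Longrightarrow> s \<in> S \<Longrightarrow> loc_frac D S a s \<in> carrier (localization D S)"
  by (auto simp: carrier_localization loc_frac_def intro: quotientI)

lemma frac_cases:
  assumes "x \<in> carrier (localization D S)"
  obtains a s where "a \<in> carrier D" "s \<in> S" "x = loc_frac D S a s"
  using assms by (auto simp: carrier_localization loc_frac_def elim: quotientE)

text \<open>The product is a union over all pairs of representatives. It collapses to one class
  because the result does not depend on the choice; by commutativity, independence has to be checked
  in one argument only.\<close>

lemma mult_frac:
  assumes "a \<in> carrier D" "s \<in> S" "b \<in> carrier D" "t \<in> S"
  shows "loc_frac D S a s \<otimes>\<^bsub>localization D S\<^esub> loc_frac D S b t = loc_frac D S (a \<otimes> b) (s \<otimes> t)"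
proof -
  have "congruent2 (loc_rel D S) (loc_rel D S)
      (\<lambda>x y. (\<lambda>(a, s). (\<lambda>(b, t). loc_frac D S (a \<otimes> b) (s \<otimes> t)) y) x)"
  proof (rule congruent2_commuteI[OF equiv_loc_rel])
    show "(\<lambda>(a, s). (\<lambda>(b, t). loc_frac D S (a \<otimes> b) (s \<otimes> t)) z) y =
        (\<lambda>(a, s). (\<lambda>(b, t). loc_frac D S (a \<otimes> b) (s \<otimes> t)) y) z"
      if "y \<in> carrier D \<times> S" "z \<in> carrier D \<times> S" for y z
      using that by (auto simp: m_comm)
    show "(\<lambda>(a, s). (\<lambda>(b, t). loc_frac D S (a \<otimes> b) (s \<otimes> t)) y) w =
        (\<lambda>(a, s). (\<lambda>(b, t). loc_frac D S (a \<otimes> b) (s \<otimes> t)) z) w"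
      if w: "w \<in> carrier D \<times> S" and yz: "(y, z) \<in> loc_rel D S" for y z w
    proof -
      obtain c u where cu: "w = (c, u)" "c \<in> carrier D" "u \<in> S"
        using w by blast
      obtain a s b t v where *: "y = (a, s)" "z = (b, t)" "a \<in> carrier D" "s \<in> S" "b \<in> carrier D" "t \<in> S"
          "v \<in> S" "v \<otimes> (a \<otimes> t) = v \<otimes> (b \<otimes> s)"
        using yz by (auto simp: loc_rel_def)
      have "v \<otimes> (c \<otimes> a \<otimes> (u \<otimes> t)) = v \<otimes> (a \<otimes> t) \<otimes> (c \<otimes> u)"
        using *(1-7) cu by (simp add: m_ac)
      also have "\<dots> = v \<otimes> (c \<otimes> b \<otimes> (u \<otimes> s))"
        unfolding *(8) using *(1-7) cu by (simp add: m_ac)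
      finally show ?thesis
        using * cu by (simp, intro frac_eqI[of _ _ _ _ v]) (simp_all add: S_mult)
    qed
  qed
  from UN_equiv_class2[OF equiv_loc_rel equiv_loc_rel this, of "(a, s)" "(b, t)"] assms
  show ?thesis
    by (simp add: localization_def loc_frac_def[of D S a s] loc_frac_def[of D S b t] case_prod_beta')
qed

lemma add_frac:
  assumes "a \<in> carrier D" "s \<in> S" "b \<in> carrier D" "t \<in> S"
  shows "loc_frac D S a s \<oplus>\<^bsub>localization D S\<^esub> loc_frac D S b t =
    loc_frac D S (a \<otimes> t \<oplus> b \<otimes> s) (s \<otimes> t)"
proof -
  have "congruent2 (loc_rel D S) (loc_rel D S)
      (\<lambda>x y. (\<lambda>(a, s). (\<lambda>(b, t). loc_frac D S (a \<otimes> t \<oplus> b \<otimes> s) (s \<otimes> t)) y) x)"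
  proof (rule congruent2_commuteI[OF equiv_loc_rel])
    show "(\<lambda>(a, s). (\<lambda>(b, t). loc_frac D S (a \<otimes> t \<oplus> b \<otimes> s) (s \<otimes> t)) z) y =
        (\<lambda>(a, s). (\<lambda>(b, t). loc_frac D S (a \<otimes> t \<oplus> b \<otimes> s) (s \<otimes> t)) y) z"
      if "y \<in> carrier D \<times> S" "z \<in> carrier D \<times> S" for y z
      using that by (auto simp: m_comm a_comm)
    show "(\<lambda>(a, s). (\<lambda>(b, t). loc_frac D S (a \<otimes> t \<oplus> b \<otimes> s) (s \<otimes> t)) y) w =
        (\<lambda>(a, s). (\<lambda>(b, t). loc_frac D S (a \<otimes> t \<oplus> b \<otimes> s) (s \<otimes> t)) z) w"
      if w: "w \<in> carrier D \<times> S" and yz: "(y, z) \<in> loc_rel D S" for y z w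
    proof -
      obtain c u where cu: "w = (c, u)" "c \<in> carrier D" "u \<in> S"
        using w by blast
      obtain a s b t v where *: "y = (a, s)" "z = (b, t)" "a \<in> carrier D" "s \<in> S" "b \<in> carrier D" "t \<in> S"
          "v \<in> S" "v \<otimes> (a \<otimes> t) = v \<otimes> (b \<otimes> s)"
        using yz by (auto simp: loc_rel_def)
      have "v \<otimes> ((c \<otimes> s \<oplus> a \<otimes> u) \<otimes> (u \<otimes> t)) =
          v \<otimes> (c \<otimes> s \<otimes> u \<otimes> t) \<oplus> v \<otimes> (a \<otimes> t) \<otimes> (u \<otimes> u)"
        using *(1-7) cu by (simp add: l_distr r_distr m_ac)
      also have "\<dots> = v \<otimes> ((c \<otimes> t \<oplus> b \<otimes> u) \<otimes> (u \<otimes> s))"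
        unfolding *(8) using *(1-7) cu by (simp add: l_distr r_distr m_ac)
      finally show ?thesis
        using * cu by (simp, intro frac_eqI[of _ _ _ _ v]) (simp_all add: S_mult)
    qed
  qed
  from UN_equiv_class2[OF equiv_loc_rel equiv_loc_rel this, of "(a, s)" "(b, t)"] assms
  show ?thesis
    by (simp add: localization_def loc_frac_def[of D S a s] loc_frac_def[of D S b t] case_prod_beta')
qed

lemma one_localization: "\<one>\<^bsub>localization D S\<^esub> = loc_frac D S \<one> \<one>"
  and zero_localization: "\<zero>\<^bsub>localization D S\<^esub> = loc_frac D S \<zero> \<one>"
  by (simp_all add: localization_def)

lemmas localization_simps = mult_frac add_frac one_localization zero_localization

lemma cring_localization: "cring (localization D S)"
proof (rule cringI)
  show "abelian_group (localization D S)"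
  proof (rule abelian_groupI)
    fix x assume "x \<in> carrier (localization D S)"
    then obtain a s where x: "a \<in> carrier D" "s \<in> S" "x = loc_frac D S a s"
      by (rule frac_cases)
    show "\<zero>\<^bsub>localization D S\<^esub> \<oplus>\<^bsub>localization D S\<^esub> x = x"
      using x by (simp add: localization_simps S_one)
    have "loc_frac D S (\<ominus> a) s \<oplus>\<^bsub>localization D S\<^esub> x = loc_frac D S \<zero> (s \<otimes> s)"
      using x by (simp add: localization_simps l_minus l_neg)
    also have "\<dots> = \<zero>\<^bsub>localization D S\<^esub>"
      unfolding zero_localization using x by (intro frac_eqI') (simp_all add: S_one S_mult)
    finally show "\<exists>y\<in>carrier (localization D S). y \<oplus>\<^bsub>localization D S\<^esub> x = \<zero>\<^bsub>localization D S\<^esub>"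
      using x by (intro bexI[of _ "loc_frac D S (\<ominus> a) s"]) (simp_all add: frac_closed)
  next
    fix x y assume "x \<in> carrier (localization D S)" "y \<in> carrier (localization D S)"
    then obtain a s b t where *: "a \<in> carrier D" "s \<in> S" "b \<in> carrier D" "t \<in> S"
      "x = loc_frac D S a s" "y = loc_frac D S b t"
      by (elim frac_cases) blast
    then show "x \<oplus>\<^bsub>localization D S\<^esub> y \<in> carrier (localization D S)"
      by (simp add: add_frac S_mult frac_closed)
    show "x \<oplus>\<^bsub>localization D S\<^esub> y = y \<oplus>\<^bsub>localization D S\<^esub> x"
      using * by (simp add: add_frac m_comm a_comm)
  next
    fix x y z
    assume "x \<in> carrier (localization D S)" "y \<in> carrier (localization D S)" "z \<in> carrier (localization D S)"
    then obtain a s b t c u where *: "a \<in> carrier D" "s \<in> S" "b \<in> carrier D" "t \<in> S" "c \<in> carrier D" "u \<in> S"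
      "x = loc_frac D S a s" "y = loc_frac D S b t" "z = loc_frac D S c u"
      by (elim frac_cases) blast
    show "x \<oplus>\<^bsub>localization D S\<^esub> y \<oplus>\<^bsub>localization D S\<^esub> z =
        x \<oplus>\<^bsub>localization D S\<^esub> (y \<oplus>\<^bsub>localization D S\<^esub> z)"
      unfolding *(7-9) using *(1-6) by (simp add: add_frac S_mult l_distr r_distr m_ac a_ac)
  qed (simp add: localization_simps S_one frac_closed)
  show "comm_monoid (localization D S)"
  proof (rule comm_monoidI)
    fix x assume "x \<in> carrier (localization D S)"
    then obtain a s where x: "a \<in> carrier D" "s \<in> S" "x = loc_frac D S a s"
      by (rule frac_cases)
    then show "\<one>\<^bsub>localization D S\<^esub> \<otimes>\<^bsub>localization D S\<^esub> x = x"
      by (simp add: localization_simps S_one)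
  next
    fix x y assume "x \<in> carrier (localization D S)" "y \<in> carrier (localization D S)"
    then obtain a s b t where *: "a \<in> carrier D" "s \<in> S" "b \<in> carrier D" "t \<in> S"
      "x = loc_frac D S a s" "y = loc_frac D S b t"
      by (elim frac_cases) blast
    then show "x \<otimes>\<^bsub>localization D S\<^esub> y \<in> carrier (localization D S)"
      by (simp add: mult_frac S_mult frac_closed)
    show "x \<otimes>\<^bsub>localization D S\<^esub> y = y \<otimes>\<^bsub>localization D S\<^esub> x"
      using * by (simp add: mult_frac m_comm)
  next
    fix x y z
    assume "x \<in> carrier (localization D S)" "y \<in> carrier (localization D S)" "z \<in> carrier (localization D S)"
    then obtain a s b t c u where *: "a \<in> carrier D" "s \<in> S" "b \<in> carrier D" "t \<in> S" "c \<in> carrier D" "u \<in> S"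
      "x = loc_frac D S a s" "y = loc_frac D S b t" "z = loc_frac D S c u"
      by (elim frac_cases) blast
    show "x \<otimes>\<^bsub>localization D S\<^esub> y \<otimes>\<^bsub>localization D S\<^esub> z =
        x \<otimes>\<^bsub>localization D S\<^esub> (y \<otimes>\<^bsub>localization D S\<^esub> z)"
      unfolding *(7-9) using *(1-6) by (simp add: mult_frac S_mult m_ac)
  qed (simp add: localization_simps S_one frac_closed)
next
  fix x y z
  assume "x \<in> carrier (localization D S)" "y \<in> carrier (localization D S)" "z \<in> carrier (localization D S)"
  then obtain a s b t c u where *: "a \<in> carrier D" "s \<in> S" "b \<in> carrier D" "t \<in> S" "c \<in> carrier D" "u \<in> S"
    "x = loc_frac D S a s" "y = loc_frac D S b t" "z = loc_frac D S c u"
    by (elim frac_cases) blast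
  have "(x \<oplus>\<^bsub>localization D S\<^esub> y) \<otimes>\<^bsub>localization D S\<^esub> z =
      loc_frac D S ((a \<otimes> t \<oplus> b \<otimes> s) \<otimes> c) (s \<otimes> t \<otimes> u)"
    unfolding *(7-9) using *(1-6) by (simp add: localization_simps S_mult)
  also have "\<dots> = loc_frac D S (a \<otimes> c \<otimes> (t \<otimes> u) \<oplus> b \<otimes> c \<otimes> (s \<otimes> u)) (s \<otimes> u \<otimes> (t \<otimes> u))"
    using *(1-6) by (intro frac_eqI') (simp_all add: S_mult l_distr r_distr m_ac)
  also have "\<dots> = x \<otimes>\<^bsub>localization D S\<^esub> z \<oplus>\<^bsub>localization D S\<^esub> y \<otimes>\<^bsub>localization D S\<^esub> z"
    unfolding *(7-9) using *(1-6) by (simp add: localization_simps S_mult)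
  finally show "(x \<oplus>\<^bsub>localization D S\<^esub> y) \<otimes>\<^bsub>localization D S\<^esub> z =
      x \<otimes>\<^bsub>localization D S\<^esub> z \<oplus>\<^bsub>localization D S\<^esub> y \<otimes>\<^bsub>localization D S\<^esub> z" .
qed

end

context "domain"
begin

lemma mult_subset_nonzero: "mult_subset R (carrier R - {\<zero>})"
  by unfold_locales (auto simp: integral_iff)

lemma field_frac_field: "field (frac_field R)"
proof -
  interpret mult_subset R "carrier R - {\<zero>}"
    by (rule mult_subset_nonzero)
  show ?thesis
    unfolding frac_field_def
  proof (rule cring.cring_fieldI2[OF cring_localization])
    show "\<zero>\<^bsub>localization R (carrier R - {\<zero>})\<^esub> \<noteq> \<one>\<^bsub>localization R (carrier R - {\<zero>})\<^esub>"
      unfolding localization_simps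
    proof
      assume "loc_frac R (carrier R - {\<zero>}) \<zero> \<one> = loc_frac R (carrier R - {\<zero>}) \<one> \<one>"
      from frac_eqD[OF this] show False
        by auto
    qed
  next
    fix x assume x: "x \<in> carrier (localization R (carrier R - {\<zero>}))"
      "x \<noteq> \<zero>\<^bsub>localization R (carrier R - {\<zero>})\<^esub>"
    then obtain a s where *: "a \<in> carrier R" "s \<in> carrier R - {\<zero>}" "x = loc_frac R (carrier R - {\<zero>}) a s"
      by (auto elim!: frac_cases)
    have "a \<noteq> \<zero>"
    proof
      assume "a = \<zero>"
      then have "x = \<zero>\<^bsub>localization R (carrier R - {\<zero>})\<^esub>"
        unfolding zero_localization *(3) using * by (intro frac_eqI') simp_all
      then show False
        using x(2) by simp
    qed
    then have "x \<otimes>\<^bsub>localization R (carrier R - {\<zero>})\<^esub> loc_frac R (carrier R - {\<zero>}) s a =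
        loc_frac R (carrier R - {\<zero>}) (a \<otimes> s) (s \<otimes> a)"
      using * by (simp add: mult_frac)
    also have "\<dots> = \<one>\<^bsub>localization R (carrier R - {\<zero>})\<^esub>"
      unfolding one_localization using * \<open>a \<noteq> \<zero>\<close>
      by (intro frac_eqI') (simp_all add: m_comm integral_iff)
    finally have "x \<otimes>\<^bsub>localization R (carrier R - {\<zero>})\<^esub> loc_frac R (carrier R - {\<zero>}) s a =
        \<one>\<^bsub>localization R (carrier R - {\<zero>})\<^esub>" .
    then show "\<exists>y\<in>carrier (localization R (carrier R - {\<zero>})).
        x \<otimes>\<^bsub>localization R (carrier R - {\<zero>})\<^esub> y = \<one>\<^bsub>localization R (carrier R - {\<zero>})\<^esub>"
      using * \<open>a \<noteq> \<zero>\<close> by (intro bexI[of _ "loc_frac R (carrier R - {\<zero>}) s a"] frac_closed) simp_all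
  qed
qed

lemma frac_field_hom:
  defines "\<kappa> \<equiv> (\<lambda>a. loc_frac R (carrier R - {\<zero>}) a \<one>)"
  shows "\<kappa> \<in> ring_hom R (frac_field R)" "\<And>a. a \<in> carrier R \<Longrightarrow> \<kappa> a = \<zero>\<^bsub>frac_field R\<^esub> \<longleftrightarrow> a = \<zero>"
proof -
  interpret mult_subset R "carrier R - {\<zero>}"
    by (rule mult_subset_nonzero)
  show "\<kappa> \<in> ring_hom R (frac_field R)"
    unfolding \<kappa>_def frac_field_def
    by (rule ring_hom_memI) (simp_all add: localization_simps frac_closed)
  show "\<kappa> a = \<zero>\<^bsub>frac_field R\<^esub> \<longleftrightarrow> a = \<zero>" if a: "a \<in> carrier R" for a
  proof
    assume "\<kappa> a = \<zero>\<^bsub>frac_field R\<^esub>"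
    then have "loc_frac R (carrier R - {\<zero>}) a \<one> = loc_frac R (carrier R - {\<zero>}) \<zero> \<one>"
      by (simp add: \<kappa>_def frac_field_def zero_localization)
    from frac_eqD[OF this] a show "a = \<zero>"
      by (auto simp: integral_iff)
  qed (simp add: \<kappa>_def frac_field_def zero_localization)
qed

end

text \<open>The class map is the projection of \<open>R\<close> onto the domain R/P followed by the
  embedding of R/P into its fraction field; the second map is injective, so the kernel is
  \<open>P\<close>.\<close>

lemma quot_class_hom:
  assumes "primeideal P R"
  shows "field (quot_field R P)" "quot_class R P \<in> ring_hom R (quot_field R P)"
    "\<And>p. p \<in> carrier R \<Longrightarrow> quot_class R P p = \<zero>\<^bsub>quot_field R P\<^esub> \<longleftrightarrow> p \<in> P"
proof -
  interpret primeideal P R by fact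
  interpret D: "domain" "R Quot P" by (rule quotient_is_domain)
  show "field (quot_field R P)"
    unfolding quot_field_def by (rule D.field_frac_field)
  have eq: "quot_class R P = (\<lambda>a. loc_frac (R Quot P) (carrier (R Quot P) - {\<zero>\<^bsub>R Quot P\<^esub>}) a \<one>\<^bsub>R Quot P\<^esub>) \<circ> (+>\<^bsub>R\<^esub>) P"
    by (simp add: o_def quot_class_def[abs_def])
  show "quot_class R P \<in> ring_hom R (quot_field R P)"
    unfolding quot_field_def eq using rcos_ring_hom D.frac_field_hom(1) by (rule ring_hom_trans)
  fix p assume p: "p \<in> carrier R"
  then have "P +>\<^bsub>R\<^esub> p \<in> carrier (R Quot P)"
    using rcos_ring_hom by (auto simp: ring_hom_def)
  then have "quot_class R P p = \<zero>\<^bsub>quot_field R P\<^esub> \<longleftrightarrow> P +>\<^bsub>R\<^esub> p = \<zero>\<^bsub>R Quot P\<^esub>"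
    unfolding quot_field_def quot_class_def by (rule D.frac_field_hom(2))
  also have "\<dots> \<longleftrightarrow> p \<in> P"
    using p a_rcos_const a_rcos_self by (auto simp: FactRing_def)
  finally show "quot_class R P p = \<zero>\<^bsub>quot_field R P\<^esub> \<longleftrightarrow> p \<in> P" .
qed


subsection \<open>Algebraic dependence modulo a prime ideal\<close>

context const_field
begin

text \<open>Here \<open>a\<close> is the constant term of an algebraic equation of minimal degree with denominators cleared.\<close>

lemma algebraic_imp_multiple:
  fixes D :: "'v mpoly set" and V U :: "'v set"
  defines "R \<equiv> mpoly_ring K V"
  defines "L \<equiv> quot_field R D" and "\<kappa> \<equiv> quot_class R D"
  assumes prime: "primeideal D R" and UV: "U \<subseteq> V"
    and p: "p \<in> polys K V" "p \<notin> D"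
    and alg: "(ring.algebraic L over
      generate_field L ((\<lambda>c. \<kappa> (mconst c)) ` K \<union> (\<lambda>v. \<kappa> (mvar v)) ` U)) (\<kappa> p)"
  shows "\<exists>a\<in>polys K U. a \<notin> D \<and> (\<exists>g\<in>polys K V. a - g * p \<in> D)"
proof -
  interpret L: field L
    unfolding L_def by (rule quot_class_hom(1)[OF prime])
  interpret R: cring R
    unfolding R_def by (rule cring_mpoly_ring)
  interpret H: ring_hom_ring R L \<kappa>
    by unfold_locales (use quot_class_hom(2)[OF prime] in \<open>simp add: L_def \<kappa>_def\<close>)
  have \<kappa>_zero: "\<kappa> q = \<zero>\<^bsub>L\<^esub> \<longleftrightarrow> q \<in> D" if "q \<in> polys K V" for q
    using quot_class_hom(3)[OF prime, of q] that by (simp add: L_def \<kappa>_def R_def)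
  have pU: "q \<in> polys K V" if "q \<in> polys K U" for q
    using polys_mono[OF UV] that by blast
  have \<kappa>_closed: "\<kappa> q \<in> carrier L" if "q \<in> polys K V" for q
    using H.hom_closed that by (simp add: R_def)
  have \<kappa>_add: "\<kappa> (q + r) = \<kappa> q \<oplus>\<^bsub>L\<^esub> \<kappa> r"
    and \<kappa>_mult: "\<kappa> (q * r) = \<kappa> q \<otimes>\<^bsub>L\<^esub> \<kappa> r" if "q \<in> polys K V" "r \<in> polys K V" for q r
    using H.hom_add[of q r] H.hom_mult[of q r] that by (simp_all add: R_def)
  have \<kappa>_uminus: "\<kappa> (- q) = \<ominus>\<^bsub>L\<^esub> \<kappa> q" if "q \<in> polys K V" for q
    using H.hom_a_inv[of q] that by (simp add: R_def mpoly_ring_uminus)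
  have \<kappa>_one: "\<kappa> 1 = \<one>\<^bsub>L\<^esub>"
    using H.hom_one by (simp add: R_def)
  have D: "1 \<notin> D" "\<And>q r. q \<in> polys K V \<Longrightarrow> r \<in> polys K V \<Longrightarrow> q * r \<in> D \<Longrightarrow> q \<in> D \<or> r \<in> D"
    and ideal: "ideal D (mpoly_ring K V)"
    using prime by (auto simp: R_def primeideal_mpoly_ring_iff)
  note D_closed = ideal_mpoly_ringD[OF ideal]
  let ?S = "(\<lambda>c. \<kappa> (mconst c)) ` K \<union> (\<lambda>v. \<kappa> (mvar v)) ` U"
  let ?G = "generate_field L ?S"
  have S: "?S \<subseteq> carrier L"
    using UV by (auto intro!: \<kappa>_closed polys_mconst polys_mvar)
  have G_carrier: "?G \<subseteq> carrier L"
    using S by (rule L.generate_field_incl)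
  \<comment> \<open>Elements of the generated field are quotients of images of polynomials in K[U].
    The relation is kept free of division; inverting an element exchanges \<open>a\<close> and
    \<open>b\<close>.\<close>
  have G_frac: "\<exists>b\<in>polys K U. \<exists>a\<in>polys K U. b \<notin> D \<and> \<kappa> b \<otimes>\<^bsub>L\<^esub> x = \<kappa> a" if "x \<in> ?G" for x
    using that
  proof (induction rule: generate_field.induct)
    case one
    show ?case
      using D(1) by (intro bexI[of _ 1]) (simp_all add: \<kappa>_one)
  next
    case (incl h)
    then obtain a where "a \<in> polys K U" "h = \<kappa> a"
      by (auto intro: polys_mconst polys_mvar)
    then show ?case
      using D(1) pU \<kappa>_closed by (intro bexI[of _ 1] bexI[of _ a]) (simp_all add: \<kappa>_one)
  next
    case (a_inv h)
    then obtain b a where "b \<in> polys K U" "a \<in> polys K U" "b \<notin> D" "\<kappa> b \<otimes>\<^bsub>L\<^esub> h = \<kappa> a"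
      by blast
    then show ?case
      using a_inv.hyps G_carrier pU \<kappa>_closed
      by (intro bexI[of _ b] bexI[of _ "- a"]) (auto simp: \<kappa>_uminus L.r_minus subset_iff intro: polys_uminus)
  next
    case (m_inv h)
    then obtain b a where *: "b \<in> polys K U" "a \<in> polys K U" "b \<notin> D" "\<kappa> b \<otimes>\<^bsub>L\<^esub> h = \<kappa> a"
      by blast
    have h: "h \<in> carrier L" "h \<noteq> \<zero>\<^bsub>L\<^esub>"
      using m_inv G_carrier by auto
    then have inv: "inv\<^bsub>L\<^esub> h \<in> carrier L" "h \<otimes>\<^bsub>L\<^esub> inv\<^bsub>L\<^esub> h = \<one>\<^bsub>L\<^esub>"
      using L.field_Units by auto
    have b: "\<kappa> b \<in> carrier L" "\<kappa> b \<noteq> \<zero>\<^bsub>L\<^esub>"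
      using * pU \<kappa>_zero \<kappa>_closed by auto
    have "\<kappa> a \<noteq> \<zero>\<^bsub>L\<^esub>"
      using b h by (simp add: *(4)[symmetric] L.integral_iff)
    then have "a \<notin> D"
      using * pU \<kappa>_zero by auto
    moreover have "\<kappa> a \<otimes>\<^bsub>L\<^esub> inv\<^bsub>L\<^esub> h = \<kappa> b"
      using b h inv by (simp add: *(4)[symmetric] L.m_assoc)
    ultimately show ?case
      using * by blast
  next
    case (eng_add h1 h2)
    then obtain b1 a1 b2 a2 where *: "b1 \<in> polys K U" "a1 \<in> polys K U" "b1 \<notin> D" "\<kappa> b1 \<otimes>\<^bsub>L\<^esub> h1 = \<kappa> a1"
      "b2 \<in> polys K U" "a2 \<in> polys K U" "b2 \<notin> D" "\<kappa> b2 \<otimes>\<^bsub>L\<^esub> h2 = \<kappa> a2"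
      by blast
    have h: "h1 \<in> carrier L" "h2 \<in> carrier L"
      using eng_add.hyps G_carrier by auto
    have c: "\<kappa> b1 \<in> carrier L" "\<kappa> b2 \<in> carrier L"
      using * pU \<kappa>_closed by auto
    have "\<kappa> (a1 * b2 + a2 * b1) = \<kappa> b1 \<otimes>\<^bsub>L\<^esub> h1 \<otimes>\<^bsub>L\<^esub> \<kappa> b2 \<oplus>\<^bsub>L\<^esub> \<kappa> b2 \<otimes>\<^bsub>L\<^esub> h2 \<otimes>\<^bsub>L\<^esub> \<kappa> b1"
      using * pU by (simp add: \<kappa>_add \<kappa>_mult polys_mult)
    also have "\<dots> = \<kappa> (b1 * b2) \<otimes>\<^bsub>L\<^esub> (h1 \<oplus>\<^bsub>L\<^esub> h2)"
      using *(1,2,5,6) pU h c by (simp add: \<kappa>_mult L.r_distr L.m_ac)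
    finally have "\<kappa> (b1 * b2) \<otimes>\<^bsub>L\<^esub> (h1 \<oplus>\<^bsub>L\<^esub> h2) = \<kappa> (a1 * b2 + a2 * b1)" ..
    moreover have "b1 * b2 \<notin> D"
      using * pU D(2) by blast
    ultimately show ?case
      using * by (intro bexI[of _ "b1 * b2"] bexI[of _ "a1 * b2 + a2 * b1"])
        (auto intro!: polys_add polys_mult)
  next
    case (eng_mult h1 h2)
    then obtain b1 a1 b2 a2 where *: "b1 \<in> polys K U" "a1 \<in> polys K U" "b1 \<notin> D" "\<kappa> b1 \<otimes>\<^bsub>L\<^esub> h1 = \<kappa> a1"
      "b2 \<in> polys K U" "a2 \<in> polys K U" "b2 \<notin> D" "\<kappa> b2 \<otimes>\<^bsub>L\<^esub> h2 = \<kappa> a2"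
      by blast
    have h: "h1 \<in> carrier L" "h2 \<in> carrier L"
      using eng_mult.hyps G_carrier by auto
    have c: "\<kappa> b1 \<in> carrier L" "\<kappa> b2 \<in> carrier L"
      using * pU \<kappa>_closed by auto
    have "\<kappa> (a1 * a2) = \<kappa> b1 \<otimes>\<^bsub>L\<^esub> h1 \<otimes>\<^bsub>L\<^esub> (\<kappa> b2 \<otimes>\<^bsub>L\<^esub> h2)"
      using * pU by (simp add: \<kappa>_mult)
    also have "\<dots> = \<kappa> (b1 * b2) \<otimes>\<^bsub>L\<^esub> (h1 \<otimes>\<^bsub>L\<^esub> h2)"
      using *(1,2,5,6) pU h c by (simp add: \<kappa>_mult L.m_ac)
    finally have "\<kappa> (b1 * b2) \<otimes>\<^bsub>L\<^esub> (h1 \<otimes>\<^bsub>L\<^esub> h2) = \<kappa> (a1 * a2)" ..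
    moreover have "b1 * b2 \<notin> D"
      using * pU D(2) by blast
    ultimately show ?case
      using * by (intro bexI[of _ "b1 * b2"] bexI[of _ "a1 * a2"]) (auto intro!: polys_mult)
  qed
  let ?x = "\<kappa> p"
  have x: "?x \<in> carrier L" "?x \<noteq> \<zero>\<^bsub>L\<^esub>"
    using p \<kappa>_closed \<kappa>_zero by auto
  have pow: "?x [^]\<^bsub>L\<^esub> (k::nat) = \<kappa> (p ^ k)" for k
    using H.hom_nat_pow[of p k] p(1) by (simp add: R_def mpoly_ring_pow)
  \<comment> \<open>Clears the denominators of all coefficients at once, so that the value at
    \<open>?x\<close> becomes the image of a polynomial.\<close>
  have clear: "\<exists>b\<in>polys K U. \<exists>g\<in>polys K V. b \<notin> D \<and> \<kappa> b \<otimes>\<^bsub>L\<^esub> L.eval cs ?x = \<kappa> g" if "set cs \<subseteq> ?G" for cs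
    using that
  proof (induction cs)
    case Nil
    then show ?case
      using D(1) \<kappa>_zero[of 0] D_closed(2) by (intro bexI[of _ 1] bexI[of _ 0]) (simp_all add: \<kappa>_one)
  next
    case (Cons c cs)
    then obtain b g where *: "b \<in> polys K U" "g \<in> polys K V" "b \<notin> D" "\<kappa> b \<otimes>\<^bsub>L\<^esub> L.eval cs ?x = \<kappa> g"
      by auto
    obtain b' a where **: "b' \<in> polys K U" "a \<in> polys K U" "b' \<notin> D" "\<kappa> b' \<otimes>\<^bsub>L\<^esub> c = \<kappa> a"
      using Cons.prems G_frac[of c] by auto
    let ?q = "p ^ length cs"
    have h: "c \<in> carrier L" "L.eval cs ?x \<in> carrier L" "\<kappa> ?q \<in> carrier L" "?q \<in> polys K V"
      using Cons.prems G_carrier x(1) p(1) by (auto intro!: L.eval_in_carrier \<kappa>_closed polys_power)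
    have c: "\<kappa> b \<in> carrier L" "\<kappa> b' \<in> carrier L"
      using * ** pU \<kappa>_closed by auto
    have "\<kappa> (b * a * ?q + b' * g) =
        \<kappa> b \<otimes>\<^bsub>L\<^esub> (\<kappa> b' \<otimes>\<^bsub>L\<^esub> c) \<otimes>\<^bsub>L\<^esub> \<kappa> ?q \<oplus>\<^bsub>L\<^esub> \<kappa> b' \<otimes>\<^bsub>L\<^esub> (\<kappa> b \<otimes>\<^bsub>L\<^esub> L.eval cs ?x)"
      using * ** h pU by (simp add: \<kappa>_add \<kappa>_mult polys_mult)
    also have "\<dots> = \<kappa> (b * b') \<otimes>\<^bsub>L\<^esub> L.eval (c # cs) ?x"
      using *(1-3) **(1-3) h c pU by (simp add: \<kappa>_mult pow L.r_distr L.m_ac)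
    finally have "\<kappa> (b * b') \<otimes>\<^bsub>L\<^esub> L.eval (c # cs) ?x = \<kappa> (b * a * ?q + b' * g)" ..
    moreover have "b * b' \<notin> D"
      using * ** pU D(2) by blast
    ultimately show ?case
      using * ** h pU by (intro bexI[of _ "b * b'"] bexI[of _ "b * a * ?q + b' * g"])
        (auto intro!: polys_mult polys_add)
  qed
  \<comment> \<open>Coefficient lists begin with the leading coefficient, so reverse induction
    inspects the constant term. If it is zero, the nonzero factor \<open>?x\<close> is divided out;
    a nonzero constant term, with denominators cleared, is the required element of K[U].\<close>
  have main: ?thesis
    if "set cs \<subseteq> ?G" "cs \<noteq> []" "hd cs \<noteq> \<zero>\<^bsub>L\<^esub>" "L.eval cs ?x = \<zero>\<^bsub>L\<^esub>" for cs
    using that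
  proof (induction cs rule: rev_induct)
    case (snoc c cs)
    have c: "c \<in> carrier L" and cs: "set cs \<subseteq> carrier L" "L.eval cs ?x \<in> carrier L"
      using snoc.prems(1) G_carrier x(1) by (auto intro!: L.eval_in_carrier)
    have ev: "L.eval cs ?x \<otimes>\<^bsub>L\<^esub> ?x \<oplus>\<^bsub>L\<^esub> c = \<zero>\<^bsub>L\<^esub>"
      using snoc.prems(4) L.eval_append[OF cs(1), of "[c]" ?x] c cs(2) x(1) by simp
    show ?case
    proof (cases "c = \<zero>\<^bsub>L\<^esub>")
      case True
      then have "L.eval cs ?x = \<zero>\<^bsub>L\<^esub>"
        using ev x cs(2) by (simp add: L.integral_iff)
      moreover have "cs \<noteq> []"
        using snoc.prems(3) True by auto
      ultimately show ?thesis
        using snoc.IH snoc.prems by simp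
    next
      case False
      obtain b g where *: "b \<in> polys K U" "g \<in> polys K V" "b \<notin> D" "\<kappa> b \<otimes>\<^bsub>L\<^esub> L.eval cs ?x = \<kappa> g"
        using clear[of cs] snoc.prems(1) by auto
      obtain b' a where **: "b' \<in> polys K U" "a \<in> polys K U" "b' \<notin> D" "\<kappa> b' \<otimes>\<^bsub>L\<^esub> c = \<kappa> a"
        using snoc.prems(1) G_frac[of c] by auto
      have b: "\<kappa> b \<in> carrier L" "\<kappa> b' \<in> carrier L" "\<kappa> b' \<noteq> \<zero>\<^bsub>L\<^esub>"
        using * ** pU \<kappa>_closed \<kappa>_zero by auto
      have "\<kappa> a \<noteq> \<zero>\<^bsub>L\<^esub>"
        using b(2,3) c False by (simp add: **(4)[symmetric] L.integral_iff)
      then have "a \<notin> D"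
        using ** pU \<kappa>_zero by auto
      then have ab: "a * b \<notin> D"
        using * ** pU D(2) by blast
      have "\<kappa> (a * b + b' * g * p) =
          \<kappa> b' \<otimes>\<^bsub>L\<^esub> c \<otimes>\<^bsub>L\<^esub> \<kappa> b \<oplus>\<^bsub>L\<^esub> \<kappa> b' \<otimes>\<^bsub>L\<^esub> (\<kappa> b \<otimes>\<^bsub>L\<^esub> L.eval cs ?x) \<otimes>\<^bsub>L\<^esub> ?x"
        using * ** p pU by (simp add: \<kappa>_add \<kappa>_mult polys_mult)
      also have "\<dots> = \<kappa> b \<otimes>\<^bsub>L\<^esub> \<kappa> b' \<otimes>\<^bsub>L\<^esub> (L.eval cs ?x \<otimes>\<^bsub>L\<^esub> ?x \<oplus>\<^bsub>L\<^esub> c)"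
        using b c cs x by (simp add: L.r_distr L.m_ac L.a_comm)
      also have "\<dots> = \<zero>\<^bsub>L\<^esub>"
        using b by (simp add: ev)
      finally have "a * b - (- (b' * g)) * p \<in> D"
        using * ** p pU \<kappa>_zero by (simp add: polys_add polys_mult)
      then show ?thesis
        using * ** ab pU
        by (intro bexI[of _ "a * b"] conjI bexI[of _ "- (b' * g)"]) (auto intro!: polys_mult polys_uminus)
    qed
  qed simp
  obtain cs where "cs \<in> carrier (univ_poly L ?G)" "cs \<noteq> []" "L.eval cs ?x = \<zero>\<^bsub>L\<^esub>"
    using L.algebraicE[OF subfieldE(1)[OF L.generate_field_is_subfield[OF S]] x(1) alg] by blast
  then show ?thesis
    by (intro main[of cs]) (auto simp: univ_poly_def polynomial_def)
qed

text \<open>An element of \<open>I\<close> outside \<open>D\<close> has a multiple that is congruent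
  modulo \<open>D\<close> to some element of K[U] outside \<open>D\<close>. As \<open>D\<close> lies
  in \<open>I\<close>, that element lies in \<open>I\<close> as well, but \<open>I\<close> meets
  K[U] only in 0.\<close>

lemma ideal_Int_polys_subset:
  assumes prime: "primeideal D (mpoly_ring K V)" and "U \<subseteq> V" "V \<subseteq> V'"
    and basis: "vars_transcendence_basis K (mpoly_ring K V) D U"
    and I: "ideal I (mpoly_ring K V')" "D \<subseteq> I" "I \<inter> polys K U \<subseteq> {0}"
  shows "I \<inter> polys K V \<subseteq> D"
proof
  fix p assume p: "p \<in> I \<inter> polys K V"
  show "p \<in> D"
  proof (rule ccontr)
    assume "p \<notin> D"
    have "quot_class (mpoly_ring K V) D p \<in> carrier (quot_field (mpoly_ring K V) D)"
      using quot_class_hom(2)[OF prime] p by (simp add: ring_hom_def Pi_iff)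
    then obtain a g where *: "a \<in> polys K U" "a \<notin> D" "g \<in> polys K V" "a - g * p \<in> D"
      using algebraic_imp_multiple[OF prime \<open>U \<subseteq> V\<close> _ \<open>p \<notin> D\<close>] p basis
      unfolding vars_transcendence_basis_def transcendence_basis_def by blast
    note I_closed = ideal_mpoly_ringD[OF I(1)]
    have "g * p \<in> I"
      using * p polys_mono[OF \<open>V \<subseteq> V'\<close>] by (intro I_closed(4)) auto
    then have "a \<in> I"
      using I_closed(3)[of "a - g * p" "g * p"] * I(2) by auto
    then have "a = 0"
      using * I(3) by auto
    moreover have "0 \<in> D"
      using prime ideal_mpoly_ringD(2) by (auto simp: primeideal_mpoly_ring_iff)
    ultimately show False
      using * by simp
  qed
qed

lemma primeideal_contraction:
  assumes "primeideal P (mpoly_ring K V')" "V \<subseteq> V'"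
  shows "primeideal (P \<inter> polys K V) (mpoly_ring K V)"
proof -
  have P: "ideal P (mpoly_ring K V')" "1 \<notin> P"
    "\<forall>p\<in>polys K V'. \<forall>q\<in>polys K V'. p * q \<in> P \<longrightarrow> p \<in> P \<or> q \<in> P"
    using assms(1) by (simp_all add: primeideal_mpoly_ring_iff)
  note I = ideal_mpoly_ringD[OF P(1)] and mono = polys_mono[OF assms(2)]
  have "ideal (P \<inter> polys K V) (mpoly_ring K V)"
    using I mono by (intro ideal_mpoly_ringI) (auto intro: polys_add polys_mult)
  then show ?thesis
    using P(2,3) mono by (auto simp: primeideal_mpoly_ring_iff)
qed


subsection \<open>Specialization\<close>

lemma specialize_simps:
  "specialize W w 0 = 0" "specialize W w 1 = 1"
  "specialize W w (p + q) = specialize W w p + specialize W w q"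
  "specialize W w (p - q) = specialize W w p - specialize W w q"
  "specialize W w (p * q) = specialize W w p * specialize W w q"
  by (simp_all add: specialize_def)

lemma specialize_id: "mvars p \<inter> W = {} \<Longrightarrow> specialize W w p = p"
  unfolding specialize_def using msubst_cong[of p _ mvar] by (auto simp: disjoint_iff)

lemma polys_specialize:
  assumes "p \<in> polys K A" "w \<in> W \<rightarrow> K"
  shows "specialize W w p \<in> polys K (A - W)"
  unfolding specialize_def using assms(1)
  by (rule polys_msubst) (use assms(2) in \<open>auto intro: polys_mconst polys_mvar\<close>)

text \<open>Specialization is a ring homomorphism, so the polynomials whose specialization lies in
  the target ideal form an ideal, and this ideal contains the generators.\<close>

lemma specialize_genideal:
  assumes F: "F \<subseteq> polys K A" and w: "w \<in> W \<rightarrow> K"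
    and p: "p \<in> genideal (mpoly_ring K A) F"
  shows "specialize W w p \<in> genideal (mpoly_ring K (A - W)) (specialize W w ` F)"
proof -
  have F': "specialize W w ` F \<subseteq> polys K (A - W)"
    using F w by (auto intro: polys_specialize)
  note J = genideal_mpoly_ring[OF F']
  let ?I = "{p \<in> polys K A. specialize W w p \<in> genideal (mpoly_ring K (A - W)) (specialize W w ` F)}"
  have "ideal ?I (mpoly_ring K A)"
    using w by (intro ideal_vimage_mpoly_ring[OF J(1)]) (auto simp: specialize_simps polys_specialize)
  moreover have "F \<subseteq> ?I"
    using F J(2) by auto
  ultimately show ?thesis
    using genideal_mpoly_ring(3)[OF F] p by blast
qed

text \<open>Modulo the linear forms each variable of \<open>W\<close> equals its value. For
  products, writing s for the specialization, pq - s(p)s(q) = p(q - s(q)) + s(q)(p - s(p)).\<close>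

lemma diff_specialize_in_ideal:
  assumes I: "ideal I (mpoly_ring K A)" "(\<lambda>v. mvar v - mconst (w v)) ` W \<subseteq> I"
    and w: "w \<in> W \<rightarrow> K" and p: "p \<in> polys K A"
  shows "p - specialize W w p \<in> I"
proof -
  note I_closed = ideal_mpoly_ringD[OF I(1)]
  have sp: "specialize W w q \<in> polys K A" if "q \<in> polys K A" for q
    using polys_specialize[OF that w] polys_mono[of "A - W" A] by auto
  from p K_zero K_one have "p \<in> polys K A \<and> p - specialize W w p \<in> I"
  proof (induction rule: polys_induct)
    case (const x)
    then show ?case
      by (simp add: specialize_def polys_mconst I_closed(2))
  next
    case (var v)
    then show ?case
      using I(2) I_closed(2) by (auto simp: specialize_def polys_mvar)
  next
    case (add p q)
    then have "(p - specialize W w p) + (q - specialize W w q) \<in> I"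
      using I_closed(3) by blast
    with add show ?case
      by (simp add: specialize_simps polys_add algebra_simps)
  next
    case (mult p q)
    then have "p * (q - specialize W w q) + specialize W w q * (p - specialize W w p) \<in> I"
      using I_closed(3,4) sp by blast
    with mult show ?case
      by (simp add: specialize_simps polys_mult algebra_simps)
  qed
  then show ?thesis ..
qed

text \<open>Let \<open>P\<close> be the quotient ideal (I : g). If \<open>g\<close> were in
  \<open>P\<close>, its square would lie in \<open>I\<close>, hence \<open>g\<close> too by
  radicality, and \<open>P\<close> would contain 1. For a prime \<open>Q\<close> between
  \<open>I\<close> and \<open>P\<close>, an element \<open>x\<close> of \<open>P\<close> has xg in
  \<open>Q\<close> with \<open>g\<close> outside \<open>Q\<close>, so \<open>x\<close> is in
  \<open>Q\<close>.\<close>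

lemma associated_prime_minimal:
  assumes "radical_ideal (mpoly_ring K V) I" "P \<in> associated_primes (mpoly_ring K V) I"
  shows "P \<in> minimal_primes (mpoly_ring K V) I"
proof -
  have I: "ideal I (mpoly_ring K V)"
    and rad: "\<And>x. x \<in> polys K V \<Longrightarrow> x ^ 2 \<in> I \<Longrightarrow> x \<in> I"
    using assms(1) unfolding radical_ideal_def by (auto simp: mpoly_ring_pow)
  note I_closed = ideal_mpoly_ringD[OF I]
  obtain g where P: "primeideal P (mpoly_ring K V)"
    and g: "g \<in> polys K V" and P_eq: "P = {x \<in> polys K V. x * g \<in> I}"
    using assms(2) unfolding associated_primes_def by auto
  have "I \<subseteq> P"
    using I_closed(1) I_closed(4)[OF g] by (auto simp: P_eq mult.commute)
  moreover have "Q = P" if Q: "primeideal Q (mpoly_ring K V)" "I \<subseteq> Q" "Q \<subseteq> P" for Q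
  proof -
    have "g \<notin> P"
    proof
      assume "g \<in> P"
      then have "g ^ 2 \<in> I"
        by (simp add: P_eq power2_eq_square)
      then have "g \<in> I"
        using g rad by blast
      then have "1 \<in> P"
        by (simp add: P_eq)
      then show False
        using P by (simp add: primeideal_mpoly_ring_iff)
    qed
    have "x \<in> Q" if "x \<in> P" for x
      using that Q \<open>g \<notin> P\<close> g unfolding P_eq by (auto simp: primeideal_mpoly_ring_iff)
    with Q(3) show ?thesis
      by blast
  qed
  ultimately show ?thesis
    using P unfolding minimal_primes_def by blast
qed

text \<open>Specialization identifies K[A] modulo the linear forms with K[A - W], so the minimal
  primes correspond: pull back along the specialization in one direction, intersect with K[A - W] in
  the other.\<close>

lemma minimal_prime_specialize:
  assumes F: "F \<subseteq> polys K A" and w: "w \<in> W \<rightarrow> K" and W: "W \<subseteq> A"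
    and P: "P \<in> minimal_primes (mpoly_ring K (A - W))
      (genideal (mpoly_ring K (A - W)) (specialize W w ` F))"
  defines "Q \<equiv> {p \<in> polys K A. specialize W w p \<in> P}"
  shows "Q \<in> minimal_primes (mpoly_ring K A)
    (genideal (mpoly_ring K A) (F \<union> (\<lambda>v. mvar v - mconst (w v)) ` W))"
proof -
  let ?lin = "(\<lambda>v. mvar v - mconst (w v)) ` W"
  have F': "specialize W w ` F \<subseteq> polys K (A - W)"
    using F w by (auto intro: polys_specialize)
  have lin: "?lin \<subseteq> polys K A"
    using w W by (auto intro!: polys_diff polys_mvar polys_mconst)
  then have FX: "F \<union> ?lin \<subseteq> polys K A"
    using F by blast
  have prime: "primeideal P (mpoly_ring K (A - W))"
    and sub: "genideal (mpoly_ring K (A - W)) (specialize W w ` F) \<subseteq> P"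
    and min: "\<And>Q. primeideal Q (mpoly_ring K (A - W)) \<Longrightarrow>
      genideal (mpoly_ring K (A - W)) (specialize W w ` F) \<subseteq> Q \<Longrightarrow> Q \<subseteq> P \<Longrightarrow> Q = P"
    using P unfolding minimal_primes_def by blast+
  have idP: "ideal P (mpoly_ring K (A - W))"
    using prime by (simp add: primeideal_mpoly_ring_iff)
  have idQ: "ideal Q (mpoly_ring K A)"
    unfolding Q_def using w
    by (intro ideal_vimage_mpoly_ring[OF idP]) (auto simp: specialize_simps polys_specialize)
  have primeQ: "primeideal Q (mpoly_ring K A)"
    using prime idQ w unfolding primeideal_mpoly_ring_iff
    by (auto simp: Q_def specialize_simps polys_specialize)
  have "F \<subseteq> Q"
    using F sub genideal_mpoly_ring(2)[OF F'] by (auto simp: Q_def)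
  moreover have "?lin \<subseteq> Q"
  proof -
    have "specialize W w (mvar v - mconst (w v)) = 0" if "v \<in> W" for v
      using that by (simp add: specialize_def)
    then show ?thesis
      using lin ideal_mpoly_ringD(2)[OF idP] by (auto simp: Q_def)
  qed
  ultimately have subQ: "genideal (mpoly_ring K A) (F \<union> ?lin) \<subseteq> Q"
    by (intro genideal_mpoly_ring(3)[OF FX idQ]) blast
  have "Q' = Q" if Q': "primeideal Q' (mpoly_ring K A)"
    "genideal (mpoly_ring K A) (F \<union> ?lin) \<subseteq> Q'" "Q' \<subseteq> Q" for Q'
  proof -
    have idQ': "ideal Q' (mpoly_ring K A)"
      using Q' by (simp add: primeideal_mpoly_ring_iff)
    have gens: "F \<union> ?lin \<subseteq> Q'"
      using Q'(2) genideal_mpoly_ring(2)[OF FX] by blast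
    then have diff: "p - specialize W w p \<in> Q'" if "p \<in> polys K A" for p
      using that w by (intro diff_specialize_in_ideal[OF idQ']) auto
    have c: "primeideal (Q' \<inter> polys K (A - W)) (mpoly_ring K (A - W))"
      using Q'(1) by (rule primeideal_contraction) blast
    have "specialize W w ` F \<subseteq> Q' \<inter> polys K (A - W)"
    proof
      fix p assume "p \<in> specialize W w ` F"
      then obtain q where q: "q \<in> F" "p = specialize W w q"
        by blast
      then have "q - (q - specialize W w q) \<in> Q'"
        using gens F diff by (intro ideal_mpoly_ringD(5)[OF idQ', of q "q - specialize W w q"]) auto
      then show "p \<in> Q' \<inter> polys K (A - W)"
        using q F' by auto
    qed
    then have "genideal (mpoly_ring K (A - W)) (specialize W w ` F) \<subseteq> Q' \<inter> polys K (A - W)"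
      using c by (intro genideal_mpoly_ring(3)[OF F']) (simp_all add: primeideal_mpoly_ring_iff)
    moreover have "Q' \<inter> polys K (A - W) \<subseteq> P"
    proof
      fix p assume p: "p \<in> Q' \<inter> polys K (A - W)"
      then have "specialize W w p = p"
        by (intro specialize_id) (auto dest: polys_mvars)
      then show "p \<in> P"
        using p Q'(3) by (auto simp: Q_def)
    qed
    ultimately have eq: "Q' \<inter> polys K (A - W) = P"
      using min c by blast
    have "p \<in> Q'" if "p \<in> Q" for p
    proof -
      have "p \<in> polys K A" "specialize W w p \<in> Q'"
        using that eq by (auto simp: Q_def)
      then have "(p - specialize W w p) + specialize W w p \<in> Q'"
        using diff by (intro ideal_mpoly_ringD(3)[OF idQ'])
      then show ?thesis
        by simp
    qed
    with Q'(3) show ?thesis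
      by blast
  qed
  then show ?thesis
    using primeQ subQ unfolding minimal_primes_def by blast
qed

text \<open>By the Leibniz rule, the polynomials lying in the larger ideal together with their total
  derivatives form an ideal. The derivative of a multiple of \<open>p\<close> involves
  \<open>p\<close> itself, hence both conditions in \<open>?I\<close>.\<close>

lemma total_deriv_genideal:
  assumes F: "F \<subseteq> polys K V" "F \<subseteq> F'" "total_deriv ` F \<subseteq> F'" and F': "F' \<subseteq> polys K V'"
    and V: "V \<subseteq> V'" "(\<lambda>v. (fst v, Suc (snd v))) ` V \<subseteq> V'"
    and p: "p \<in> genideal (mpoly_ring K V) F"
  shows "total_deriv p \<in> genideal (mpoly_ring K V') F'"
proof -
  let ?J = "genideal (mpoly_ring K V') F'"
  note J = genideal_mpoly_ring[OF F'] and J_closed = ideal_mpoly_ringD[OF genideal_mpoly_ring(1)[OF F']]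
  let ?I = "{p \<in> polys K V. p \<in> ?J \<and> total_deriv p \<in> ?J}"
  have "ideal ?I (mpoly_ring K V)"
    using J_closed(2) polys_mono[OF V(1)] polys_total_deriv[OF _ V(2,1)]
    by (intro ideal_mpoly_ringI)
      (auto simp: total_deriv_add total_deriv_mult polys_add polys_mult subset_iff intro!: J_closed(3,4))
  moreover have "F \<subseteq> ?I"
    using F J(2) by auto
  ultimately show ?thesis
    using genideal_mpoly_ring(3)[OF F(1)] p by blast
qed

end


section \<open>Points of a parametric geometric resolution\<close>

context const_field
begin

lemma mult_subset_polys:
  assumes "U \<subseteq> V" shows "mult_subset (mpoly_ring K V) (polys K U - {0})"
  using polys_mono[OF assms]
  by (intro mult_subset.intro cring_mpoly_ring mult_subset_axioms.intro)
    (auto simp: mpoly_mult_eq_0_iff intro: polys_mult)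

context
  fixes U Z :: "'v set" and I
  assumes I: "ideal I (mpoly_ring K (U \<union> Z))"
begin

interpretation mult_subset "mpoly_ring K (U \<union> Z)" "polys K U - {0}"
  by (rule mult_subset_polys) simp

interpretation A: cring "KU_poly_ring K U Z"
  unfolding KU_poly_ring_def by (rule cring_localization)

lemma KU_frac_image: "(\<lambda>p. KU_frac K U Z p 1) ` I \<subseteq> carrier (KU_poly_ring K U Z)"
  using ideal_mpoly_ringD(1)[OF I] by (auto simp: KU_frac_def KU_poly_ring_def intro!: frac_closed)

interpretation J: ideal "KU_ideal K U Z I" "KU_poly_ring K U Z"
  unfolding KU_ideal_def using KU_frac_image by (rule A.genideal_ideal)

lemma KU_class_eq_zero_iff:
  assumes "p \<in> polys K (U \<union> Z)"
  shows "KU_class K U Z I p 1 = \<zero>\<^bsub>KU_algebra K U Z I\<^esub> \<longleftrightarrow> KU_frac K U Z p 1 \<in> KU_ideal K U Z I"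
proof -
  have "KU_frac K U Z p 1 \<in> carrier (KU_poly_ring K U Z)"
    using assms by (auto simp: KU_frac_def KU_poly_ring_def intro!: frac_closed)
  then show ?thesis
    unfolding KU_class_def KU_algebra_def FactRing_def
    using J.a_rcos_self J.a_rcos_const by auto
qed

lemma KU_class_eq_zeroI:
  assumes "p \<in> I" shows "KU_class K U Z I p 1 = \<zero>\<^bsub>KU_algebra K U Z I\<^esub>"
proof -
  have "KU_frac K U Z p 1 \<in> KU_ideal K U Z I"
    using A.genideal_self[OF KU_frac_image] assms unfolding KU_ideal_def by blast
  then show ?thesis
    using assms ideal_mpoly_ringD(1)[OF I] KU_class_eq_zero_iff by blast
qed

text \<open>The extension of \<open>I\<close> to the localization consists of the fractions a/s with
  \<open>a\<close> in \<open>I\<close>. If p/1 is such a fraction, cross-multiplication yields a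
  nonzero element of K[U] that multiplies \<open>p\<close> into \<open>I\<close>.\<close>

lemma KU_class_eq_zeroD:
  assumes p: "p \<in> polys K (U \<union> Z)" and zero: "KU_class K U Z I p 1 = \<zero>\<^bsub>KU_algebra K U Z I\<^esub>"
  shows "\<exists>c\<in>polys K U - {0}. c * p \<in> I"
proof -
  let ?S = "polys K U - {0}" and ?A = "KU_poly_ring K U Z"
  note I_closed = ideal_mpoly_ringD[OF I]
  have UV: "polys K U \<subseteq> polys K (U \<union> Z)"
    by (rule polys_mono) simp
  define J where "J = {KU_frac K U Z a s | a s. a \<in> I \<and> s \<in> ?S}"
  note frac_simps = mult_frac[folded KU_frac_def KU_poly_ring_def, simplified]
    add_frac[folded KU_frac_def KU_poly_ring_def, simplified]
    zero_localization[folded KU_frac_def KU_poly_ring_def, simplified]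
  have J_carrier: "J \<subseteq> carrier ?A"
    using I_closed(1) by (auto simp: J_def KU_frac_def KU_poly_ring_def intro!: frac_closed)
  have one: "1 \<in> ?S"
    by simp
  have S_mult': "s * t \<in> ?S" if "s \<in> ?S" "t \<in> ?S" for s t
    using S_mult[OF that] by simp
  have J_mult: "x \<otimes>\<^bsub>?A\<^esub> y \<in> J" if xy: "x \<in> carrier ?A" "y \<in> J" for x y
  proof -
    obtain a s where x: "a \<in> polys K (U \<union> Z)" "s \<in> ?S" "x = KU_frac K U Z a s"
      using xy(1) unfolding KU_poly_ring_def KU_frac_def by (elim frac_cases) simp
    obtain b t where y: "b \<in> I" "t \<in> ?S" "y = KU_frac K U Z b t"
      using xy(2) by (auto simp: J_def)
    have "x \<otimes>\<^bsub>?A\<^esub> y = KU_frac K U Z (a * b) (s * t)"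
      using x y subsetD[OF I_closed(1) y(1)] by (simp add: frac_simps)
    then show ?thesis
      using x y I_closed(4) S_mult' unfolding J_def by blast
  qed
  have "ideal J ?A"
  proof (rule idealI[OF A.ring_axioms])
    show "subgroup J (add_monoid ?A)"
    proof (rule A.add.subgroupI)
      show "J \<subseteq> carrier ?A"
        by (rule J_carrier)
      show "J \<noteq> {}"
        using I_closed(2) one unfolding J_def by blast
      fix x assume x: "x \<in> J"
      then have "\<ominus>\<^bsub>?A\<^esub> x = (\<ominus>\<^bsub>?A\<^esub> \<one>\<^bsub>?A\<^esub>) \<otimes>\<^bsub>?A\<^esub> x"
        using J_carrier by (simp add: A.l_minus subset_iff)
      also have "\<dots> \<in> J"
        using x by (intro J_mult) simp_all
      finally show "\<ominus>\<^bsub>?A\<^esub> x \<in> J" .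
      fix y assume y: "y \<in> J"
      obtain a s b t where xy: "a \<in> I" "s \<in> ?S" "b \<in> I" "t \<in> ?S" "x = KU_frac K U Z a s" "y = KU_frac K U Z b t"
        using x y by (auto simp: J_def)
      have "x \<oplus>\<^bsub>?A\<^esub> y = KU_frac K U Z (a * t + b * s) (s * t)"
        using xy subsetD[OF I_closed(1) xy(1)] subsetD[OF I_closed(1) xy(3)] by (simp add: frac_simps)
      moreover have "a * t + b * s \<in> I"
        using I_closed(3)[OF I_closed(4)[of t a] I_closed(4)[of s b]] xy UV by (auto simp: mult.commute)
      ultimately show "x \<oplus>\<^bsub>?A\<^esub> y \<in> J"
        using S_mult'[OF xy(2,4)] unfolding J_def by blast
    qed
    fix x y assume "x \<in> J" "y \<in> carrier ?A"
    then show "y \<otimes>\<^bsub>?A\<^esub> x \<in> J" "x \<otimes>\<^bsub>?A\<^esub> y \<in> J"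
      using J_mult[of y x] J_carrier A.m_comm[of x y] by (auto simp: subset_iff)
  qed
  moreover have "(\<lambda>p. KU_frac K U Z p 1) ` I \<subseteq> J"
    using one unfolding J_def by blast
  ultimately have "KU_ideal K U Z I \<subseteq> J"
    unfolding KU_ideal_def by (rule A.genideal_minimal)
  then have "KU_frac K U Z p 1 \<in> J"
    using zero KU_class_eq_zero_iff[OF p] by blast
  then obtain a s where as: "a \<in> I" "s \<in> ?S" "KU_frac K U Z p 1 = KU_frac K U Z a s"
    by (auto simp: J_def)
  then obtain c where c: "c \<in> ?S" "c * (p * s) = c * a"
    using frac_eqD[of p 1 a s] p one I_closed(1) unfolding KU_frac_def by auto
  have "c * a \<in> I"
    using c(1) as(1) UV by (intro I_closed(4)) auto
  then have "(c * s) * p \<in> I"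
    using c(2) by (simp add: mult_ac)
  then show ?thesis
    using S_mult'[OF c(1) as(2)] by blast
qed

end

lemma ideal_vanishing_ideal: "ideal (vanishing_ideal K V Y) (mpoly_ring K V)"
  by (rule ideal_mpoly_ringI) (auto simp: vanishing_ideal_def polys_add polys_mult)

lemma meval_subst_ups: "meval x (subst_ups l p) = meval (case_option (meval x l) x) p"
  unfolding subst_ups_def meval_msubst by (rule meval_cong) (simp split: option.split)

text \<open>\<open>G\<close> is \<open>g\<close> with a/(b q') substituted for the variables
  \<open>Z\<close>, times a power of the common denominator. The relation is stated for values and
  without division because it is used twice: at points \<open>x\<close> of the variety, where
  denominators may vanish and \<upsilon> takes the value of the linear form, and at the image
  \<open>x\<close> of \<open>y\<close> under the parametrization.\<close>

lemma clear_denominators: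
  fixes a b :: "'v \<Rightarrow> 'w mpoly" and q' :: "'w mpoly" and \<iota> :: "'v \<Rightarrow> 'w"
  assumes "finite Z" "g \<in> polys K (U \<union> Z)" "q' \<in> polys K V"
    and ab: "\<And>z. z \<in> Z \<Longrightarrow> a z \<in> polys K V" "\<And>z. z \<in> Z \<Longrightarrow> b z \<in> polys K V" and \<iota>: "\<iota> ` U \<subseteq> V"
  shows "\<exists>N. \<exists>G\<in>polys K V. \<forall>x y. (\<forall>u\<in>U. x u = y (\<iota> u)) \<longrightarrow>
    (\<forall>z\<in>Z. meval y (b z) * meval y q' * x z = meval y (a z)) \<longrightarrow>
    meval y G = meval y (prod b Z * q') ^ N * meval x g"
  using assms(2) K_zero K_one
proof (induction rule: polys_induct)
  case (const c)
  then show ?case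
    by (intro exI[of _ 0] bexI[of _ "mconst c"]) (auto intro: polys_mconst)
next
  case (var v)
  show ?case
  proof (cases "v \<in> U")
    case True
    then show ?thesis
      using \<iota> by (intro exI[of _ 0] bexI[of _ "mvar (\<iota> v)"]) (auto intro: polys_mvar)
  next
    case False
    with var have v: "v \<in> Z"
      by blast
    show ?thesis
    proof (intro exI[of _ 1] bexI[of _ "prod b (Z - {v}) * a v"] allI impI)
      show "prod b (Z - {v}) * a v \<in> polys K V"
        using v ab by (intro polys_mult polys_prod) auto
      fix x y assume "\<forall>z\<in>Z. meval y (b z) * meval y q' * x z = meval y (a z)"
      then have "meval y (b v) * meval y q' * x v = meval y (a v)"
        using v by blast
      moreover have "prod b Z = b v * prod b (Z - {v})"
        using assms(1) v by (rule prod.remove)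
      ultimately show "meval y (prod b (Z - {v}) * a v) = meval y (prod b Z * q') ^ 1 * meval x (mvar v)"
        by (simp add: mult_ac)
    qed
  qed
next
  case (add g1 g2)
  then obtain N1 G1 N2 G2 where *: "G1 \<in> polys K V" "G2 \<in> polys K V"
    "\<forall>x y. (\<forall>u\<in>U. x u = y (\<iota> u)) \<longrightarrow> (\<forall>z\<in>Z. meval y (b z) * meval y q' * x z = meval y (a z)) \<longrightarrow>
      meval y G1 = meval y (prod b Z * q') ^ N1 * meval x g1"
    "\<forall>x y. (\<forall>u\<in>U. x u = y (\<iota> u)) \<longrightarrow> (\<forall>z\<in>Z. meval y (b z) * meval y q' * x z = meval y (a z)) \<longrightarrow>
      meval y G2 = meval y (prod b Z * q') ^ N2 * meval x g2"
    by blast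
  let ?B = "prod b Z * q'"
  have "prod b Z \<in> polys K V"
    using ab by (intro polys_prod) auto
  with * assms(3) show ?case
    by (intro exI[of _ "N1 + N2"] bexI[of _ "G1 * ?B ^ N2 + G2 * ?B ^ N1"])
      (auto simp: power_add algebra_simps intro!: polys_add polys_mult polys_power)
next
  case (mult g1 g2)
  then obtain N1 G1 N2 G2 where *: "G1 \<in> polys K V" "G2 \<in> polys K V"
    "\<forall>x y. (\<forall>u\<in>U. x u = y (\<iota> u)) \<longrightarrow> (\<forall>z\<in>Z. meval y (b z) * meval y q' * x z = meval y (a z)) \<longrightarrow>
      meval y G1 = meval y (prod b Z * q') ^ N1 * meval x g1"
    "\<forall>x y. (\<forall>u\<in>U. x u = y (\<iota> u)) \<longrightarrow> (\<forall>z\<in>Z. meval y (b z) * meval y q' * x z = meval y (a z)) \<longrightarrow>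
      meval y G2 = meval y (prod b Z * q') ^ N2 * meval x g2"
    by blast
  then show ?case
    by (intro exI[of _ "N1 + N2"] bexI[of _ "G1 * G2"])
      (auto simp: power_add mult_ac intro!: polys_mult)
qed

text \<open>Pseudo-division by \<open>q\<close> shows that a cleared polynomial \<open>G\<close> vanishes on the hypersurface wherever
  a power of the leading coefficient of \<open>q\<close> does not. As \<open>q' \<noteq> 0\<close>, such points accumulate at \<open>y\<close>, so
  that neither Gauss's lemma nor primitivity of \<open>q\<close> is needed.\<close>

lemma meval_param_map_eq_0:
  assumes fin: "finite Z" and UZ: "U \<inter> Z = {}"
    and res: "geometric_resolution K U Z Y l q a b"
    and y: "y \<in> param_domain U Z q b" "meval y q = 0"
    and g: "g \<in> vanishing_ideal K (U \<union> Z) Y"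
  shows "meval (param_map U Z q a b y) g = 0"
proof -
  let ?I = "vanishing_ideal K (U \<union> Z) Y" and ?q' = "mpderiv None q"
  have I: "ideal ?I (mpoly_ring K (U \<union> Z))"
    by (rule ideal_vanishing_ideal)
  obtain c where "l = (\<Sum>z\<in>Z. mconst (of_rat (c z)) * mvar z)"
    using res by (auto simp: geometric_resolution_def)
  then have l: "l \<in> polys K (U \<union> Z)"
    by (auto intro!: polys_sum polys_mult polys_mconst polys_mvar K_of_rat)
  have q: "q \<in> polys K (Uups U)" "q \<noteq> 0" "KU_class K U Z ?I (subst_ups l q) 1 = \<zero>\<^bsub>KU_algebra K U Z ?I\<^esub>"
    and q_min: "\<And>g. g \<in> polys K (Uups U) \<Longrightarrow> g \<noteq> 0 \<Longrightarrow>
      KU_class K U Z ?I (subst_ups l g) 1 = \<zero>\<^bsub>KU_algebra K U Z ?I\<^esub> \<Longrightarrow> mdeg None q \<le> mdeg None g"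
    and q_deg: "mdeg None q > 0"
    using res by (auto simp: geometric_resolution_def KU_minimal_poly_def)
  have Uups: "polys K (Some ` U) \<subseteq> polys K (Uups U)"
    by (rule polys_mono) (auto simp: Uups_def)
  have ab: "a z \<in> polys K (Uups U)" "b z \<in> polys K (Uups U)"
    and abY: "\<And>x. x \<in> Y \<Longrightarrow> meval x (subst_ups l (b z * ?q') * mvar z - subst_ups l (a z)) = 0" if "z \<in> Z" for z
    using res that Uups by (auto simp: geometric_resolution_def)
  have subst: "subst_ups l p \<in> polys K (U \<union> Z)" if "p \<in> polys K (Uups U)" for p
    unfolding subst_ups_def using that
    by (rule polys_msubst) (auto simp: Uups_def intro: l polys_mvar)
  have gV: "g \<in> polys K (U \<union> Z)" and gY: "\<And>x. x \<in> Y \<Longrightarrow> meval x g = 0"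
    using g by (auto simp: vanishing_ideal_def)
  have "\<exists>N. \<exists>G\<in>polys K (Uups U). \<forall>x y. (\<forall>u\<in>U. x u = y (Some u)) \<longrightarrow>
    (\<forall>z\<in>Z. meval y (b z) * meval y ?q' * x z = meval y (a z)) \<longrightarrow>
    meval y G = meval y (prod b Z * ?q') ^ N * meval x g"
    by (rule clear_denominators[OF fin gV polys_mpderiv[OF q(1)]]) (use ab in \<open>auto simp: Uups_def\<close>)
  then obtain N G where G: "G \<in> polys K (Uups U)"
    and GN': "\<forall>x y. (\<forall>u\<in>U. x u = y (Some u)) \<longrightarrow>
      (\<forall>z\<in>Z. meval y (b z) * meval y ?q' * x z = meval y (a z)) \<longrightarrow>
      meval y G = meval y (prod b Z * ?q') ^ N * meval x g"
    by (elim exE bexE)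
  note GN = GN'[rule_format]
  \<comment> \<open>Over a point of \<open>Y\<close> the indeterminate \<upsilon> takes the value of
    \<open>l\<close>, and the division-free relation applies even where a denominator is
    zero.\<close>
  have GY: "meval x (subst_ups l G) = 0" if x: "x \<in> Y" for x
  proof -
    let ?y = "case_option (meval x l) x"
    have "meval ?y (b z) * meval ?y ?q' * x z = meval ?y (a z)" if z: "z \<in> Z" for z
    proof -
      have "meval x (subst_ups l (b z * ?q')) * x z - meval x (subst_ups l (a z)) = 0"
        using abY[OF z x] by (simp only: meval_simps)
      then show ?thesis
        by (simp only: meval_subst_ups meval_simps right_minus_eq)
    qed
    with GN[of x ?y] have "meval ?y G = meval ?y (prod b Z * ?q') ^ N * meval x g"
      by (simp only: option.case)
    then show ?thesis
      unfolding meval_subst_ups gY[OF x] by simp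
  qed
  \<comment> \<open>The class of \<open>q\<close> at \<open>l\<close> is zero only over K(U);
    \<open>c\<close> is the denominator that brings it into the vanishing ideal.\<close>
  obtain c where c: "c \<in> polys K U" "c \<noteq> 0" "c * subst_ups l q \<in> ?I"
    using KU_class_eq_zeroD[OF I subst[OF q(1)] q(3)] by blast
  let ?P = "to_univ None q"
  have Some_U: "Uups U - {None} = Some ` U"
    by (auto simp: Uups_def)
  have coeff: "Polynomial.coeff (to_univ None p) k \<in> polys K (Some ` U)" if "p \<in> polys K (Uups U)" for p k
    using coeff_to_univ[OF that, of None] by (simp add: Some_U)
  have None: "None \<notin> mvars p" if "p \<in> polys K (Some ` U)" for p
    using polys_mvars[OF that] by auto
  have "mdeg None q \<le> Polynomial.degree ?P"
    using mdeg_poly[of None ?P] None coeff[OF q(1)] by (simp add: poly_to_univ)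
  then have deg: "Polynomial.degree ?P > 0"
    using q_deg by simp
  obtain k h r where div: "Polynomial.smult (Polynomial.lead_coeff ?P ^ k) (to_univ None G) = ?P * h + r"
    and r: "Polynomial.degree r < Polynomial.degree ?P" "\<And>k. Polynomial.coeff r k \<in> polys K (Some ` U)"
    using pseudo_division[of "polys K (Some ` U)" ?P "to_univ None G"] deg coeff q(1) G
    by (auto simp: polys_diff polys_mult)
  let ?c = "Polynomial.lead_coeff ?P ^ k" and ?h = "poly h (mvar None)" and ?r = "poly r (mvar None)"
  have div': "?c * G = q * ?h + ?r"
    using arg_cong[OF div, of "\<lambda>p. poly p (mvar None)"] by (simp add: poly_to_univ)
  \<comment> \<open>The remainder times \<open>?d\<close>, which is \<open>c\<close> written in the
    ring with \<upsilon>, vanishes on \<open>Y\<close> after substituting \<open>l\<close>, and its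
    degree in \<upsilon> is below that of \<open>q\<close>. Minimality of \<open>q\<close> leaves
    only zero.\<close>
  have "?r = 0"
  proof (rule ccontr)
    assume r0: "?r \<noteq> 0"
    let ?d = "msubst (\<lambda>u. mvar (Some u)) c"
    have d: "?d \<in> polys K (Some ` U)"
      using c(1) by (rule polys_msubst) (auto intro: polys_mvar)
    have dl: "subst_ups l ?d = c"
      by (simp add: subst_ups_def msubst_msubst)
    have rU: "?r \<in> polys K (Uups U)"
      unfolding poly_altdef using r(2) Uups
      by (intro polys_sum polys_mult polys_power polys_mvar) (auto simp: Uups_def)
    have drU: "?d * ?r \<in> polys K (Uups U)"
      using d rU Uups by (intro polys_mult) auto
    have "?d \<noteq> 0"
      using c(2) dl by (auto simp: subst_ups_def)
    then have "?d * ?r \<noteq> 0"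
      using r0 by (simp add: mpoly_mult_eq_0_iff)
    moreover have "meval x (subst_ups l (?d * ?r)) = 0" if x: "x \<in> Y" for x
    proof -
      have 1: "meval x c * meval x (subst_ups l q) = 0"
        using c(3) x by (auto simp: vanishing_ideal_def)
      have "?d * ?r = ?d * (?c * G - q * ?h)"
        by (simp add: div')
      then have "meval x (subst_ups l (?d * ?r)) =
          meval x c * (meval x (subst_ups l ?c) * meval x (subst_ups l G) - meval x (subst_ups l q) * meval x (subst_ups l ?h))"
        using dl by (simp add: subst_ups_def)
      also have "\<dots> = - (meval x c * meval x (subst_ups l q)) * meval x (subst_ups l ?h)"
        using GY[OF x] by simp
      finally show ?thesis
        using 1 by simp
    qed
    then have "subst_ups l (?d * ?r) \<in> ?I"
      using subst[OF drU] by (simp add: vanishing_ideal_def)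
    then have "KU_class K U Z ?I (subst_ups l (?d * ?r)) 1 = \<zero>\<^bsub>KU_algebra K U Z ?I\<^esub>"
      by (rule KU_class_eq_zeroI[OF I])
    ultimately have "mdeg None q \<le> mdeg None (?d * ?r)"
      using q_min[OF drU] by blast
    also have "\<dots> = mdeg None (poly (Polynomial.smult ?d r) (mvar None))"
      by simp
    also have "\<dots> \<le> Polynomial.degree (Polynomial.smult ?d r)"
      using d r(2) by (intro mdeg_poly None) (auto intro: polys_mult)
    also have "\<dots> \<le> Polynomial.degree r"
      by (rule degree_smult_le)
    also have "\<dots> < mdeg None q"
      using r(1) degree_to_univ_le[of None q] by simp
    finally show False
      by simp
  qed
  have "?P \<noteq> 0"
    using deg by auto
  then have c0: "?c \<noteq> 0"
    by (induction k) (auto simp: mpoly_mult_eq_0_iff)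
  \<comment> \<open>Since \<open>?c\<close> is free of \<upsilon>, it can be made nonzero by moving
    the other coordinates while \<upsilon> follows as a root of \<open>q\<close>.\<close>
  have cN: "None \<notin> mvars ?c"
    using coeff[OF q(1)] by (intro None polys_power)
  have q'0: "meval y ?q' \<noteq> 0"
    using y(1) by (simp add: param_domain_def)
  have cG: "meval x (?c * G) = 0" if "meval x q = 0" for x
    by (simp only: div' \<open>?r = 0\<close> meval_simps that mult_zero_left add_0_right)
  have "meval y G = 0"
    by (rule meval_eq_0_of_generic[OF y(2) q'0 c0 cN cG])
  moreover have "meval y G = meval y (prod b Z * ?q') ^ N * meval (param_map U Z q a b y) g"
    using y(1) UZ by (intro GN) (auto simp: param_map_def param_domain_def)
  moreover have "meval y (prod b Z * ?q') \<noteq> 0"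
    using y(1) fin by (simp add: param_domain_def)
  ultimately show ?thesis
    by simp
qed

end


section \<open>Real analytic functions and classical solutions\<close>

text \<open>Real analyticity at \<open>t0\<close> in the form of a local holomorphic extension:
  closure under products and quotients then comes from complex analysis instead of computations with
  power series.\<close>

definition hol_germ :: "(real \<Rightarrow> complex) \<Rightarrow> real \<Rightarrow> bool"
  where "hol_germ g t0 \<longleftrightarrow>
    (\<exists>r>0. \<exists>G. G holomorphic_on ball (of_real t0) r \<and> (\<forall>t. \<bar>t - t0\<bar> < r \<longrightarrow> g t = G (of_real t)))"

lemma norm_of_real_diff: "norm (complex_of_real t - complex_of_real t0) = \<bar>t - t0\<bar>"
  by (metis norm_of_real of_real_diff)

text \<open>A power series that converges on a real interval converges on the complex disc of the
  same radius and is holomorphic there. Conversely, the Taylor series of a holomorphic extension can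
  be restricted to real points.\<close>

lemma real_analytic_on_iff: "real_analytic_on g T \<longleftrightarrow> (\<forall>t\<in>T. hol_germ g t)"
proof -
  have "(\<exists>r>0. \<exists>a. \<forall>t. \<bar>t - t0\<bar> < r \<longrightarrow> (\<lambda>k. a k * of_real (t - t0) ^ k) sums g t) \<longleftrightarrow> hol_germ g t0" for t0
  proof
    assume "\<exists>r>0. \<exists>a. \<forall>t. \<bar>t - t0\<bar> < r \<longrightarrow> (\<lambda>k. a k * of_real (t - t0) ^ k) sums g t"
    then obtain r a where r: "r > 0"
      and a: "\<And>t. \<bar>t - t0\<bar> < r \<Longrightarrow> (\<lambda>k. a k * of_real (t - t0) ^ k) sums g t"
      by blast
    define G where "G w = suminf (\<lambda>k. a k * (w - of_real t0) ^ k)" for w :: complex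
    have "(\<lambda>k. a k * (w - of_real t0) ^ k) sums G w" if w: "w \<in> ball (of_real t0) r" for w
    proof -
      \<comment> \<open>Convergence is known only at real points; the one at distance
        \<open>s\<close> from the centre lies farther out than \<open>w\<close>, hence forces
        convergence at \<open>w\<close>.\<close>
      obtain s where s: "norm (w - of_real t0) < s" "s < r"
        using w dense[of "norm (w - of_real t0)" r] by (auto simp: dist_norm norm_minus_commute)
      then have "s > 0"
        using norm_ge_zero[of "w - of_real t0"] by linarith
      have "summable (\<lambda>k. a k * of_real s ^ k)"
        using a[of "t0 + s"] s \<open>s > 0\<close> by (auto simp: sums_iff)
      then have "summable (\<lambda>k. a k * (w - of_real t0) ^ k)"
        by (rule powser_inside) (use s \<open>s > 0\<close> in simp)
      then show ?thesis
        unfolding G_def by (rule summable_sums)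
    qed
    then have "G holomorphic_on ball (of_real t0) r"
      by (rule power_series_holomorphic)
    moreover have "g t = G (of_real t)" if "\<bar>t - t0\<bar> < r" for t
      using a[OF that] by (simp add: G_def sums_iff)
    ultimately show "hol_germ g t0"
      using r unfolding hol_germ_def by blast
  next
    assume "hol_germ g t0"
    then obtain r G where r: "r > 0" and G: "G holomorphic_on ball (of_real t0) r"
      and g: "\<And>t. \<bar>t - t0\<bar> < r \<Longrightarrow> g t = G (of_real t)"
      unfolding hol_germ_def by blast
    have "(\<lambda>k. (deriv ^^ k) G (of_real t0) / fact k * of_real (t - t0) ^ k) sums g t" if t: "\<bar>t - t0\<bar> < r" for t
    proof -
      have "of_real t \<in> ball (complex_of_real t0) r"
        using t unfolding mem_ball dist_norm norm_of_real_diff by linarith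
      from holomorphic_power_series[OF G this] show ?thesis
        unfolding g[OF t] of_real_diff .
    qed
    with r show "\<exists>r>0. \<exists>a. \<forall>t. \<bar>t - t0\<bar> < r \<longrightarrow> (\<lambda>k. a k * of_real (t - t0) ^ k) sums g t"
      by (intro exI[of _ r] conjI exI[of _ "\<lambda>k. (deriv ^^ k) G (of_real t0) / fact k"] allI impI)
  qed
  then show ?thesis
    by (simp add: real_analytic_on_def)
qed

lemma hol_germ_const: "hol_germ (\<lambda>t. c) t0"
  unfolding hol_germ_def by (intro exI[of _ 1] conjI exI[of _ "\<lambda>_. c"]) auto

text \<open>The premise \<open>op\<close> may return a smaller radius and is given the values at the
  centre, since a quotient requires shrinking to a disc on which the denominator has no
  zeros.\<close>

lemma hol_germ_binop:
  assumes f: "hol_germ f t0" and g: "hol_germ g t0"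
    and op: "\<And>F G r. r > 0 \<Longrightarrow> F holomorphic_on ball (of_real t0) r \<Longrightarrow> G holomorphic_on ball (of_real t0) r \<Longrightarrow>
      F (of_real t0) = f t0 \<Longrightarrow> G (of_real t0) = g t0 \<Longrightarrow>
      \<exists>r'>0. (\<lambda>z. h (F z) (G z)) holomorphic_on ball (of_real t0) r'"
  shows "hol_germ (\<lambda>t. h (f t) (g t)) t0"
proof -
  obtain r1 F where 1: "r1 > 0" "F holomorphic_on ball (of_real t0) r1"
    "\<And>t. \<bar>t - t0\<bar> < r1 \<Longrightarrow> f t = F (of_real t)"
    using f unfolding hol_germ_def by blast
  obtain r2 G where 2: "r2 > 0" "G holomorphic_on ball (of_real t0) r2"
    "\<And>t. \<bar>t - t0\<bar> < r2 \<Longrightarrow> g t = G (of_real t)"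
    using g unfolding hol_germ_def by blast
  have "F holomorphic_on ball (of_real t0) (min r1 r2)" "G holomorphic_on ball (of_real t0) (min r1 r2)"
    using 1(2) 2(2) by (auto elim!: holomorphic_on_subset)
  then obtain r' where r': "r' > 0" "(\<lambda>z. h (F z) (G z)) holomorphic_on ball (of_real t0) r'"
    using op[of "min r1 r2" F G] 1 2 by auto
  let ?r = "min r' (min r1 r2)"
  have "(\<lambda>z. h (F z) (G z)) holomorphic_on ball (of_real t0) ?r"
    using r'(2) by (rule holomorphic_on_subset) auto
  then show ?thesis
    unfolding hol_germ_def using r'(1) 1 2
    by (intro exI[of _ ?r] conjI exI[of _ "\<lambda>z. h (F z) (G z)"]) auto
qed

lemma hol_germ_add: "hol_germ f t0 \<Longrightarrow> hol_germ g t0 \<Longrightarrow> hol_germ (\<lambda>t. f t + g t) t0"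
  by (rule hol_germ_binop) (auto intro: holomorphic_intros)

lemma hol_germ_mult: "hol_germ f t0 \<Longrightarrow> hol_germ g t0 \<Longrightarrow> hol_germ (\<lambda>t. f t * g t) t0"
  by (rule hol_germ_binop) (auto intro: holomorphic_intros)

lemma hol_germ_divide:
  assumes "hol_germ f t0" "hol_germ g t0" "g t0 \<noteq> 0"
  shows "hol_germ (\<lambda>t. f t / g t) t0"
  using assms(1,2)
proof (rule hol_germ_binop)
  fix F G :: "complex \<Rightarrow> complex" and r :: real
  assume *: "r > 0" "F holomorphic_on ball (of_real t0) r" "G holomorphic_on ball (of_real t0) r"
    "G (of_real t0) = g t0"
  have "continuous_on (ball (of_real t0) r) G"
    using *(3) by (rule holomorphic_on_imp_continuous_on)
  then have "isCont G (of_real t0)"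
    using *(1) by (simp add: continuous_on_eq_continuous_at)
  then obtain e where e: "e > 0" "\<And>z. dist (of_real t0) z < e \<Longrightarrow> G z \<noteq> 0"
    using continuous_at_avoid[of "of_real t0" G 0] assms(3) *(4) by auto
  have "(\<lambda>z. F z / G z) holomorphic_on ball (of_real t0) (min e r)"
    using *(2,3) e by (intro holomorphic_on_divide) (auto elim!: holomorphic_on_subset)
  then show "\<exists>r'>0. (\<lambda>z. F z / G z) holomorphic_on ball (of_real t0) r'"
    using e(1) *(1) by (intro exI[of _ "min e r"]) auto
qed

lemma hol_germ_meval:
  assumes "p \<in> polys UNIV V" "\<And>v. v \<in> V \<Longrightarrow> hol_germ (\<lambda>t. \<rho> t v) t0"
  shows "hol_germ (\<lambda>t. meval (\<rho> t) p) t0"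
  using assms(1) UNIV_I UNIV_I
  by (induction rule: polys_induct) (auto intro: hol_germ_const hol_germ_add hol_germ_mult assms(2))

lemma hol_germ_imp_has_vector_derivative:
  assumes "hol_germ g t0" obtains D where "(g has_vector_derivative D) (at t0)"
proof -
  obtain r G where r: "r > 0" and G: "G holomorphic_on ball (of_real t0) r"
    and g: "\<And>t. \<bar>t - t0\<bar> < r \<Longrightarrow> g t = G (of_real t)"
    using assms unfolding hol_germ_def by blast
  have "(G has_field_derivative deriv G (of_real t0)) (at (of_real t0))"
    using holomorphic_derivI[OF G open_ball] r by simp
  then have "((\<lambda>t. G (of_real t)) has_vector_derivative deriv G (of_real t0)) (at t0)"
    by (rule has_vector_derivative_real_field)
  then have "(g has_vector_derivative deriv G (of_real t0)) (at t0)"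
    by (rule has_vector_derivative_transform_within_open[of _ _ _ "ball t0 r"])
      (use r g in \<open>auto simp: dist_real_def abs_minus_commute\<close>)
  then show ?thesis
    by (rule that)
qed

lemma has_vector_derivative_meval:
  assumes "finite V" "p \<in> polys UNIV V"
    and d: "\<And>v. v \<in> V \<Longrightarrow> ((\<lambda>t. \<rho> t v) has_vector_derivative \<rho>' v) (at t)"
  shows "((\<lambda>t. meval (\<rho> t) p) has_vector_derivative (\<Sum>v\<in>V. meval (\<rho> t) (mpderiv v p) * \<rho>' v)) (at t)"
  using assms(2) UNIV_I UNIV_I
proof (induction rule: polys_induct)
  case (const x)
  then show ?case by simp
next
  case (var v)
  have "(\<Sum>u\<in>V. meval (\<rho> t) (mpderiv u (mvar v)) * \<rho>' u) = (\<Sum>u\<in>V. if u = v then \<rho>' u else 0)"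
    by (intro sum.cong) auto
  then show ?case
    using var d assms(1) by (simp add: sum.delta')
next
  case (add p q)
  then show ?case
    by (auto simp: distrib_right sum.distrib intro!: has_vector_derivative_add)
next
  case (mult p q)
  have "(\<Sum>v\<in>V. meval (\<rho> t) (mpderiv v (p * q)) * \<rho>' v) =
      meval (\<rho> t) p * (\<Sum>v\<in>V. meval (\<rho> t) (mpderiv v q) * \<rho>' v) +
      (\<Sum>v\<in>V. meval (\<rho> t) (mpderiv v p) * \<rho>' v) * meval (\<rho> t) q"
    by (simp add: distrib_right distrib_left sum.distrib sum_distrib_left sum_distrib_right mult_ac)
  then show ?case
    using has_vector_derivative_mult[OF mult.IH] by simp
qed

lemma iter_deriv_simps [simp]:
  "iter_deriv 0 g = g" "iter_deriv (Suc j) g t = vector_derivative (iter_deriv j g) (at t)"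
  by (simp_all add: iter_deriv_def)

text \<open>A derivative at a point depends on the previous function near that point, so the
  induction carries the equality on the whole open set \<open>T\<close>.\<close>

lemma iter_deriv_eq:
  assumes T: "open T"
    and d: "\<And>j t. j < e \<Longrightarrow> t \<in> T \<Longrightarrow> (x j has_vector_derivative x (Suc j) t) (at t)"
    and "j \<le> e" "t \<in> T"
  shows "iter_deriv j (x 0) t = x j t"
  using assms(3,4)
proof (induction j arbitrary: t)
  case (Suc j)
  have "(iter_deriv j (x 0) has_vector_derivative x (Suc j) t) (at t)"
    by (rule has_vector_derivative_transform_within_open[of "x j" _ _ T]) (use d[of j t] Suc T in auto)
  then show ?case
    by (simp add: vector_derivative_at)
qed simp

text \<open>\<open>vector_derivative\<close> is a total function; existence of the derivatives is
  therefore a separate obligation in \<open>classical_solution\<close>.\<close>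

lemma iter_deriv_differentiable:
  assumes T: "open T"
    and d: "\<And>j t. j < e \<Longrightarrow> t \<in> T \<Longrightarrow> (x j has_vector_derivative x (Suc j) t) (at t)"
    and "j < e" "t \<in> T"
  shows "iter_deriv j (x 0) differentiable (at t)"
proof -
  have "(iter_deriv j (x 0) has_vector_derivative x (Suc j) t) (at t)"
    by (rule has_vector_derivative_transform_within_open[of "x j" _ _ T])
      (use d[OF assms(3,4)] T assms(3,4) iter_deriv_eq[where x = x, OF T d, of e j] in auto)
  then show ?thesis
    by (rule differentiableI_vector)
qed


section \<open>Prolongations\<close>

lemma Xupto_mono: "j \<le> k \<Longrightarrow> Xupto n j \<subseteq> Xupto n k"
  by (auto simp: Xupto_def)

lemma Xupto_Suc: "(\<lambda>v. (fst v, Suc (snd v))) ` Xupto n j \<subseteq> Xupto n (Suc j)"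
  by (auto simp: Xupto_def)

context const_field
begin

lemma genideal_mono:
  assumes "F \<subseteq> F'" "F' \<subseteq> polys K V'" "V \<subseteq> V'" "F \<subseteq> polys K V"
  shows "genideal (mpoly_ring K V) F \<subseteq> genideal (mpoly_ring K V') F'"
proof -
  note J = genideal_mpoly_ring[OF assms(2)] and J_closed = ideal_mpoly_ringD[OF genideal_mpoly_ring(1)[OF assms(2)]]
  let ?I = "genideal (mpoly_ring K V') F' \<inter> polys K V"
  have "ideal ?I (mpoly_ring K V)"
    using J_closed polys_mono[OF assms(3)] by (intro ideal_mpoly_ringI) (auto intro: polys_add polys_mult)
  moreover have "F \<subseteq> ?I"
    using J(2) assms by blast
  ultimately show ?thesis
    using genideal_mpoly_ring(3)[OF assms(4)] by blast
qed

lemma polys_system: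
  assumes "f i \<in> carrier (diff_poly_ring K n)" "i \<in> {1..n}"
  shows "f i \<in> polys K (Xupto n (system_order n f))"
proof -
  have "snd v \<le> system_order n f" if "v \<in> mvars (f i)" for v
  proof -
    have "snd v \<le> diff_order (f i)"
      unfolding diff_order_def using that by (intro Max_ge) auto
    also have "\<dots> \<le> system_order n f"
      unfolding system_order_def using assms(2) by (intro Max_ge) auto
    finally show ?thesis .
  qed
  then show ?thesis
    using assms(1) by (fastforce simp: diff_poly_ring_def polys_def Xupto_def)
qed

lemma polys_fder:
  assumes "f i \<in> polys K (Xupto n e)" shows "fder f k i \<in> polys K (Xupto n (e + k))"
proof (induction k)
  case (Suc k)
  then show ?case
    using polys_total_deriv[OF Suc Xupto_Suc Xupto_mono] by (simp add: fder_def)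
qed (simp add: fder_def assms)

lemma Fbelow_polys:
  assumes "\<And>i. i \<in> {1..n} \<Longrightarrow> f i \<in> polys K (Xupto n e)" "e + j \<le> Suc m"
  shows "Fbelow n f j \<subseteq> polys K (Xupto n m)"
proof
  fix p assume "p \<in> Fbelow n f j"
  then obtain k i where "k < j" "i \<in> {1..n}" "p = fder f k i"
    by (auto simp: Fbelow_def)
  then show "p \<in> polys K (Xupto n m)"
    using polys_fder[OF assms(1)] polys_mono[OF Xupto_mono, of "e + k" m n] assms(2) by auto
qed

text \<open>For j = 0 there are no generators and the zero ideal of a domain is prime. For j = k + 1
  this is primality with all \<open>n\<close> equations differentiated \<open>k\<close> times, the
  rings agreeing because e + j - 1 = e + k.\<close>

lemma primeideal_prolongation:
  assumes "primality K n e f" "e \<ge> 1"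
  shows "primeideal (prolongation K n e f j) (Rring K n (e + j - 1))"
proof (cases j)
  case 0
  interpret R: "domain" "Rring K n (e - 1)"
    unfolding Rring_def by (rule domain_mpoly_ring)
  have "genideal (Rring K n (e - 1)) {} = {\<zero>\<^bsub>Rring K n (e - 1)\<^esub>}"
    using R.genideal_minimal[OF R.zeroideal, of "{}"] additive_subgroup.zero_closed[OF ideal.axioms(1)[OF R.genideal_ideal]]
    by auto
  then show ?thesis
    using 0 R.zeroprimeideal by (simp add: prolongation_def Fbelow_def)
next
  case (Suc k)
  have "Fbelow n f (Suc k) = Fbelow n f k \<union> fder f k ` {1..n}"
    unfolding Fbelow_def less_Suc_eq by blast
  then show ?thesis
    using assms Suc unfolding primality_def by (auto simp: prolongation_def)
qed

end

lemma set_spec_sequence: "set (spec_sequence n f W w i) = specialize W w ` Fbelow n f i"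
  by (force simp: spec_sequence_def Fbelow_def)

lemma total_deriv_Fbelow: "total_deriv ` Fbelow n f j \<subseteq> Fbelow n f (Suc j)"
proof
  fix p assume "p \<in> total_deriv ` Fbelow n f j"
  then obtain k i where "k < j" "i \<in> {1..n}" "p = fder f (Suc k) i"
    by (auto simp: Fbelow_def fder_def)
  then show "p \<in> Fbelow n f (Suc j)"
    unfolding Fbelow_def by blast
qed

lemma Fbelow_mono: "Fbelow n f j \<subseteq> Fbelow n f (Suc j)"
  unfolding Fbelow_def less_Suc_eq by blast

text \<open>A unit restricts to a unit, hence a constant, on every line in direction
  \<open>v\<close>. This rules out an eliminant that is the least common multiple of an empty
  family.\<close>

lemma mpderiv_unit_eval:
  assumes "p * c = 1" shows "meval y (mpderiv v p) = 0"
proof -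
  have "to_univ_at y v p * to_univ_at y v c = 1"
    using arg_cong[OF assms, of "to_univ_at y v"] by (simp add: to_univ_at_simps)
  then have "Polynomial.degree (to_univ_at y v p) = 0"
    by (metis dvd_triv_left is_unit_iff_degree dvd_0_left_iff one_neq_zero)
  then have "pderiv (to_univ_at y v p) = 0"
    by (simp add: pderiv_eq_0_iff)
  then have "poly (to_univ_at y v (mpderiv v p)) (y v) = 0"
    by (simp add: pderiv_to_univ_at)
  then show ?thesis
    by (simp add: poly_to_univ_at)
qed

theorem theorem12:
  fixes K :: "complex set"
    and n e \<sigma> d h :: nat
    and f :: "nat \<Rightarrow> nat dpoly"
    and U W Z :: "xvar set"
    and w :: "xvar \<Rightarrow> complex"
    and \<V> :: "(xvar \<Rightarrow> complex) set"
    and l :: "xvar mpoly"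
    and q P0 :: "xvar option mpoly"
    and a b :: "xvar \<Rightarrow> xvar option mpoly"
    and Pp :: "xvar \<Rightarrow> xvar mpoly set \<Rightarrow> xvar mpoly"
    and P :: "xvar \<Rightarrow> xvar mpoly"
    and G0 :: "(xvar option \<Rightarrow> complex) set"
    and \<epsilon> :: real
    and \<psi> :: "real \<Rightarrow> xvar option \<Rightarrow> complex"
    and \<phi> :: "real \<Rightarrow> xvar \<Rightarrow> complex"
  assumes K: "subfield K (cring_on UNIV)"
    and n: "n \<ge> 1"
    and f: "\<And>i. i \<in> {1..n} \<Longrightarrow> f i \<in> carrier (diff_poly_ring K n)"
    and e: "e = system_order n f" "e \<ge> 1"
    and prime: "primality K n e f"
    and qreg: "quasi_regular K n e f"
    and rank: "rank_hypothesis K n e f"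
    and index: "is_diff_index K n e f \<sigma>"
    and ord: "is_ideal_order K n f d"
    and U: "U \<subseteq> Xupto n (e - 1)" "card U = d"
      "vars_transcendence_basis K (Rring K n (e - 1)) (diff_ideal_upto K n f (e - 1)) U"
      "vars_transcendence_basis K (Rring K n e) (diff_ideal_upto K n f e) U"
    and W: "W \<subseteq> {1..n} \<times> {e + 1..e + \<sigma>}" "card W = n * e - d"
      "vars_transcendence_basis K (Rring K n (e + \<sigma>)) (prolongation K n e f (\<sigma> + 1)) (U \<union> W)"
    and Z: "Z = Xupto n (e + \<sigma>) - (U \<union> W)"
    and w: "\<exists>Y. zariski_open K W Y \<and> w \<in> Y \<and> (\<forall>w'\<in>Y. good_specialization K n e f \<sigma> U W w')"
    and V: "\<V> = spec_variety K n e f \<sigma> W w"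
    and resolution: "geometric_resolution K U Z \<V> l q a b"
    and P: "is_eliminant_family K U (Xupto n (e - 1) - U)
      (associated_primes (mpoly_ring K (Xupto n (e + \<sigma>) - W)) (spec_prolongation K n e f \<sigma> W w))
      Pp P"
    and P0: "h \<ge> 1" "is_G0_poly K U Z q a b (Xupto n (e - 1) - U) P h P0"
    and G0: "G0 = {y \<in> hypersurface U q. meval y P0 \<noteq> 0}"
    and \<epsilon>: "\<epsilon> > 0"
    and \<psi>_analytic: "\<And>y. y \<in> Uups U \<Longrightarrow> real_analytic_on (\<lambda>t. \<psi> t y) {-\<epsilon><..<\<epsilon>}"
    and \<psi>_solution: "classical_solution {-\<epsilon><..<\<epsilon>} (reduced_system U q a b) \<psi>"
    and \<psi>_G0: "\<And>t. t \<in> {-\<epsilon><..<\<epsilon>} \<Longrightarrow> \<psi> t \<in> G0"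
    and \<phi>: "\<And>t. \<phi> t = restrict (param_map U Z q a b (\<psi> t)) (Xupto n e)"
  shows "(\<forall>t\<in>{-\<epsilon><..<\<epsilon>}. \<psi> t \<in> param_domain U Z q b) \<and>
    (\<forall>i\<in>{1..n}. real_analytic_on (\<lambda>t. \<phi> t (i, 0)) {-\<epsilon><..<\<epsilon>}) \<and>
    classical_solution {-\<epsilon><..<\<epsilon>} (f ` {1..n}) (\<lambda>t i. \<phi> t (i, 0))"
proof -
  interpret const_field K
    using K by (rule const_field.intro)

  \<comment> \<open>Notation and the position of the sets of variables\<close>
  let ?T = "{-\<epsilon><..<\<epsilon>}" and ?q' = "mpderiv None q"
  let ?V = "Xupto n (e + \<sigma>) - W" and ?E = "Xupto n (e - 1)"
  let ?A = "?E - U"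
  let ?J = "spec_prolongation K n e f \<sigma> W w"
  let ?Ps = "associated_primes (mpoly_ring K ?V) ?J"
  let ?\<Delta> = "diff_ideal_upto K n f (e - 1)"
  define \<Phi> where "\<Phi> t = param_map U Z q a b (\<psi> t)" for t
  have f_polys: "f i \<in> polys K (Xupto n e)" if "i \<in> {1..n}" for i
    using polys_system[where f = f and i = i and n = n] f that e(1) by simp
  have E_e: "?E \<subseteq> Xupto n e" and e_V: "Xupto n e \<subseteq> ?V" and UW: "U \<inter> W = {}" and W_X: "W \<subseteq> Xupto n (e + \<sigma>)"
    using U(1) W(1) e(2) by (fastforce simp: Xupto_def)+
  have UZ: "U \<union> Z = ?V" "U \<inter> Z = {}"
    using Z UW U(1) E_e e_V by auto
  have fin: "finite (Xupto n j)" for j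
    by (simp add: Xupto_def)
  have finU: "finite U" and finZ: "finite Z"
    using finite_subset[OF U(1) fin] fin Z by auto
  have E_V: "?E \<subseteq> ?V"
    using E_e e_V by blast
  have w_K: "w \<in> W \<rightarrow> K" and good: "good_specialization K n e f \<sigma> U W w"
    using w by (auto simp: zariski_open_def)

  \<comment> \<open>The prolongation and its specialization\<close>
  have F: "Fbelow n f (Suc \<sigma>) \<subseteq> polys K (Xupto n (e + \<sigma>))"
    by (rule Fbelow_polys[OF f_polys]) simp_all
  have F\<sigma>: "Fbelow n f \<sigma> \<subseteq> polys K (Xupto n (e + \<sigma> - 1))"
    by (rule Fbelow_polys[OF f_polys]) simp_all
  have sF: "specialize W w ` Fbelow n f (Suc \<sigma>) \<subseteq> polys K ?V"
    using F w_K by (auto intro: polys_specialize)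
  have J_eq: "?J = genideal (mpoly_ring K ?V) (specialize W w ` Fbelow n f (Suc \<sigma>))"
    by (simp add: spec_prolongation_def)
  note J = genideal_mpoly_ring[OF sF, folded J_eq]
  \<comment> \<open>Specialization fixes polynomials free of \<open>W\<close>, so their membership
    in the unspecialized prolongation passes to \<open>?J\<close>.\<close>
  have in_J: "p \<in> ?J" if "p \<in> genideal (Rring K n (e + \<sigma>)) (Fbelow n f (Suc \<sigma>))" "mvars p \<inter> W = {}" for p
    using specialize_genideal[OF F w_K, of p] that by (simp add: J_eq Rring_def specialize_id)
  have no_W: "mvars p \<inter> W = {}" if "p \<in> polys K (Xupto n e)" for p
    using polys_mvars[OF that] e_V by blast

  \<comment> \<open>Associated primes of the specialized prolongation\<close>
  have radical: "radical_ideal (mpoly_ring K ?V) ?J"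
    and generic: "\<And>Q. Q \<in> minimal_primes (Rring K n (e + \<sigma>)) (genideal (Rring K n (e + \<sigma>))
      (Fbelow n f (Suc \<sigma>) \<union> (\<lambda>v. mvar v - mconst (w v)) ` W)) \<Longrightarrow> Q \<inter> polys K U \<subseteq> {0}"
  proof -
    have "\<sigma> + 1 \<in> {1..\<sigma> + 1}"
      by simp
    note * = good[unfolded good_specialization_def, rule_format, OF this]
    let ?gs = "spec_sequence n f W w (\<sigma> + 1)"
    \<comment> \<open>The longest initial segment is the whole sequence, and it generates
      \<open>?J\<close>.\<close>
    have "radical_ideal (mpoly_ring K ?V) (genideal (mpoly_ring K ?V) (set (take (length ?gs) ?gs)))"
      using * unfolding reduced_regular_sequence_def by blast
    then show "radical_ideal (mpoly_ring K ?V) ?J"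
      by (simp add: set_spec_sequence J_eq)
    show "\<And>Q. Q \<in> minimal_primes (Rring K n (e + \<sigma>)) (genideal (Rring K n (e + \<sigma>))
      (Fbelow n f (Suc \<sigma>) \<union> (\<lambda>v. mvar v - mconst (w v)) ` W)) \<Longrightarrow> Q \<inter> polys K U \<subseteq> {0}"
      using * by simp
  qed
  have Ps: "P \<inter> polys K U \<subseteq> {0}" "ideal P (mpoly_ring K ?V)" "?J \<subseteq> P" if "P \<in> ?Ps" for P
  proof -
    have min: "P \<in> minimal_primes (mpoly_ring K ?V) ?J"
      using radical that by (rule associated_prime_minimal)
    then show "ideal P (mpoly_ring K ?V)" "?J \<subseteq> P"
      by (auto simp: minimal_primes_def primeideal_mpoly_ring_iff)
    \<comment> \<open>The pull-back is a minimal prime in the ring with \<open>W\<close>, where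
      genericity applies. Specialization fixes K[U], so the pull-back and \<open>P\<close> meet K[U]
      in the same set.\<close>
    have "{p \<in> polys K (Xupto n (e + \<sigma>)). specialize W w p \<in> P} \<inter> polys K U \<subseteq> {0}"
      using minimal_prime_specialize[OF F w_K W_X] min by (intro generic) (simp add: J_eq Rring_def)
    moreover have "specialize W w p = p" if "p \<in> polys K U" for p
      using polys_mvars[OF that] UW by (intro specialize_id) blast
    moreover have "polys K U \<subseteq> polys K (Xupto n (e + \<sigma>))"
      using UZ by (intro polys_mono) blast
    ultimately show "P \<inter> polys K U \<subseteq> {0}"
      by auto
  qed

  \<comment> \<open>The differential ideal in order at most e - 1, and the eliminants\<close>
  have \<Delta>_eq: "?\<Delta> = prolongation K n e f \<sigma> \<inter> polys K ?E"
    using index by (simp add: is_diff_index_def is_arg_min_def)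
  have \<Delta>_prime: "primeideal ?\<Delta> (mpoly_ring K ?E)"
    unfolding \<Delta>_eq using primeideal_prolongation[OF prime e(2), of \<sigma>] e(2)
    by (intro primeideal_contraction[where V' = "Xupto n (e + \<sigma> - 1)"] Xupto_mono) (simp_all add: Rring_def)
  have \<Delta>_J: "?\<Delta> \<subseteq> ?J" and \<Delta>_deriv: "\<And>p. p \<in> ?\<Delta> \<Longrightarrow> total_deriv p \<in> ?J"
  proof -
    fix p assume "p \<in> ?\<Delta>"
    then have p: "p \<in> genideal (mpoly_ring K (Xupto n (e + \<sigma> - 1))) (Fbelow n f \<sigma>)" "p \<in> polys K ?E"
      unfolding \<Delta>_eq prolongation_def Rring_def by blast+
    \<comment> \<open>The derivative has order at most e, while \<open>W\<close> starts at order e +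
      1, so specialization does not change it.\<close>
    have "total_deriv p \<in> polys K (Xupto n (Suc (e - 1)))"
      using p(2) by (rule polys_total_deriv) (simp_all add: Xupto_Suc Xupto_mono)
    moreover have "total_deriv p \<in> genideal (mpoly_ring K (Xupto n (e + \<sigma>))) (Fbelow n f (Suc \<sigma>))"
      using p(1) Xupto_Suc[of n "e + \<sigma> - 1"] e(2)
      by (intro total_deriv_genideal[OF F\<sigma> Fbelow_mono total_deriv_Fbelow F]) (simp_all add: Xupto_mono)
    ultimately show "total_deriv p \<in> ?J"
      using e(2) by (intro in_J no_W) (simp_all add: Rring_def)
  next
    have "genideal (mpoly_ring K (Xupto n (e + \<sigma> - 1))) (Fbelow n f \<sigma>) \<subseteq>
        genideal (mpoly_ring K (Xupto n (e + \<sigma>))) (Fbelow n f (Suc \<sigma>))"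
      by (intro genideal_mono Fbelow_mono F F\<sigma> Xupto_mono) simp
    moreover have "mvars p \<inter> W = {}" if "p \<in> polys K ?E" for p
      using that polys_mono[OF E_e] no_W by blast
    ultimately show "?\<Delta> \<subseteq> ?J"
      using in_J unfolding \<Delta>_eq prolongation_def Rring_def by blast
  qed
  have eliminant_\<Delta>: "P x \<in> ?\<Delta>" if x: "x \<in> ?A" and ne: "?Ps \<noteq> {}" for x
  proof -
    obtain \<pp> where \<pp>: "\<pp> \<in> ?Ps"
      using ne by blast
    have sub: "polys K (insert x U) \<subseteq> polys K ?E"
      using x U(1) by (intro polys_mono) auto
    have *: "Pp x \<pp> \<in> polys K (insert x U)" "Pp x \<pp> \<in> \<pp>" "Pp x \<pp> divides\<^bsub>mpoly_ring K (insert x U)\<^esub> P x"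
      using P x \<pp> unfolding is_eliminant_family_def is_lcm_of_def by auto
    \<comment> \<open>The prime \<pp> contains \<open>?J\<close>, hence \<open>?\<Delta>\<close>,
      and meets K[U] only in 0; \<open>U\<close> being a transcendence basis modulo
      \<open>?\<Delta>\<close> does the rest.\<close>
    have "\<pp> \<inter> polys K ?E \<subseteq> ?\<Delta>"
      using Ps[OF \<pp>] U(1) E_V \<Delta>_J
      by (intro ideal_Int_polys_subset[OF \<Delta>_prime _ E_V U(3)[unfolded Rring_def]]) auto
    then have "Pp x \<pp> \<in> ?\<Delta>"
      using * sub by blast
    \<comment> \<open>As \<open>P x\<close> is a common multiple, one associated prime is enough to
      place it in \<open>?\<Delta>\<close>.\<close>
    moreover obtain c where "c \<in> polys K (insert x U)" "P x = Pp x \<pp> * c"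
      using *(3) by (auto simp: factor_def)
    ultimately show ?thesis
      using ideal_mpoly_ringD(4)[of ?\<Delta> ?E c "Pp x \<pp>"] \<Delta>_prime sub
      by (auto simp: primeideal_mpoly_ring_iff mult.commute)
  qed

  \<comment> \<open>Consequences of lying in \<open>G0\<close>, pointwise along the curve\<close>
  have \<psi>: "\<psi> t \<in> param_domain U Z q b" "meval (\<psi> t) q = 0" "meval (\<psi> t) P0 \<noteq> 0" if t: "t \<in> ?T" for t
  proof -
    have *: "\<psi> t \<in> affine_space (Uups U)" "meval (\<psi> t) q = 0" "meval (\<psi> t) P0 \<noteq> 0"
      using \<psi>_G0[OF t] by (auto simp: G0 hypersurface_def zero_set_def)
    then show "meval (\<psi> t) q = 0" "meval (\<psi> t) P0 \<noteq> 0"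
      by blast+
    \<comment> \<open>Divisibility of \<open>P0\<close> by \<open>B q'\<close> is what puts points
      with nonzero \<open>P0\<close> into the domain of \<Phi>.\<close>
    obtain c where "P0 = prod b Z * ?q' * c"
      using P0(2) by (auto simp: is_G0_poly_def factor_def)
    then show "\<psi> t \<in> param_domain U Z q b"
      using * finZ by (auto simp: param_domain_def)
  qed
  have P_deriv: "meval (\<Phi> t) (mpderiv x (P x)) \<noteq> 0" if "t \<in> ?T" "x \<in> ?A" for t x
  proof -
    have "(\<Prod>x\<in>?A. meval (\<Phi> t) (mpderiv x (P x))) \<noteq> 0"
      using P0(2) \<psi>[OF that(1)] by (auto simp: is_G0_poly_def \<Phi>_def)
    then show ?thesis
      using that(2) fin by simp
  qed
  have P_\<Delta>: "P x \<in> ?\<Delta>" if x: "x \<in> ?A" for x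
  proof (cases "?Ps = {}")
    case True
    \<comment> \<open>Without associated primes \<open>P x\<close> is a least common multiple of no
      polynomials, hence a unit with zero derivative. This contradicts the nonvanishing of that
      derivative at t = 0.\<close>
    have "P x divides\<^bsub>mpoly_ring K (insert x U)\<^esub> 1"
      using P x True unfolding is_eliminant_family_def is_lcm_of_def by auto
    then obtain c where "P x * c = 1"
      by (auto simp: factor_def)
    then have "meval (\<Phi> 0) (mpderiv x (P x)) = 0"
      by (rule mpderiv_unit_eval)
    then show ?thesis
      using P_deriv[of 0 x] \<epsilon> x by simp
  next
    case False
    then show ?thesis
      using eliminant_\<Delta> x by blast
  qed
  \<comment> \<open>\<open>\<V>\<close> is the zero set of \<open>?J\<close>, so \<open>?J\<close>
    lies in its vanishing ideal, and the resolution transfers this to every point \<Phi>(\<psi>(t)),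
    generic or not.\<close>
  have J_zero: "meval (\<Phi> t) g = 0" if "t \<in> ?T" "g \<in> ?J" for t g
  proof -
    have "g \<in> vanishing_ideal K (U \<union> Z) \<V>"
      using that(2) ideal_mpoly_ringD(1)[OF J(1)] unfolding UZ(1)
      by (auto simp: vanishing_ideal_def V spec_variety_def zero_set_def)
    then show ?thesis
      unfolding \<Phi>_def
      using meval_param_map_eq_0[OF finZ UZ(2) resolution \<psi>(1)[OF that(1)] \<psi>(2)[OF that(1)]] by blast
  qed

  \<comment> \<open>Analyticity of the lifted curve and the equations of the reduced system\<close>
  have germ: "hol_germ (\<lambda>t. \<psi> t y) t" if "t \<in> ?T" "y \<in> Uups U" for t y
    using \<psi>_analytic[OF that(2)] that(1) by (simp add: real_analytic_on_iff)
  have resU: "a z \<in> polys UNIV (Uups U)" "b z \<in> polys UNIV (Uups U)" if "z \<in> Z" for z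
  proof -
    have "a z \<in> polys K (Uups U)" "b z \<in> polys K (Some ` U)"
      using resolution that by (simp_all add: geometric_resolution_def)
    then show "a z \<in> polys UNIV (Uups U)" "b z \<in> polys UNIV (Uups U)"
      by (auto simp: polys_def Uups_def)
  qed
  have "q \<in> polys K (Uups U)"
    using resolution by (simp add: geometric_resolution_def KU_minimal_poly_def)
  then have q_UNIV: "?q' \<in> polys UNIV (Uups U)"
    using polys_mpderiv[of q "Uups U" None] by (simp add: polys_def)
  have \<Phi>_germ: "hol_germ (\<lambda>t. \<Phi> t v) t" if t: "t \<in> ?T" and v: "v \<in> ?V" for t v
  proof (cases "v \<in> U")
    case True
    then have "(\<lambda>t. \<Phi> t v) = (\<lambda>t. \<psi> t (Some v))"
      by (simp add: \<Phi>_def param_map_def)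
    then show ?thesis
      using germ[OF t, of "Some v"] True by (simp add: Uups_def)
  next
    case False
    with v have z: "v \<in> Z"
      using UZ by blast
    have "(\<lambda>t. \<Phi> t v) = (\<lambda>t. meval (\<psi> t) (a v) / (meval (\<psi> t) (b v) * meval (\<psi> t) ?q'))"
      using False z by (simp add: \<Phi>_def param_map_def)
    moreover have "meval (\<psi> t) (b v) * meval (\<psi> t) ?q' \<noteq> 0"
      using \<psi>(1)[OF t] z by (simp add: param_domain_def)
    ultimately show ?thesis
      using resU[OF z] q_UNIV germ[OF t]
      by (auto intro!: hol_germ_divide hol_germ_mult hol_germ_meval[where V = "Uups U"])
  qed
  have d\<psi>: "vector_derivative (\<lambda>t. \<psi> t (Some u)) (at t) = \<Phi> t (dvar u)" if t: "t \<in> ?T" and u: "u \<in> U" for t u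
  proof -
    let ?\<rho> = "\<lambda>(x, j). iter_deriv j (\<lambda>t. \<psi> t x) t"
    have sol: "meval ?\<rho> g = 0" if "g \<in> reduced_system U q a b" for g
      using \<psi>_solution t that unfolding classical_solution_def by blast
    have ord0: "meval ?\<rho> (order0 p) = meval (\<psi> t) p" for p
      by (simp add: order0_def meval_msubst)
    \<comment> \<open>The order of \<open>dvar u\<close> is at most e, below that of every variable
      in \<open>W\<close>, which leaves only \<open>U\<close> and \<open>Z\<close>.\<close>
    have du: "dvar u \<in> U \<union> Z"
    proof -
      have "dvar u \<in> Xupto n (Suc (e - 1))"
        using u U(1) Xupto_Suc[of n "e - 1"] unfolding dvar_def by blast
      then show ?thesis
        using e(2) e_V unfolding UZ(1) by auto
    qed
    show ?thesis
    proof (cases "dvar u \<in> U")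
      case True
      then have "mvar (Some u, 1) - mvar (Some (dvar u), 0) \<in> reduced_system U q a b"
        using u unfolding reduced_system_def by blast
      from sol[OF this] show ?thesis
        using True by (simp add: \<Phi>_def param_map_def)
    next
      case False
      then have "order0 (b (dvar u) * ?q') * mvar (Some u, 1) - order0 (a (dvar u)) \<in> reduced_system U q a b"
        using u unfolding reduced_system_def by blast
      from sol[OF this] have "meval (\<psi> t) (b (dvar u)) * meval (\<psi> t) ?q' *
          vector_derivative (\<lambda>t. \<psi> t (Some u)) (at t) = meval (\<psi> t) (a (dvar u))"
        by (simp add: ord0)
      moreover have "meval (\<psi> t) (b (dvar u)) \<noteq> 0" "meval (\<psi> t) ?q' \<noteq> 0"
        using \<psi>(1)[OF t] du False by (auto simp: param_domain_def)
      ultimately show ?thesis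
        using False du by (simp add: \<Phi>_def param_map_def field_simps)
    qed
  qed

  \<comment> \<open>Derivatives of the coordinates of order below e\<close>
  have dU: "((\<lambda>t. \<Phi> t u) has_vector_derivative \<Phi> t (dvar u)) (at t)" if t: "t \<in> ?T" and u: "u \<in> U" for t u
  proof -
    \<comment> \<open>The reduced system only gives the value of \<open>vector_derivative\<close>;
      that a derivative exists comes from analyticity.\<close>
    obtain D where D: "((\<lambda>t. \<Phi> t u) has_vector_derivative D) (at t)"
      using \<Phi>_germ[OF t, of u] u UZ hol_germ_imp_has_vector_derivative by blast
    have "(\<lambda>t. \<Phi> t u) = (\<lambda>t. \<psi> t (Some u))"
      using u by (simp add: \<Phi>_def param_map_def)
    then have "D = \<Phi> t (dvar u)"
      using d\<psi>[OF t u] vector_derivative_at[OF D] by simp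
    with D show ?thesis
      by simp
  qed
  have dA: "((\<lambda>t. \<Phi> t x) has_vector_derivative \<Phi> t (dvar x)) (at t)" if t: "t \<in> ?T" and x: "x \<in> ?A" for t x
  proof -
    obtain D where D: "((\<lambda>t. \<Phi> t x) has_vector_derivative D) (at t)"
      using \<Phi>_germ[OF t, of x] x E_V hol_germ_imp_has_vector_derivative by blast
    \<comment> \<open>The true velocities of the variables of \<open>P x\<close>: the unknown one
      for \<open>x\<close>, the ones already identified for \<open>U\<close>.\<close>
    define \<rho>' where "\<rho>' v = (if v = x then D else \<Phi> t (dvar v))" for v
    have Px: "P x \<in> polys K (insert x U)"
      using P x by (auto simp: is_eliminant_family_def is_lcm_of_def)
    then have "((\<lambda>t. meval (\<Phi> t) (P x)) has_vector_derivative
        (\<Sum>v\<in>insert x U. meval (\<Phi> t) (mpderiv v (P x)) * \<rho>' v)) (at t)"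
      using D dU[OF t] finU x by (intro has_vector_derivative_meval) (auto simp: \<rho>'_def polys_def)
    \<comment> \<open>\<open>P x\<close> vanishes along the whole open interval, not just at
      \<open>t\<close>, so its derivative is zero.\<close>
    moreover have "((\<lambda>t. meval (\<Phi> t) (P x)) has_vector_derivative 0) (at t)"
      by (rule has_vector_derivative_transform_within_open[OF has_vector_derivative_const[of 0], where S = ?T])
        (use P_\<Delta>[OF x] \<Delta>_J J_zero t in auto)
    ultimately have sum1: "(\<Sum>v\<in>insert x U. meval (\<Phi> t) (mpderiv v (P x)) * \<rho>' v) = 0"
      by (rule vector_derivative_unique_at)
    \<comment> \<open>The same linear relation with \<open>\<Phi> t (dvar x)\<close> in place of the
      unknown velocity \<open>D\<close>, read off the total derivative of \<open>P x\<close>.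
      Subtracting the two leaves only the term of \<open>x\<close>.\<close>
    have sum2: "(\<Sum>v\<in>insert x U. meval (\<Phi> t) (mpderiv v (P x)) * \<Phi> t (dvar v)) = 0"
    proof -
      have "total_deriv (P x) = (\<Sum>v\<in>insert x U. mpderiv v (P x) * mvar (dvar v))"
        unfolding dvar_def using finU polys_mvars[OF Px] by (intro total_deriv_superset) simp_all
      then show ?thesis
        using J_zero[OF t \<Delta>_deriv[OF P_\<Delta>[OF x]]] by simp
    qed
    have sum3: "(\<Sum>v\<in>U. meval (\<Phi> t) (mpderiv v (P x)) * \<rho>' v) = (\<Sum>v\<in>U. meval (\<Phi> t) (mpderiv v (P x)) * \<Phi> t (dvar v))"
      using x by (intro sum.cong) (auto simp: \<rho>'_def)
    have "x \<notin> U"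
      using x by blast
    have "meval (\<Phi> t) (mpderiv x (P x)) * \<rho>' x = meval (\<Phi> t) (mpderiv x (P x)) * \<Phi> t (dvar x)"
      using trans[OF sum1 sum2[symmetric]]
      unfolding sum.insert[OF finU \<open>x \<notin> U\<close>] sum3 add_right_cancel .
    then have "meval (\<Phi> t) (mpderiv x (P x)) * D = meval (\<Phi> t) (mpderiv x (P x)) * \<Phi> t (dvar x)"
      by (simp only: \<rho>'_def if_True refl)
    then show ?thesis
      using P_deriv[OF t x] D by simp
  qed

  \<comment> \<open>Blocks of coordinates as iterated derivatives, and the equations of
    \<Sigma>\<close>
  have \<phi>_eq: "\<phi> t v = \<Phi> t v" if "v \<in> Xupto n e" for t v
    using that by (simp add: \<phi> \<Phi>_def)
  have d\<phi>: "((\<lambda>t. \<phi> t (i, j)) has_vector_derivative \<phi> t (i, Suc j)) (at t)"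
    if "i \<in> {1..n}" "j < e" "t \<in> ?T" for i j t
  proof -
    have "(i, j) \<in> ?E" "(i, j) \<in> Xupto n e" "(i, Suc j) \<in> Xupto n e"
      using that by (auto simp: Xupto_def)
    moreover have "dvar (i, j) = (i, Suc j)"
      by (simp add: dvar_def)
    ultimately show ?thesis
      using dU[OF that(3), of "(i, j)"] dA[OF that(3), of "(i, j)"] by (cases "(i, j) \<in> U") (simp_all add: \<phi>_eq)
  qed
  have \<phi>_iter: "iter_deriv j (\<lambda>t. \<phi> t (i, 0)) t = \<Phi> t (i, j)"
    if "i \<in> {1..n}" "j \<le> e" "t \<in> ?T" for i j t
  proof -
    have "iter_deriv j (\<lambda>t. \<phi> t (i, 0)) t = \<phi> t (i, j)"
      by (rule iter_deriv_eq[where x = "\<lambda>j t. \<phi> t (i, j)", OF open_greaterThanLessThan d\<phi>[OF that(1)] that(2,3)])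
    also have "\<dots> = \<Phi> t (i, j)"
      using that(1,2) by (intro \<phi>_eq) (simp add: Xupto_def)
    finally show ?thesis .
  qed
  have \<phi>_diff: "iter_deriv j (\<lambda>t. \<phi> t (i, 0)) differentiable (at t)"
    if "i \<in> {1..n}" "j < e" "t \<in> ?T" for i j t
    by (rule iter_deriv_differentiable[where x = "\<lambda>j t. \<phi> t (i, j)", OF open_greaterThanLessThan d\<phi>[OF that(1)] that(2,3)])
  have "real_analytic_on (\<lambda>t. \<phi> t (i, 0)) ?T" if "i \<in> {1..n}" for i
  proof -
    have "(i, 0) \<in> Xupto n e"
      using that by (simp add: Xupto_def)
    then show ?thesis
      using \<Phi>_germ e_V by (auto simp: real_analytic_on_iff \<phi>_eq)
  qed
  moreover have "classical_solution ?T (f ` {1..n}) (\<lambda>t i. \<phi> t (i, 0))"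
    unfolding classical_solution_def
  proof (intro ballI)
    fix t g assume t: "t \<in> ?T" and "g \<in> f ` {1..n}"
    then obtain k where k: "k \<in> {1..n}" "g = f k"
      by blast
    have vars: "i \<in> {1..n} \<and> j \<le> e" if "(i, j) \<in> mvars g" for i j
      using that polys_mvars[OF f_polys[OF k(1)]] k(2) by (auto simp: Xupto_def)
    \<comment> \<open>An equation is its own derivative of order 0, hence a generator of the
      prolongation; being of order at most e, it survives specialization unchanged.\<close>
    have "fder f 0 k \<in> Fbelow n f (Suc \<sigma>)"
      unfolding Fbelow_def using k(1) by blast
    then have "f k \<in> Fbelow n f (Suc \<sigma>)"
      by (simp add: fder_def)
    then have "f k \<in> ?J"
      using in_J[of "f k"] genideal_mpoly_ring(2)[OF F] no_W[OF f_polys[OF k(1)]] by (auto simp: Rring_def)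
    then have "meval (\<Phi> t) g = 0"
      using J_zero[OF t] k by simp
    moreover have "meval (\<lambda>(i, j). iter_deriv j (\<lambda>t. \<phi> t (i, 0)) t) g = meval (\<Phi> t) g"
      using \<phi>_iter vars t by (intro meval_cong) auto
    ultimately show "(\<forall>(i, j)\<in>mvars g. \<forall>m<j. iter_deriv m (\<lambda>t. \<phi> t (i, 0)) differentiable (at t)) \<and>
        meval (\<lambda>(i, j). iter_deriv j (\<lambda>t. \<phi> t (i, 0)) t) g = 0"
      using vars t by (auto intro!: \<phi>_diff dest!: vars)
  qed
  ultimately show ?thesis
    using \<psi>(1) by blast
qed

end
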